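(* Let $l>0$, $a\neq0$ and $m\ge m_{\rm ex}$, and consider the rotating Dymnikova spacetime, i.e. the G\"urses-G\"ursey metric $$ds^2=-\Bigl(1-\frac{2M(r)r}{\Sigma}\Bigr)dt^2-\frac{4aM(r)r\sin^2\theta}{\Sigma}\,dt\,d\phi+\frac{\Sigma}{\Delta}dr^2+\Sigma\, d\theta^2+\Bigl(r^2+a^2+\frac{2a^2M(r)r\sin^2\theta}{\Sigma}\Bigr)\sin^2\theta\, d\phi^2,$$ $\Sigma=r^2+a^2\cos^2\theta$, $\Delta(r)=r^2+a^2-2rM(r)$, with $$M(r)=\frac{2m}{\pi}\left\{\arctan\left(\frac rl\right)-\frac{lr}{r^2+l^2}\right\},$$ where $m_{\rm ex}>0$ is the minimum over $r>0$ of $$m_{\rm h}(r)=\frac{\pi(r^2+a^2)}{4r}\left\{\arctan\left(\frac rl\right)-\frac{lr}{r^2+l^2}\right\}^{-1}.$$ Let $r_2$ be the largest positive root of $\Delta$ (the radius of the event horizon). Then the effective energy-momentum tensor $\tilde T_{\mu\nu}:=G_{\mu\nu}$ satisfies the dominant energy condition at every point with $r\ge\sqrt{|al|}$, and $\sqrt{|al|}<r_2$. Consequently the dominant energy condition is satisfied on and outside the event horizon, i.e. in the whole region $r\ge r_2$.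
   Context: Signature $(-,+,+,+)$; $G_{\mu\nu}$ is the Einstein tensor (units $c=8\pi G=1$). Dominant energy condition at a point: for every timelike vector $v^\mu$, $\tilde T_{\mu\nu}v^\mu v^\nu\ge0$ and $J_\mu J^\mu\le0$, where $J^\mu:=-\tilde T^\mu{}_\nu v^\nu$. The equation $\Delta(r)=0$ with $r>0$ is equivalent to $m=m_{\rm h}(r)$, and the spacetime is a black hole exactly when $m\ge m_{\rm ex}$. The hypersurface $\Delta=0$ is only a coordinate singularity: where $rM(r)\ge0$ the metric can be rewritten in Doran coordinates $(\bar t,r,\theta,\varphi)$, in which it is regular across $\Delta=0$: $$ds^2=-d\bar t^2+\Sigma\, d\theta^2+(r^2+a^2)\sin^2\theta\, d\varphi^2+\frac{\Sigma}{r^2+a^2}\Bigl\{dr+\frac{\sqrt{2M(r)r(r^2+a^2)}}{\Sigma}(d\bar t-a\sin^2\theta\, d\varphi)\Bigr\}^2,$$ and $\tilde T_{\mu\nu}$ on the horizon is that of this extension. *)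

theory Defs
  imports "HOL-Analysis.Analysis"
begin

section \<open>Curvature of a metric given in coordinates\<close>

text \<open>A metric on a coordinate chart is a function assigning to the coordinates \<open>x\<close> of a point the
  symmetric matrix of components \<open>g\<^sub>i\<^sub>j\<close>. Signature is \<open>(-,+,+,+)\<close> and the sign
  of the Ricci tensor is the one for which round spheres have positive Ricci curvature.\<close>

definition pd :: "'n::finite \<Rightarrow> (real^'n \<Rightarrow> real) \<Rightarrow> real^'n \<Rightarrow> real" where
  "pd k f x = deriv (\<lambda>s. f (x + s *\<^sub>R axis k 1)) 0"

definition christoffel ::
  "(real^'n \<Rightarrow> real^'n^'n) \<Rightarrow> 'n::finite \<Rightarrow> 'n \<Rightarrow> 'n \<Rightarrow> real^'n \<Rightarrow> real" where
  "christoffel g i j k x =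
     (\<Sum>p\<in>UNIV. matrix_inv (g x) $ i $ p *
        (pd j (\<lambda>y. g y $ p $ k) x + pd k (\<lambda>y. g y $ p $ j) x - pd p (\<lambda>y. g y $ j $ k) x)) / 2"

definition ricci :: "(real^'n \<Rightarrow> real^'n^'n) \<Rightarrow> real^'n \<Rightarrow> real^'n^'n::finite" where
  "ricci g x = (\<chi> j k.
     (\<Sum>i\<in>UNIV. pd i (christoffel g i j k) x) - (\<Sum>i\<in>UNIV. pd k (christoffel g i i j) x)
     + (\<Sum>i\<in>UNIV. \<Sum>p\<in>UNIV. christoffel g i i p x * christoffel g p j k x)
     - (\<Sum>i\<in>UNIV. \<Sum>p\<in>UNIV. christoffel g i k p x * christoffel g p i j x))"

definition scalar_curvature :: "(real^'n \<Rightarrow> real^'n^'n) \<Rightarrow> real^'n::finite \<Rightarrow> real" where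
  "scalar_curvature g x = (\<Sum>j\<in>UNIV. \<Sum>k\<in>UNIV. matrix_inv (g x) $ j $ k * ricci g x $ j $ k)"

definition einstein :: "(real^'n \<Rightarrow> real^'n^'n) \<Rightarrow> real^'n \<Rightarrow> real^'n^'n::finite" where
  "einstein g x = ricci g x - (scalar_curvature g x / 2) *\<^sub>R g x"

definition dominant_energy_condition :: "real^'n^'n \<Rightarrow> real^'n^'n::finite \<Rightarrow> bool" where
  "dominant_energy_condition g T \<longleftrightarrow>
     (\<forall>v. v \<bullet> (g *v v) < 0 \<longrightarrow>
        v \<bullet> (T *v v) \<ge> 0 \<and>
        (let J = - ((matrix_inv g ** T) *v v) in J \<bullet> (g *v J) \<le> 0))"

text \<open>The condition for the effective energy-momentum tensor \<open>T = G\<close> of the metric \<open>g\<close> at \<open>x\<close>.\<close>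

definition effective_DEC :: "(real^'n \<Rightarrow> real^'n^'n) \<Rightarrow> real^'n::finite \<Rightarrow> bool" where
  "effective_DEC g x \<longleftrightarrow> dominant_energy_condition (g x) (einstein g x)"


section \<open>The Gurses-Gursey metric\<close>

text \<open>Line elements are written with symmetric products of covectors, so that
  \<open>c *\<^sub>R (\<alpha> \<odot> \<beta>)\<close> is the term \<open>c \<alpha> \<beta>\<close> of \<open>ds\<^sup>2\<close>
  (a mixed term thus contributes \<open>c/2\<close> to each of the two off-diagonal components).\<close>

definition symprod :: "real^'n \<Rightarrow> real^'n \<Rightarrow> real^'n^'n" (infixl "\<odot>" 77) where
  "\<alpha> \<odot> \<beta> = (\<chi> i j. (\<alpha> $ i * \<beta> $ j + \<beta> $ i * \<alpha> $ j) / 2)"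

abbreviation dx :: "4 \<Rightarrow> real^4" where
  "dx k \<equiv> axis k 1"

definition Sigma_fn :: "real \<Rightarrow> real \<Rightarrow> real \<Rightarrow> real" where
  "Sigma_fn a r \<theta> = r\<^sup>2 + a\<^sup>2 * (cos \<theta>)\<^sup>2"

definition Delta_fn :: "(real \<Rightarrow> real) \<Rightarrow> real \<Rightarrow> real \<Rightarrow> real" where
  "Delta_fn M a r = r\<^sup>2 + a\<^sup>2 - 2 * r * M r"

text \<open>Boyer-Lindquist coordinates \<open>(t, r, \<theta>, \<phi>)\<close>.\<close>

definition gg_metric :: "(real \<Rightarrow> real) \<Rightarrow> real \<Rightarrow> real^4 \<Rightarrow> real^4^4" where
  "gg_metric M a x = (let r = x $ 2; \<theta> = x $ 3; S = Sigma_fn a r \<theta> in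
     - (1 - 2 * M r * r / S) *\<^sub>R (dx 1 \<odot> dx 1)
     - (4 * a * M r * r * (sin \<theta>)\<^sup>2 / S) *\<^sub>R (dx 1 \<odot> dx 4)
     + (S / Delta_fn M a r) *\<^sub>R (dx 2 \<odot> dx 2)
     + S *\<^sub>R (dx 3 \<odot> dx 3)
     + ((r\<^sup>2 + a\<^sup>2 + 2 * a\<^sup>2 * M r * r * (sin \<theta>)\<^sup>2 / S) * (sin \<theta>)\<^sup>2) *\<^sub>R (dx 4 \<odot> dx 4))"

text \<open>Doran coordinates \<open>(t, r, \<theta>, \<phi>)\<close>, regular across \<open>\<Delta> = 0\<close>.\<close>

definition doran_metric :: "(real \<Rightarrow> real) \<Rightarrow> real \<Rightarrow> real^4 \<Rightarrow> real^4^4" where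
  "doran_metric M a x = (let r = x $ 2; \<theta> = x $ 3; S = Sigma_fn a r \<theta>;
       \<omega> = dx 2 + (sqrt (2 * M r * r * (r\<^sup>2 + a\<^sup>2)) / S) *\<^sub>R
             (dx 1 - (a * (sin \<theta>)\<^sup>2) *\<^sub>R dx 4) in
     - (dx 1 \<odot> dx 1)
     + S *\<^sub>R (dx 3 \<odot> dx 3)
     + ((r\<^sup>2 + a\<^sup>2) * (sin \<theta>)\<^sup>2) *\<^sub>R (dx 4 \<odot> dx 4)
     + (S / (r\<^sup>2 + a\<^sup>2)) *\<^sub>R (\<omega> \<odot> \<omega>))"

text \<open>Spherical angles degenerate on the rotation axis. A regular chart there is
  \<open>(t, r, X, Y)\<close> with \<open>X = sin \<theta> cos \<phi>\<close>, \<open>Y = sin \<theta> sin \<phi>\<close>,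
  \<open>X\<^sup>2 + Y\<^sup>2 < 1\<close>, on the hemisphere \<open>cos \<theta> > 0\<close> or \<open>cos \<theta> < 0\<close>. Since
  \<open>sin\<^sup>2\<theta> d\<phi> = X dY - Y dX\<close>, \<open>sin \<theta> cos \<theta> d\<theta> = X dX + Y dY\<close> and
  \<open>\<Sigma> d\<theta>\<^sup>2 + (r\<^sup>2 + a\<^sup>2) sin\<^sup>2\<theta> d\<phi>\<^sup>2 =
   (r\<^sup>2 + a\<^sup>2) (dX\<^sup>2 + dY\<^sup>2) + r\<^sup>2 / (1 - X\<^sup>2 - Y\<^sup>2) (X dX + Y dY)\<^sup>2\<close>,
  the Doran metric takes the following form, the same on both hemispheres.\<close>

definition doran_polar_metric :: "(real \<Rightarrow> real) \<Rightarrow> real \<Rightarrow> real^4 \<Rightarrow> real^4^4" where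
  "doran_polar_metric M a x = (let r = x $ 2; X = x $ 3; Y = x $ 4;
       S = r\<^sup>2 + a\<^sup>2 * (1 - X\<^sup>2 - Y\<^sup>2);
       \<rho> = X *\<^sub>R dx 3 + Y *\<^sub>R dx 4;
       \<omega> = dx 2 + (sqrt (2 * M r * r * (r\<^sup>2 + a\<^sup>2)) / S) *\<^sub>R
             (dx 1 - a *\<^sub>R (X *\<^sub>R dx 4 - Y *\<^sub>R dx 3)) in
     - (dx 1 \<odot> dx 1)
     + (r\<^sup>2 + a\<^sup>2) *\<^sub>R (dx 3 \<odot> dx 3 + dx 4 \<odot> dx 4)
     + (r\<^sup>2 / (1 - X\<^sup>2 - Y\<^sup>2)) *\<^sub>R (\<rho> \<odot> \<rho>)
     + (S / (r\<^sup>2 + a\<^sup>2)) *\<^sub>R (\<omega> \<odot> \<omega>))"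

text \<open>The dominant energy condition at every spacetime point whose radial coordinate lies in \<open>R\<close>,
  a set of positive radii: in the Boyer-Lindquist chart off the horizons and off the axis; in the
  Doran chart off the axis, including the horizons \<open>\<Delta> = 0\<close>; and on the axis itself (both
  poles, including the poles of the horizons) in the polar Doran chart.\<close>

definition DEC_on_radii :: "(real \<Rightarrow> real) \<Rightarrow> real \<Rightarrow> real set \<Rightarrow> bool" where
  "DEC_on_radii M a R \<longleftrightarrow>
     (\<forall>t \<phi> \<theta>. \<forall>r\<in>R. 0 < \<theta> \<and> \<theta> < pi \<longrightarrow>
        (Delta_fn M a r \<noteq> 0 \<longrightarrow> effective_DEC (gg_metric M a) (vector [t, r, \<theta>, \<phi>])) \<and>
        effective_DEC (doran_metric M a) (vector [t, r, \<theta>, \<phi>])) \<and>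
     (\<forall>t. \<forall>r\<in>R. effective_DEC (doran_polar_metric M a) (vector [t, r, 0, 0]))"


section \<open>The rotating Dymnikova spacetime\<close>

definition dymnikova_mass :: "real \<Rightarrow> real \<Rightarrow> real \<Rightarrow> real" where
  "dymnikova_mass l m r = 2 * m / pi * (arctan (r / l) - l * r / (r\<^sup>2 + l\<^sup>2))"

definition horizon_mass :: "real \<Rightarrow> real \<Rightarrow> real \<Rightarrow> real" where
  "horizon_mass l a r =
     pi * (r\<^sup>2 + a\<^sup>2) / (4 * r) * inverse (arctan (r / l) - l * r / (r\<^sup>2 + l\<^sup>2))"

definition extremal_mass :: "real \<Rightarrow> real \<Rightarrow> real" where
  "extremal_mass l a = (INF r\<in>{0<..}. horizon_mass l a r)"

definition event_horizon_radius :: "real \<Rightarrow> real \<Rightarrow> real \<Rightarrow> real" where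
  "event_horizon_radius l a m = (GREATEST r. 0 < r \<and> Delta_fn (dymnikova_mass l m) a r = 0)"

end

(*
  Both the Boyer-Lindquist and the Doran form of the metric are
    g = -(A/S) th1^2 + 2 th1 dr + S dtheta^2 + (sin^2 theta / S) th4^2
  with th1 = dt - a sin^2 theta dphi + S K dr, th4 = a dt - (r^2 + a^2) dphi, S = Sigma, A = Delta;
  K = 1/A gives Boyer-Lindquist, K = 1/((r^2 + a^2)(1 + b)) with b = sqrt(2 M r / (r^2 + a^2)) gives
  Doran. K only shifts t and phi along r, so it drops out of the frame components of the curvature.
  These are block diagonal: G = -rho g1 + p g2, where g1 and g2 are the (t,r) and the angular part of
  the metric, rho = 2 r^2 M' / S^2 and p = rho - (2 M' + r M'') / S. The dominant energy condition is
  therefore |p| <= rho, which follows from 0 <= (2 M' + r M'') (r^2 + a^2) <= 4 r^2 M'; for the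
  Dymnikova mass the upper bound says r^4 >= a^2 l^2. On the axis the curvature is read off from the
  2-jet of the metric in the polar chart.

  The minimum of m_h lies at a radius greater than sqrt |a l|, because m_h is strictly decreasing on
  (0, sqrt |a l|]; Delta is nonpositive there and positive for large r, so r_2 lies further out.
*)
theory Submission
  imports Defs
begin

text \<open>The Doran chart is regular where Delta = 0, but the orthonormal Carter frame carries
  factors sqrt(Delta) and breaks down there. The frame used instead has a null second vector: the
  (t,r) block of its metric has determinant -1 whatever A is, and nothing is divided by A. The price
  is a frame metric that varies from point to point, so the connection matrices are not
  antisymmetric and the moving-frame calculus has to be set up for variable frame components. The
  quotients 1 / Sigma and 1 / sin theta enter as variables of their own. Inverse, compatibility,
  torsion and Ricci tensor then become polynomial identities modulo three relations, with A, A', A''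
  as free variables, and each is certified by explicit multiples of the relations. On the axis 1 /
  sin theta is lost, hence the separate computation there; it works with b rather than M, because
  the Doran metric contains the square root. The radius sqrt |a l| plays two independent roles: it
  is where the energy bound becomes sharp on the axis, and it lies on the decreasing branch of m_h.
  The second needs an estimate of the mass profile, a cubic upper bound.\<close>

section \<open>Coordinate derivatives and the Levi-Civita connection\<close>

text \<open>\<open>pd\<close> is built on \<open>deriv\<close>, which returns an unspecified value
  where no derivative exists. The relational form carries existence along with the value, so that
  sums and products can be differentiated by plain rules.\<close>

definition has_pd :: "'n::finite \<Rightarrow> (real^'n \<Rightarrow> real) \<Rightarrow> real \<Rightarrow> real^'n \<Rightarrow> bool" where
  "has_pd k f D y \<longleftrightarrow> ((\<lambda>s. f (y + s *\<^sub>R axis k 1)) has_real_derivative D) (at 0)"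

lemma has_pd_imp_pd: "has_pd k f D y \<Longrightarrow> pd k f y = D"
  by (simp add: has_pd_def pd_def DERIV_imp_deriv)

lemma has_pd_unique: "has_pd k f D y \<Longrightarrow> has_pd k f D' y \<Longrightarrow> D = D'"
  using has_pd_imp_pd by metis

lemma has_pd_const: "has_pd k (\<lambda>y. c) 0 y"
  by (simp add: has_pd_def)

lemma has_pd_add: "has_pd k f D y \<Longrightarrow> has_pd k g D' y \<Longrightarrow> has_pd k (\<lambda>y. f y + g y) (D + D') y"
  unfolding has_pd_def by (rule DERIV_add)

lemma has_pd_mult:
  "has_pd k f D y \<Longrightarrow> has_pd k g D' y \<Longrightarrow> has_pd k (\<lambda>y. f y * g y) (D * g y + f y * D') y"
  unfolding has_pd_def by (drule (1) DERIV_mult) (simp add: algebra_simps)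

lemma has_pd_sum:
  "(\<And>i. i \<in> I \<Longrightarrow> has_pd k (f i) (D i) y) \<Longrightarrow> has_pd k (\<lambda>y. \<Sum>i\<in>I. f i y) (\<Sum>i\<in>I. D i) y"
  unfolding has_pd_def by (rule DERIV_sum)

lemma eventually_line_in_open:
  fixes y :: "real^'n::finite"
  assumes "open U" "y \<in> U"
  shows "eventually (\<lambda>s. y + s *\<^sub>R axis k 1 \<in> U) (nhds (0::real))"
proof -
  have "((\<lambda>s::real. y + s *\<^sub>R axis k 1) \<longlongrightarrow> y + 0 *\<^sub>R axis k 1) (nhds 0)"
    by (intro tendsto_intros filterlim_ident)
  then show ?thesis
    using assms by (auto dest: topological_tendstoD)
qed

text \<open>Allows a formula for the metric that holds only on an open chart domain to be
  differentiated there: a short piece of every coordinate line through \<open>y\<close> stays in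
  \<open>U\<close>.\<close>

lemma has_pd_cong:
  fixes y :: "real^'n::finite"
  assumes "open U" "y \<in> U" "\<And>z. z \<in> U \<Longrightarrow> f z = f' z"
  shows "has_pd k f D y \<longleftrightarrow> has_pd k f' D y"
  unfolding has_pd_def
proof (rule DERIV_cong_ev)
  show "\<forall>\<^sub>F s in nhds 0. f (y + s *\<^sub>R axis k 1) = f' (y + s *\<^sub>R axis k 1)"
    using eventually_line_in_open[OF assms(1,2), of k] by eventually_elim (rule assms(3))
qed auto

definition has_mpd ::
  "'n::finite \<Rightarrow> (real^'n \<Rightarrow> real^'q^'p) \<Rightarrow> real^'q^'p \<Rightarrow> real^'n \<Rightarrow> bool" where
  "has_mpd k F D y \<longleftrightarrow> (\<forall>i j. has_pd k (\<lambda>y. F y $ i $ j) (D $ i $ j) y)"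

lemma has_mpd_unique: "has_mpd k f D y \<Longrightarrow> has_mpd k f D' y \<Longrightarrow> D = D'"
  unfolding has_mpd_def vec_eq_iff by (blast intro: has_pd_unique)

lemma has_mpd_const: "has_mpd k (\<lambda>y. c) 0 y"
  by (simp add: has_mpd_def has_pd_const)

lemma has_mpd_add:
  "has_mpd k F D y \<Longrightarrow> has_mpd k G D' y \<Longrightarrow> has_mpd k (\<lambda>y. F y + G y) (D + D') y"
  by (simp add: has_mpd_def has_pd_add)

lemma has_mpd_transpose:
  "has_mpd k F D y \<Longrightarrow> has_mpd k (\<lambda>y. transpose (F y)) (transpose D) y"
  by (simp add: has_mpd_def transpose_def)

lemma has_mpd_mult:
  "has_mpd k F D y \<Longrightarrow> has_mpd k G D' y \<Longrightarrow> has_mpd k (\<lambda>y. F y ** G y) (D ** G y + F y ** D') y"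
  unfolding has_mpd_def matrix_matrix_mult_def
  unfolding sum.distrib[symmetric] vec_lambda_beta vector_add_component
  by (intro allI impI has_pd_sum has_pd_mult) blast+

lemma has_mpd_cong:
  fixes y :: "real^'n::finite"
  assumes "open U" "y \<in> U" "\<And>z. z \<in> U \<Longrightarrow> F z = F' z"
  shows "has_mpd k F D y \<longleftrightarrow> has_mpd k F' D y"
proof -
  have "has_pd k (\<lambda>z. F z $ i $ j) d y \<longleftrightarrow> has_pd k (\<lambda>z. F' z $ i $ j) d y" for i j d
    by (rule has_pd_cong[OF assms(1,2)]) (simp add: assms(3))
  then show ?thesis
    unfolding has_mpd_def by blast
qed

lemma matrix_sub_ldistrib: "(A :: real^'m^'n) ** (B - C) = A ** B - A ** C"
  by (simp add: matrix_matrix_mult_def vec_eq_iff algebra_simps sum_subtractf)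

lemma matrix_sub_rdistrib: "((B :: real^'m^'n) - C) ** A = B ** A - C ** A"
  by (simp add: matrix_matrix_mult_def vec_eq_iff algebra_simps sum_subtractf)

lemma matrix_add_rdistrib: "((B :: real^'m^'n) + C) ** A = B ** A + C ** A"
  by (simp add: matrix_matrix_mult_def vec_eq_iff algebra_simps sum.distrib)

lemma matrix_minus_left: "(- (B :: real^'m^'n)) ** A = - (B ** A)"
  by (simp add: matrix_matrix_mult_def vec_eq_iff sum_negf)

lemma transpose_add: "transpose (A + B) = transpose A + transpose B"
  by (simp add: transpose_def vec_eq_iff)

text \<open>The torsion-free metric connection is unique: \<open>\<Gamma> l $ i $ j\<close> stands for
  \<open>\<Gamma>\<^sup>i\<^sub>l\<^sub>j\<close>.\<close>

lemma christoffel_unique: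
  fixes g :: "real^'n \<Rightarrow> real^'n^'n::finite"
  assumes dg: "\<And>l. has_mpd l g (transpose (\<Gamma> l) ** g y + g y ** \<Gamma> l) y"
    and sym: "\<And>i j k. \<Gamma> j $ i $ k = \<Gamma> k $ i $ j"
    and gsym: "transpose (g y) = g y"
    and inv: "matrix_inv (g y) ** g y = mat 1"
  shows "christoffel g i j k y = \<Gamma> j $ i $ k"
proof -
  have gs: "g y $ p $ q = g y $ q $ p" for p q
    using arg_cong[OF gsym, of "\<lambda>A. A $ q $ p"] by (simp add: transpose_def)
  \<comment> \<open>\<open>b l p q\<close> is the connection coefficient with its upper index
    lowered into the slot \<open>q\<close>. It is symmetric in \<open>l\<close> and
    \<open>p\<close>, so the Koszul combination of the derivatives of \<open>g\<close> collapses to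
    \<open>2 * b j k p\<close>.\<close>
  define b where "b l p q = (\<Sum>r\<in>UNIV. g y $ q $ r * \<Gamma> l $ r $ p)" for l p q
  have bs: "b l p q = b p l q" for l p q
    by (simp add: b_def sym[of l _ p])
  have pdg: "pd l (\<lambda>z. g z $ p $ q) y = b l p q + b l q p" for l p q
  proof -
    have "has_pd l (\<lambda>z. g z $ p $ q) ((transpose (\<Gamma> l) ** g y + g y ** \<Gamma> l) $ p $ q) y"
      using dg[of l] by (simp add: has_mpd_def)
    then show ?thesis
      by (simp add: has_pd_imp_pd matrix_matrix_mult_def transpose_def b_def gs[of _ q] mult.commute)
  qed
  have "pd j (\<lambda>z. g z $ p $ k) y + pd k (\<lambda>z. g z $ p $ j) y - pd p (\<lambda>z. g z $ j $ k) y
      = 2 * (g y ** \<Gamma> j) $ p $ k" for p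
    unfolding pdg using bs[of j k p] bs[of j p k] bs[of k p j]
    by (simp add: matrix_matrix_mult_def b_def)
  then have "christoffel g i j k y
      = (\<Sum>p\<in>UNIV. matrix_inv (g y) $ i $ p * (2 * (g y ** \<Gamma> j) $ p $ k)) / 2"
    unfolding christoffel_def by presburger
  also have "\<dots> = (matrix_inv (g y) ** (g y ** \<Gamma> j)) $ i $ k"
    by (simp add: matrix_matrix_mult_def[of "matrix_inv _"] sum_divide_distrib)
  finally show ?thesis
    by (simp add: matrix_mul_assoc inv)
qed

text \<open>Reading \<open>d k\<close> as the derivative of \<open>\<theta>\<close> along
  \<open>k\<close>, each \<open>\<Gamma> k\<close> is the gauge transform of \<open>w k\<close>, and
  \<open>- E ** d l ** E\<close> is the derivative of \<open>E\<close>. The pure gauge terms cancel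
  since the second derivatives \<open>dd\<close> are symmetric, so curvature is merely
  conjugated.\<close>

lemma curvature_gauge_transform:
  fixes E \<theta> :: "real^'n^'n::finite"
  assumes "\<theta> ** E = mat 1"
    and \<Gamma>: "\<And>k. \<Gamma> k = E ** (d k + w k ** \<theta>)"
    and d\<Gamma>: "\<And>l k. d\<Gamma> l k = E ** (dd l k + (dw l k ** \<theta> + w k ** d l)) - E ** d l ** E ** (d k + w k ** \<theta>)"
    and "dd i k = dd k i"
  shows "d\<Gamma> i k - d\<Gamma> k i + \<Gamma> i ** \<Gamma> k - \<Gamma> k ** \<Gamma> i
    = E ** (dw i k - dw k i + w i ** w k - w k ** w i) ** \<theta>"
proof -
  have c: "\<theta> ** (E ** X) = X" for X :: "real^'n^'n"
    by (simp add: matrix_mul_assoc assms(1))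
  show ?thesis
    unfolding \<Gamma> d\<Gamma> \<open>dd i k = dd k i\<close>
    by (simp add: matrix_add_ldistrib matrix_add_rdistrib matrix_sub_ldistrib matrix_sub_rdistrib
        c flip: matrix_mul_assoc)
qed

section \<open>Curvature in a moving frame\<close>

lemma matrix_inv_eqI:
  fixes A :: "real^'n^'n::finite"
  assumes "B ** A = mat 1" shows "matrix_inv A = B"
proof -
  have AB: "A ** B = mat 1"
    using assms matrix_left_right_inverse by blast
  have "A ** matrix_inv A = mat 1"
    unfolding matrix_inv_def using AB assms by (metis (mono_tags, lifting) someI)
  then have "B ** (A ** matrix_inv A) = B"
    by simp
  then show ?thesis
    by (simp add: matrix_mul_assoc assms)
qed

lemma sum_rotate3:
  "(\<Sum>i\<in>I. \<Sum>b\<in>B. \<Sum>a\<in>A. f i b a) = (\<Sum>b\<in>B. \<Sum>a\<in>A. \<Sum>i\<in>I. f i b a)"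
  by (simp only: sum.swap[where A=I and B=B] sum.swap[where A=I and B=A])

lemma sum_rotate5:
  "(\<Sum>i\<in>I. \<Sum>b\<in>B. \<Sum>a\<in>A. \<Sum>c\<in>C. \<Sum>d\<in>D. f i b a c d)
    = (\<Sum>b\<in>B. \<Sum>a\<in>A. \<Sum>c\<in>C. \<Sum>d\<in>D. \<Sum>i\<in>I. f i b a c d)"
  by (simp only: sum.swap[where A=I and B=B] sum.swap[where A=I and B=A]
      sum.swap[where A=I and B=C] sum.swap[where A=I and B=D])

text \<open>A moving frame \<open>\<theta> $ a $ j = \<theta>\<^sup>a\<^sub>j\<close> with dual frame \<open>E\<close>,
  in which the metric has the components \<open>\<eta>\<close> (not necessarily constant), with inverse
  \<open>\<kappa>\<close>, and the Levi-Civita connection the components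
  \<open>W c $ a $ b = \<omega>\<^sup>a\<^sub>b(e\<^sub>c)\<close>; \<open>eW d c\<close> is the derivative of
  \<open>W c\<close> in the direction \<open>e\<^sub>d\<close>.\<close>

locale moving_frame =
  fixes U :: "(real^'n::finite) set" and g \<theta> E \<eta> \<kappa> :: "real^'n \<Rightarrow> real^'n^'n"
    and d\<theta> :: "'n \<Rightarrow> real^'n \<Rightarrow> real^'n^'n" and dd\<theta> :: "'n \<Rightarrow> 'n \<Rightarrow> real^'n \<Rightarrow> real^'n^'n"
    and W :: "'n \<Rightarrow> real^'n \<Rightarrow> real^'n^'n" and eW :: "'n \<Rightarrow> 'n \<Rightarrow> real^'n \<Rightarrow> real^'n^'n"
  assumes open_U: "open U"
    and metric: "y \<in> U \<Longrightarrow> g y = transpose (\<theta> y) ** \<eta> y ** \<theta> y"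
    and dual: "y \<in> U \<Longrightarrow> E y ** \<theta> y = mat 1"
    and \<eta>_inv: "y \<in> U \<Longrightarrow> \<eta> y ** \<kappa> y = mat 1"
    and \<eta>_sym: "y \<in> U \<Longrightarrow> transpose (\<eta> y) = \<eta> y"
    and d\<theta>: "y \<in> U \<Longrightarrow> has_mpd k \<theta> (d\<theta> k y) y"
    and dd\<theta>: "y \<in> U \<Longrightarrow> has_mpd l (d\<theta> k) (dd\<theta> l k y) y"
    and dd\<theta>_sym: "y \<in> U \<Longrightarrow> dd\<theta> l k y = dd\<theta> k l y"
    and E_diff: "y \<in> U \<Longrightarrow> \<exists>D. has_mpd k E D y"
    and compatible: "y \<in> U \<Longrightarrow> has_mpd k \<eta>
        (\<Sum>c\<in>UNIV. \<theta> y $ c $ k *\<^sub>R (\<eta> y ** W c y + transpose (\<eta> y ** W c y))) y"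
    and dW: "y \<in> U \<Longrightarrow> has_mpd k (W c) (\<Sum>d\<in>UNIV. \<theta> y $ d $ k *\<^sub>R eW d c y) y"
    and torsion: "y \<in> U \<Longrightarrow> d\<theta> j y $ a $ k - d\<theta> k y $ a $ j
        = (\<Sum>b\<in>UNIV. \<Sum>c\<in>UNIV. W c y $ a $ b * (\<theta> y $ b $ j * \<theta> y $ c $ k - \<theta> y $ b $ k * \<theta> y $ c $ j))"
begin

definition \<omega> :: "'n \<Rightarrow> real^'n \<Rightarrow> real^'n^'n" where
  "\<omega> k y = (\<Sum>c\<in>UNIV. \<theta> y $ c $ k *\<^sub>R W c y)"

definition \<Gamma> :: "'n \<Rightarrow> real^'n \<Rightarrow> real^'n^'n" where
  "\<Gamma> k y = E y ** (d\<theta> k y + \<omega> k y ** \<theta> y)"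

definition d\<omega> :: "'n \<Rightarrow> 'n \<Rightarrow> real^'n \<Rightarrow> real^'n^'n" where
  "d\<omega> l k y = (\<Sum>c\<in>UNIV. d\<theta> l y $ c $ k *\<^sub>R W c y
     + \<theta> y $ c $ k *\<^sub>R (\<Sum>d\<in>UNIV. \<theta> y $ d $ l *\<^sub>R eW d c y))"

definition d\<Gamma> :: "'n \<Rightarrow> 'n \<Rightarrow> real^'n \<Rightarrow> real^'n^'n" where
  "d\<Gamma> l k y = E y ** (dd\<theta> l k y + (d\<omega> l k y ** \<theta> y + \<omega> k y ** d\<theta> l y))
     - E y ** d\<theta> l y ** E y ** (d\<theta> k y + \<omega> k y ** \<theta> y)"

text \<open>The curvature endomorphism of the pair e_c, e_d. The last sum is minus the connection
  along the commutator [e_c, e_d], whose components are \<open>W c y $ e $ d - W d y $ e $ c\<close>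
  because torsion vanishes.\<close>

definition frame_curvature :: "'n \<Rightarrow> 'n \<Rightarrow> real^'n \<Rightarrow> real^'n^'n" where
  "frame_curvature c d y = eW c d y - eW d c y + W c y ** W d y - W d y ** W c y
     + (\<Sum>e\<in>UNIV. (W d y $ e $ c - W c y $ e $ d) *\<^sub>R W e y)"

definition frame_ricci :: "real^'n \<Rightarrow> real^'n^'n" where
  "frame_ricci y = (\<chi> b d. \<Sum>a\<in>UNIV. frame_curvature a d y $ a $ b)"

lemma dual': "y \<in> U \<Longrightarrow> \<theta> y ** E y = mat 1"
  using dual matrix_left_right_inverse by blast

lemma dual_cancel: "y \<in> U \<Longrightarrow> \<theta> y ** (E y ** X) = X"
  by (simp add: matrix_mul_assoc dual')

lemma \<omega>_nth: "\<omega> k y $ i $ j = (\<Sum>c\<in>UNIV. \<theta> y $ c $ k * W c y $ i $ j)"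
  by (simp add: \<omega>_def)

text \<open>Antisymmetrising \<open>d\<theta> k y + \<omega> k y ** \<theta> y\<close> in its two
  lower indices gives exactly the first structure equation, the axiom
  \<open>torsion\<close>.\<close>

lemma \<Gamma>_sym:
  assumes "y \<in> U" shows "\<Gamma> k y $ i $ j = \<Gamma> j y $ i $ k"
proof -
  have "(d\<theta> k y + \<omega> k y ** \<theta> y) $ a $ j = (d\<theta> j y + \<omega> j y ** \<theta> y) $ a $ k" for a
  proof -
    have "(\<omega> k y ** \<theta> y) $ a $ j = (\<Sum>b\<in>UNIV. \<Sum>c\<in>UNIV. W c y $ a $ b * (\<theta> y $ b $ j * \<theta> y $ c $ k))" for k j
      by (simp add: matrix_matrix_mult_def \<omega>_nth sum_distrib_right sum_distrib_left algebra_simps)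
    then show ?thesis
      using torsion[OF assms, of j a k] by (simp add: algebra_simps sum_subtractf)
  qed
  then show ?thesis
    by (simp add: \<Gamma>_def matrix_matrix_mult_def[of "E y"])
qed

lemma inverse_metric:
  assumes "y \<in> U" shows "matrix_inv (g y) = E y ** \<kappa> y ** transpose (E y)"
    and "matrix_inv (g y) ** g y = mat 1"
proof -
  have t: "transpose (E y) ** (transpose (\<theta> y) ** X) = X" for X :: "real^'n^'n"
    using arg_cong[OF dual'[OF assms], of transpose]
    by (simp add: matrix_transpose_mul matrix_mul_assoc)
  have k: "\<kappa> y ** (\<eta> y ** X) = X" for X :: "real^'n^'n"
    using \<eta>_inv[OF assms] matrix_left_right_inverse by (metis matrix_mul_assoc matrix_mul_lid)
  have l: "(E y ** \<kappa> y ** transpose (E y)) ** g y = mat 1"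
    by (simp add: metric[OF assms] dual[OF assms] t k flip: matrix_mul_assoc)
  then show "matrix_inv (g y) = E y ** \<kappa> y ** transpose (E y)"
    by (rule matrix_inv_eqI)
  with l show "matrix_inv (g y) ** g y = mat 1"
    by simp
qed

lemma metric_sym: "y \<in> U \<Longrightarrow> transpose (g y) = g y"
  by (simp add: metric matrix_transpose_mul \<eta>_sym flip: matrix_mul_assoc)

text \<open>The summand \<open>E y ** d\<theta> k y\<close> of \<open>\<Gamma>\<close> accounts for
  the derivatives of the two factors \<open>\<theta>\<close> of \<open>g\<close>, and
  \<open>compatible\<close> for that of the factor \<open>\<eta>\<close> between them.\<close>

lemma has_mpd_metric:
  assumes "y \<in> U"
  shows "has_mpd k g (transpose (\<Gamma> k y) ** g y + g y ** \<Gamma> k y) y"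
proof -
  let ?d\<eta> = "\<Sum>c\<in>UNIV. \<theta> y $ c $ k *\<^sub>R (\<eta> y ** W c y + transpose (\<eta> y ** W c y))"
  have "(\<eta> y ** \<omega> k y) $ i $ j = (\<Sum>c\<in>UNIV. \<theta> y $ c $ k * (\<eta> y ** W c y) $ i $ j)" for i j
    unfolding matrix_matrix_mult_def \<omega>_nth vec_lambda_beta sum_distrib_left
    by (subst sum.swap) (simp add: mult.left_commute)
  then have "?d\<eta> $ i $ j = (\<eta> y ** \<omega> k y + transpose (\<eta> y ** \<omega> k y)) $ i $ j" for i j
    by (simp add: transpose_def distrib_left sum.distrib)
  then have d\<eta>: "?d\<eta> = \<eta> y ** \<omega> k y + transpose (\<omega> k y) ** \<eta> y"
    by (simp add: vec_eq_iff matrix_transpose_mul \<eta>_sym[OF assms])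
  have g\<Gamma>: "g y ** \<Gamma> k y = transpose (\<theta> y) ** (\<eta> y ** (d\<theta> k y + \<omega> k y ** \<theta> y))"
    by (simp add: metric[OF assms] \<Gamma>_def dual_cancel[OF assms] flip: matrix_mul_assoc)
  have \<Gamma>g: "transpose (\<Gamma> k y) ** g y = transpose (d\<theta> k y + \<omega> k y ** \<theta> y) ** (\<eta> y ** \<theta> y)"
    using arg_cong[OF g\<Gamma>, of transpose]
    by (simp add: matrix_transpose_mul \<eta>_sym[OF assms] metric_sym[OF assms] flip: matrix_mul_assoc)
  have "has_mpd k (\<lambda>y. transpose (\<theta> y) ** \<eta> y ** \<theta> y)
      ((transpose (d\<theta> k y) ** \<eta> y + transpose (\<theta> y) ** ?d\<eta>) ** \<theta> y + transpose (\<theta> y) ** \<eta> y ** d\<theta> k y) y"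
    by (intro has_mpd_mult has_mpd_transpose d\<theta> compatible assms)
  also have "(transpose (d\<theta> k y) ** \<eta> y + transpose (\<theta> y) ** ?d\<eta>) ** \<theta> y + transpose (\<theta> y) ** \<eta> y ** d\<theta> k y
      = transpose (\<Gamma> k y) ** g y + g y ** \<Gamma> k y"
    unfolding g\<Gamma> \<Gamma>g d\<eta>
    by (simp add: matrix_add_ldistrib matrix_add_rdistrib transpose_add matrix_transpose_mul
        flip: matrix_mul_assoc)
  finally show ?thesis
    using has_mpd_cong[OF open_U assms, of g "\<lambda>y. transpose (\<theta> y) ** \<eta> y ** \<theta> y"] metric by blast
qed

lemma christoffel_eq: "y \<in> U \<Longrightarrow> christoffel g i j k y = \<Gamma> j y $ i $ k"
  using has_mpd_metric \<Gamma>_sym metric_sym inverse_metric(2)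
  by (intro christoffel_unique)

lemma has_mpd_\<Gamma>:
  assumes "y \<in> U" shows "has_mpd l (\<Gamma> k) (d\<Gamma> l k y) y"
proof -
  obtain D where D: "has_mpd l E D y"
    using E_diff[OF assms] by blast
  \<comment> \<open>\<open>E_diff\<close> supplies some derivative of \<open>E\<close>;
    differentiating the duality relation determines its value.\<close>
  have "has_mpd l (\<lambda>y. E y ** \<theta> y) 0 y"
    using has_mpd_cong[OF open_U assms, of "\<lambda>y. E y ** \<theta> y" "\<lambda>y. mat 1"] dual has_mpd_const by blast
  then have "D ** \<theta> y + E y ** d\<theta> l y = 0"
    using has_mpd_mult[OF D d\<theta>[OF assms]] has_mpd_unique by blast
  then have "D ** \<theta> y ** E y = - (E y ** d\<theta> l y) ** E y"
    by (simp only: add_eq_0_iff2)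
  then have D_eq: "D = - (E y ** d\<theta> l y ** E y)"
    by (simp add: dual'[OF assms] matrix_minus_left flip: matrix_mul_assoc)
  have "has_mpd l (\<omega> k) (d\<omega> l k y) y"
  proof -
    have "has_pd l (\<lambda>y. \<Sum>c\<in>UNIV. \<theta> y $ c $ k * W c y $ i $ j)
        (\<Sum>c\<in>UNIV. d\<theta> l y $ c $ k * W c y $ i $ j
          + \<theta> y $ c $ k * (\<Sum>d\<in>UNIV. \<theta> y $ d $ l *\<^sub>R eW d c y) $ i $ j) y" for i j
      using d\<theta>[OF assms, of l] dW[OF assms, of l] unfolding has_mpd_def
      by (intro has_pd_sum has_pd_mult) blast+
    then show ?thesis
      by (simp add: has_mpd_def \<omega>_nth d\<omega>_def sum.distrib)
  qed
  then have "has_mpd l (\<lambda>y. E y ** (d\<theta> k y + \<omega> k y ** \<theta> y))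
      (D ** (d\<theta> k y + \<omega> k y ** \<theta> y) + E y ** (dd\<theta> l k y + (d\<omega> l k y ** \<theta> y + \<omega> k y ** d\<theta> l y))) y"
    by (intro has_mpd_mult has_mpd_add D d\<theta> dd\<theta> assms)
  moreover have "\<Gamma> k = (\<lambda>y. E y ** (d\<theta> k y + \<omega> k y ** \<theta> y))"
    by (simp add: \<Gamma>_def fun_eq_iff)
  ultimately show ?thesis
    by (simp add: d\<Gamma>_def D_eq matrix_minus_left)
qed

text \<open>Cartan's second structure equation. The coframe factor inside \<open>\<omega>\<close>
  contributes the exterior derivative of the coframe, which \<open>torsion\<close> turns into the
  commutator term of \<open>frame_curvature\<close>.\<close>

lemma curvature_components:
  assumes "y \<in> U"
  shows "(d\<omega> i k y - d\<omega> k i y + \<omega> i y ** \<omega> k y - \<omega> k y ** \<omega> i y) $ a $ b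
    = (\<Sum>c\<in>UNIV. \<Sum>d\<in>UNIV. \<theta> y $ c $ i * \<theta> y $ d $ k * frame_curvature c d y $ a $ b)"
proof -
  let ?S = "\<lambda>f. \<Sum>c\<in>UNIV. \<Sum>d\<in>UNIV. \<theta> y $ c $ i * \<theta> y $ d $ k * f c d"
  have prod: "(\<omega> i y ** \<omega> k y) $ a $ b = (\<Sum>c\<in>UNIV. \<Sum>d\<in>UNIV. \<theta> y $ c $ i * \<theta> y $ d $ k * (W c y ** W d y) $ a $ b)"
    for i k
    unfolding matrix_matrix_mult_def \<omega>_nth sum_product vec_lambda_beta
    by (subst sum.swap, rule sum.cong, simp, subst sum.swap) (simp add: sum_distrib_left mult_ac)
  have swap: "(\<Sum>c\<in>UNIV. \<Sum>d\<in>UNIV. \<theta> y $ c $ k * \<theta> y $ d $ i * f c d) = ?S (\<lambda>c d. f d c)" for f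
    by (subst sum.swap) (simp add: mult_ac)
  have "(d\<omega> i k y - d\<omega> k i y) $ a $ b = (\<Sum>e\<in>UNIV. (d\<theta> i y $ e $ k - d\<theta> k y $ e $ i) * W e y $ a $ b)
      + ?S (\<lambda>c d. eW c d y $ a $ b) - ?S (\<lambda>c d. eW d c y $ a $ b)"
  proof -
    have "d\<omega> l m y $ a $ b = (\<Sum>e\<in>UNIV. d\<theta> l y $ e $ m * W e y $ a $ b)
        + (\<Sum>c\<in>UNIV. \<Sum>d\<in>UNIV. \<theta> y $ c $ m * \<theta> y $ d $ l * eW d c y $ a $ b)" for l m
      by (simp add: d\<omega>_def sum.distrib sum_distrib_left mult.assoc)
    then show ?thesis
      using swap[of "\<lambda>c d. eW d c y $ a $ b"]
      by (simp add: left_diff_distrib sum_subtractf)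
  qed
  moreover have "(\<Sum>e\<in>UNIV. (d\<theta> i y $ e $ k - d\<theta> k y $ e $ i) * W e y $ a $ b)
      = ?S (\<lambda>c d. \<Sum>e\<in>UNIV. (W d y $ e $ c - W c y $ e $ d) * W e y $ a $ b)"
  proof -
    have "(\<Sum>e\<in>UNIV. (d\<theta> i y $ e $ k - d\<theta> k y $ e $ i) * W e y $ a $ b)
       = (\<Sum>e\<in>UNIV. ?S (\<lambda>c d. (W d y $ e $ c - W c y $ e $ d) * W e y $ a $ b))"
    proof (rule sum.cong)
      fix e
      have "d\<theta> i y $ e $ k - d\<theta> k y $ e $ i = ?S (\<lambda>c d. W d y $ e $ c - W c y $ e $ d)"
        unfolding torsion[OF assms] right_diff_distrib sum_subtractf
        using swap[of "\<lambda>c d. W d y $ e $ c"] by (simp add: mult_ac)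
      then show "(d\<theta> i y $ e $ k - d\<theta> k y $ e $ i) * W e y $ a $ b
         = ?S (\<lambda>c d. (W d y $ e $ c - W c y $ e $ d) * W e y $ a $ b)"
        by (simp add: sum_distrib_right mult.assoc)
    qed simp
    also have "\<dots> = ?S (\<lambda>c d. \<Sum>e\<in>UNIV. (W d y $ e $ c - W c y $ e $ d) * W e y $ a $ b)"
      by (subst sum.swap, rule sum.cong, simp, subst sum.swap) (simp add: sum_distrib_left)
    finally show ?thesis .
  qed
  moreover have "(\<omega> i y ** \<omega> k y - \<omega> k y ** \<omega> i y) $ a $ b
      = ?S (\<lambda>c d. (W c y ** W d y) $ a $ b) - ?S (\<lambda>c d. (W d y ** W c y) $ a $ b)"
    using swap[of "\<lambda>c d. (W c y ** W d y) $ a $ b"] by (simp add: prod)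
  ultimately show ?thesis
    by (simp add: frame_curvature_def distrib_left right_diff_distrib sum.distrib sum_subtractf)
qed

theorem ricci_eq:
  assumes "y \<in> U"
  shows "ricci g y = transpose (\<theta> y) ** frame_ricci y ** \<theta> y"
proof -
  let ?F = "\<lambda>i k. d\<Gamma> i k y - d\<Gamma> k i y + \<Gamma> i y ** \<Gamma> k y - \<Gamma> k y ** \<Gamma> i y"
  let ?\<Omega> = "\<lambda>i k. d\<omega> i k y - d\<omega> k i y + \<omega> i y ** \<omega> k y - \<omega> k y ** \<omega> i y"
  have chr: "christoffel g i j k z = \<Gamma> k z $ i $ j" if "z \<in> U" for i j k z
    using christoffel_eq[OF that] \<Gamma>_sym[OF that] by simp
  have "pd l (christoffel g i j k) y = d\<Gamma> l k y $ i $ j" for l i j k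
  proof -
    have "has_pd l (\<lambda>z. \<Gamma> k z $ i $ j) (d\<Gamma> l k y $ i $ j) y"
      using has_mpd_\<Gamma>[OF assms] by (simp add: has_mpd_def)
    then have "has_pd l (christoffel g i j k) (d\<Gamma> l k y $ i $ j) y"
      using has_pd_cong[OF open_U assms, of "christoffel g i j k" "\<lambda>z. \<Gamma> k z $ i $ j"] chr by blast
    then show ?thesis
      by (rule has_pd_imp_pd)
  qed
  \<comment> \<open>Brings the term \<open>pd k (christoffel g i i j)\<close> of
    \<open>ricci\<close> into the form of the entry of \<open>d\<Gamma> k i\<close> that occurs in
    \<open>?F\<close>: the symmetry of \<open>\<Gamma>\<close> holds near \<open>y\<close>, so it
    passes to derivatives by uniqueness.\<close>
  moreover have "d\<Gamma> k j y $ i $ i' = d\<Gamma> k i' y $ i $ j" for k j i i'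
  proof -
    have "has_pd k (\<lambda>z. \<Gamma> j z $ i $ i') (d\<Gamma> k j y $ i $ i') y"
      "has_pd k (\<lambda>z. \<Gamma> i' z $ i $ j) (d\<Gamma> k i' y $ i $ j) y"
      using has_mpd_\<Gamma>[OF assms] by (simp_all add: has_mpd_def)
    then show ?thesis
      using has_pd_cong[OF open_U assms, of "\<lambda>z. \<Gamma> j z $ i $ i'" "\<lambda>z. \<Gamma> i' z $ i $ j"]
        \<Gamma>_sym has_pd_unique by blast
  qed
  ultimately have "ricci g y $ j $ k = (\<Sum>i\<in>UNIV. ?F i k $ i $ j)" for j k
    unfolding ricci_def
    by (simp add: chr[OF assms] christoffel_eq[OF assms] matrix_matrix_mult_def sum.distrib
        sum_subtractf)
      (simp add: \<Gamma>_sym[OF assms])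
  moreover have "?F i k = E y ** ?\<Omega> i k ** \<theta> y" for i k
    by (rule curvature_gauge_transform[where \<Gamma>="\<lambda>k. \<Gamma> k y" and d\<Gamma>="\<lambda>l k. d\<Gamma> l k y"
          and d="\<lambda>k. d\<theta> k y" and w="\<lambda>k. \<omega> k y" and dd="\<lambda>l k. dd\<theta> l k y" and dw="\<lambda>l k. d\<omega> l k y"])
      (simp_all add: dual' assms \<Gamma>_def d\<Gamma>_def dd\<theta>_sym)
  ultimately have R: "ricci g y $ j $ k = (\<Sum>i\<in>UNIV. (E y ** ?\<Omega> i k ** \<theta> y) $ i $ j)" for j k
    by simp
  have \<theta>E: "(\<Sum>i\<in>UNIV. \<theta> y $ c $ i * E y $ i $ a) = (if c = a then 1 else 0)" for c a
    using arg_cong[OF dual'[OF assms], of "\<lambda>A. A $ c $ a"] by (simp add: matrix_matrix_mult_def mat_def)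
  have "ricci g y $ j $ k = (transpose (\<theta> y) ** frame_ricci y ** \<theta> y) $ j $ k" for j k
  proof -
    have "ricci g y $ j $ k = (\<Sum>i\<in>UNIV. \<Sum>b\<in>UNIV. \<Sum>a\<in>UNIV. \<Sum>c\<in>UNIV. \<Sum>d\<in>UNIV.
        \<theta> y $ c $ i * E y $ i $ a * (\<theta> y $ d $ k * frame_curvature c d y $ a $ b * \<theta> y $ b $ j))"
    proof -
      have entry: "(E y ** X ** \<theta> y) $ i $ j
          = (\<Sum>b\<in>UNIV. \<Sum>a\<in>UNIV. E y $ i $ a * X $ a $ b * \<theta> y $ b $ j)" for X i
        by (simp add: matrix_matrix_mult_def sum_distrib_right)
      show ?thesis
        unfolding R entry curvature_components[OF assms]
        by (simp add: sum_distrib_left sum_distrib_right mult_ac)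
    qed
    \<comment> \<open>The coordinate index \<open>i\<close> now occurs only in a product of coframe
      and dual frame, which is a Kronecker delta; the coordinate trace becomes the frame
      trace.\<close>
    also have "\<dots> = (\<Sum>b\<in>UNIV. \<Sum>a\<in>UNIV. \<Sum>c\<in>UNIV. \<Sum>d\<in>UNIV.
        (\<Sum>i\<in>UNIV. \<theta> y $ c $ i * E y $ i $ a) * (\<theta> y $ d $ k * frame_curvature c d y $ a $ b * \<theta> y $ b $ j))"
      by (subst sum_rotate5) (simp add: sum_distrib_right)
    also have "\<dots> = (\<Sum>b\<in>UNIV. \<Sum>a\<in>UNIV. \<Sum>d\<in>UNIV. \<theta> y $ d $ k * frame_curvature a d y $ a $ b * \<theta> y $ b $ j)"
    proof -
      have "(\<Sum>c\<in>UNIV. \<Sum>d\<in>UNIV. (if c = a then 1 else 0) * h c d) = (\<Sum>d\<in>UNIV. h a d)"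
        for a and h :: "'n \<Rightarrow> 'n \<Rightarrow> real"
        by (subst sum.swap) (simp add: if_distrib[of "\<lambda>x. x * _"] cong: if_cong)
      then show ?thesis
        unfolding \<theta>E by simp
    qed
    also have "\<dots> = (\<Sum>d\<in>UNIV. \<Sum>b\<in>UNIV. \<Sum>a\<in>UNIV. \<theta> y $ d $ k * frame_curvature a d y $ a $ b * \<theta> y $ b $ j)"
      by (rule sum_rotate3[symmetric])
    also have "\<dots> = (transpose (\<theta> y) ** frame_ricci y ** \<theta> y) $ j $ k"
      unfolding matrix_matrix_mult_def frame_ricci_def transpose_def
      by (simp add: sum_distrib_left sum_distrib_right mult_ac)
    finally show ?thesis .
  qed
  then show ?thesis
    by (simp add: vec_eq_iff)
qed

theorem einstein_eq:
  assumes "y \<in> U"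
  shows "einstein g y = transpose (\<theta> y)
    ** (frame_ricci y - ((\<Sum>a\<in>UNIV. \<Sum>b\<in>UNIV. \<kappa> y $ a $ b * frame_ricci y $ a $ b) / 2) *\<^sub>R \<eta> y) ** \<theta> y"
proof -
  have "scalar_curvature g y = (\<Sum>a\<in>UNIV. \<Sum>b\<in>UNIV. \<kappa> y $ a $ b * frame_ricci y $ a $ b)"
  proof -
    have pair: "(\<Sum>a\<in>UNIV. \<Sum>b\<in>UNIV. A $ a $ b * B $ a $ b) = trace (A ** transpose B)"
      for A B :: "real^'n^'n"
      by (simp add: trace_def matrix_matrix_mult_def transpose_def)
    have t: "transpose (E y) ** (transpose (\<theta> y) ** X) = X" for X :: "real^'n^'n"
      using arg_cong[OF dual'[OF assms], of transpose]
      by (simp add: matrix_transpose_mul matrix_mul_assoc)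
    have "scalar_curvature g y = trace (E y ** (\<kappa> y ** (transpose (frame_ricci y) ** \<theta> y)))"
      unfolding scalar_curvature_def pair ricci_eq[OF assms] inverse_metric(1)[OF assms]
      by (simp add: matrix_transpose_mul t flip: matrix_mul_assoc)
    also have "\<dots> = trace (\<kappa> y ** transpose (frame_ricci y))"
      by (subst trace_mul_sym) (simp add: dual'[OF assms] flip: matrix_mul_assoc)
    finally show ?thesis
      by (simp add: pair)
  qed
  then show ?thesis
    unfolding einstein_def ricci_eq[OF assms] metric[OF assms]
    by (simp add: matrix_sub_ldistrib matrix_sub_rdistrib matrix_scalar_ac flip: scalar_matrix_assoc)
qed

end

section \<open>The connection of the Carter frame\<close>

lemma vector_4:
  "(vector [x, y, z, w] :: 'a::zero^4) $ 1 = x"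
  "(vector [x, y, z, w] :: 'a::zero^4) $ 2 = y"
  "(vector [x, y, z, w] :: 'a::zero^4) $ 3 = z"
  "(vector [x, y, z, w] :: 'a::zero^4) $ 4 = w"
  by (simp_all add: vector_def)

text \<open>The coframe is \<open>dt - a sin\<^sup>2\<theta> d\<phi> + \<Sigma> K dr, dr, d\<theta>, a dt - (r\<^sup>2 + a\<^sup>2) d\<phi>\<close>, in this order.
  The arguments \<open>s, c, u, v\<close> stand for \<open>sin \<theta>, cos \<theta>, 1 / \<Sigma>, 1 / sin \<theta>\<close>, and \<open>A, A1, A2\<close>
  for \<open>\<Delta>\<close> and its derivatives; the first index of the array is the direction of differentiation.\<close>

definition carter_conn :: "real \<Rightarrow> real \<Rightarrow> real \<Rightarrow> real \<Rightarrow> real \<Rightarrow> real \<Rightarrow> real \<Rightarrow> real \<Rightarrow> real^4^4^4" where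
  "carter_conn a r s c A A1 u v = vector [
    vector [
     vector [A1 * u / 2 - r * A * u^2, 0, - (a^2 * s * c * u), r * a * s^2 * u^2],
     vector [A * A1 * u^2 / 2 - r * A^2 * u^3, - (A1 * u / 2) + r * A * u^2, 0, r * a * s^2 * A * u^3],
     vector [- (a^2 * s * c * A * u^3), a^2 * s * c * u^2, 0, a * s * c * A * u^3],
     vector [0, - (r * a * u), - (a * c * A * u * v), 0]],
    vector [
     vector [0, 0, 0, 0],
     vector [- (A1 * u / 2) + r * A * u^2, 0, - (a^2 * s * c * u), - (r * a * s^2 * u^2)],
     vector [a^2 * s * c * u^2, 0, r * u, - (a * s * c * u^2)],
     vector [r * a * u, 0, a * c * v, - (r * u)]],
    vector [
     vector [a^2 * s * c * u, 0, - r, - (a * s * c * u)],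
     vector [0, - (a^2 * s * c * u), - (r * A * u), 0],
     vector [0, r * u, - (a^2 * s * c * u), 0],
     vector [- (a * c * A * u * v), a * c * v, 0, c * v + a^2 * s * c * u]],
    vector [
     vector [r * a * s^2 * u^2, 0, a * s * c * u, - (r * s^2 * u^2)],
     vector [r * a * s^2 * A * u^3, - (r * a * s^2 * u^2), 0, - (r * s^2 * A * u^3)],
     vector [a * s * c * A * u^3, - (a * s * c * u^2), 0, - (r^2 * s * c * u^3) - a^2 * s * c * u^3],
     vector [0, r * u, c * v + a^2 * s * c * u, 0]]]"

definition carter_conn_dr :: "real \<Rightarrow> real \<Rightarrow> real \<Rightarrow> real \<Rightarrow> real \<Rightarrow> real \<Rightarrow> real \<Rightarrow> real \<Rightarrow> real \<Rightarrow> real^4^4^4" where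
  "carter_conn_dr a r s c A A1 A2 u v = vector [
    vector [
     vector [- (A * u^2) - 2 * r * A1 * u^2 + A2 * u / 2 + 4 * r^2 * A * u^3, 0, 2 * r * a^2 * s * c * u^2, a * s^2 * u^2 - 4 * r^2 * a * s^2 * u^3],
     vector [- (A^2 * u^3) + A1^2 * u^2 / 2 - 4 * r * A * A1 * u^3 + A * A2 * u^2 / 2 + 6 * r^2 * A^2 * u^4, A * u^2 + 2 * r * A1 * u^2 - A2 * u / 2 - 4 * r^2 * A * u^3, 0, a * s^2 * A * u^3 + r * a * s^2 * A1 * u^3 - 6 * r^2 * a * s^2 * A * u^4],
     vector [- (a^2 * s * c * A1 * u^3) + 6 * r * a^2 * s * c * A * u^4, - (4 * r * a^2 * s * c * u^3), 0, a * s * c * A1 * u^3 - 6 * r * a * s * c * A * u^4],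
     vector [0, - (a * u) + 2 * r^2 * a * u^2, - (a * c * A1 * u * v) + 2 * r * a * c * A * u^2 * v, 0]],
    vector [
     vector [0, 0, 0, 0],
     vector [A * u^2 + 2 * r * A1 * u^2 - A2 * u / 2 - 4 * r^2 * A * u^3, 0, 2 * r * a^2 * s * c * u^2, - (a * s^2 * u^2) + 4 * r^2 * a * s^2 * u^3],
     vector [- (4 * r * a^2 * s * c * u^3), 0, u - 2 * r^2 * u^2, 4 * r * a * s * c * u^3],
     vector [a * u - 2 * r^2 * a * u^2, 0, 0, - (u) + 2 * r^2 * u^2]],
    vector [
     vector [- (2 * r * a^2 * s * c * u^2), 0, - 1, 2 * r * a * s * c * u^2],
     vector [0, 2 * r * a^2 * s * c * u^2, - (A * u) - r * A1 * u + 2 * r^2 * A * u^2, 0],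
     vector [0, u - 2 * r^2 * u^2, 2 * r * a^2 * s * c * u^2, 0],
     vector [- (a * c * A1 * u * v) + 2 * r * a * c * A * u^2 * v, 0, 0, - (2 * r * a^2 * s * c * u^2)]],
    vector [
     vector [a * s^2 * u^2 - 4 * r^2 * a * s^2 * u^3, 0, - (2 * r * a * s * c * u^2), - (s^2 * u^2) + 4 * r^2 * s^2 * u^3],
     vector [a * s^2 * A * u^3 + r * a * s^2 * A1 * u^3 - 6 * r^2 * a * s^2 * A * u^4, - (a * s^2 * u^2) + 4 * r^2 * a * s^2 * u^3, 0, - (s^2 * A * u^3) - r * s^2 * A1 * u^3 + 6 * r^2 * s^2 * A * u^4],
     vector [a * s * c * A1 * u^3 - 6 * r * a * s * c * A * u^4, 4 * r * a * s * c * u^3, 0, - (2 * r * s * c * u^3) + 6 * r^3 * s * c * u^4 + 6 * r * a^2 * s * c * u^4],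
     vector [0, u - 2 * r^2 * u^2, - (2 * r * a^2 * s * c * u^2), 0]]]"

definition carter_conn_d\<theta> :: "real \<Rightarrow> real \<Rightarrow> real \<Rightarrow> real \<Rightarrow> real \<Rightarrow> real \<Rightarrow> real \<Rightarrow> real \<Rightarrow> real^4^4^4" where
  "carter_conn_d\<theta> a r s c A A1 u v = vector [
    vector [
     vector [a^2 * s * c * A1 * u^2 - 4 * r * a^2 * s * c * A * u^3, 0, - (a^2 * c^2 * u) + a^2 * s^2 * u - 2 * a^4 * s^2 * c^2 * u^2, 2 * r * a * s * c * u^2 + 4 * r * a^3 * s^3 * c * u^3],
     vector [2 * a^2 * s * c * A * A1 * u^3 - 6 * r * a^2 * s * c * A^2 * u^4, - (a^2 * s * c * A1 * u^2) + 4 * r * a^2 * s * c * A * u^3, 0, 2 * r * a * s * c * A * u^3 + 6 * r * a^3 * s^3 * c * A * u^4],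
     vector [- (a^2 * c^2 * A * u^3) + a^2 * s^2 * A * u^3 - 6 * a^4 * s^2 * c^2 * A * u^4, a^2 * c^2 * u^2 - a^2 * s^2 * u^2 + 4 * a^4 * s^2 * c^2 * u^3, 0, a * c^2 * A * u^3 - a * s^2 * A * u^3 + 6 * a^3 * s^2 * c^2 * A * u^4],
     vector [0, - (2 * r * a^3 * s * c * u^2), a * s * A * u * v - 2 * a^3 * s * c^2 * A * u^2 * v + a * c^2 * A * u * v^2, 0]],
    vector [
     vector [0, 0, 0, 0],
     vector [- (a^2 * s * c * A1 * u^2) + 4 * r * a^2 * s * c * A * u^3, 0, - (a^2 * c^2 * u) + a^2 * s^2 * u - 2 * a^4 * s^2 * c^2 * u^2, - (2 * r * a * s * c * u^2) - 4 * r * a^3 * s^3 * c * u^3],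
     vector [a^2 * c^2 * u^2 - a^2 * s^2 * u^2 + 4 * a^4 * s^2 * c^2 * u^3, 0, 2 * r * a^2 * s * c * u^2, - (a * c^2 * u^2) + a * s^2 * u^2 - 4 * a^3 * s^2 * c^2 * u^3],
     vector [2 * r * a^3 * s * c * u^2, 0, - (a * s * v) - a * c^2 * v^2, - (2 * r * a^2 * s * c * u^2)]],
    vector [
     vector [a^2 * c^2 * u - a^2 * s^2 * u + 2 * a^4 * s^2 * c^2 * u^2, 0, 0, - (a * c^2 * u) + a * s^2 * u - 2 * a^3 * s^2 * c^2 * u^2],
     vector [0, - (a^2 * c^2 * u) + a^2 * s^2 * u - 2 * a^4 * s^2 * c^2 * u^2, - (2 * r * a^2 * s * c * A * u^2), 0],
     vector [0, 2 * r * a^2 * s * c * u^2, - (a^2 * c^2 * u) + a^2 * s^2 * u - 2 * a^4 * s^2 * c^2 * u^2, 0],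
     vector [a * s * A * u * v - 2 * a^3 * s * c^2 * A * u^2 * v + a * c^2 * A * u * v^2, - (a * s * v) - a * c^2 * v^2, 0, a^2 * c^2 * u - s * v - a^2 * s^2 * u + 2 * a^4 * s^2 * c^2 * u^2 - c^2 * v^2]],
    vector [
     vector [2 * r * a * s * c * u^2 + 4 * r * a^3 * s^3 * c * u^3, 0, a * c^2 * u - a * s^2 * u + 2 * a^3 * s^2 * c^2 * u^2, - (2 * r * s * c * u^2) - 4 * r * a^2 * s^3 * c * u^3],
     vector [2 * r * a * s * c * A * u^3 + 6 * r * a^3 * s^3 * c * A * u^4, - (2 * r * a * s * c * u^2) - 4 * r * a^3 * s^3 * c * u^3, 0, - (2 * r * s * c * A * u^3) - 6 * r * a^2 * s^3 * c * A * u^4],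
     vector [a * c^2 * A * u^3 - a * s^2 * A * u^3 + 6 * a^3 * s^2 * c^2 * A * u^4, - (a * c^2 * u^2) + a * s^2 * u^2 - 4 * a^3 * s^2 * c^2 * u^3, 0, - (r^2 * c^2 * u^3) - a^2 * c^2 * u^3 + r^2 * s^2 * u^3 + a^2 * s^2 * u^3 - 6 * r^2 * a^2 * s^2 * c^2 * u^4 - 6 * a^4 * s^2 * c^2 * u^4],
     vector [0, 2 * r * a^2 * s * c * u^2, a^2 * c^2 * u - s * v - a^2 * s^2 * u + 2 * a^4 * s^2 * c^2 * u^2 - c^2 * v^2, 0]]]"

text \<open>Substituted for \<open>u\<close>, with \<open>inv_sin\<close> for \<open>v\<close>, this
  makes the entries of \<open>carter_conn\<close> polynomial. Differentiation stays within
  polynomials, since it sends \<open>u\<close> to a multiple of \<open>u^2\<close> and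
  \<open>v\<close> to a multiple of \<open>v^2\<close>.\<close>

definition inv_Sigma :: "real \<Rightarrow> real \<Rightarrow> real \<Rightarrow> real" where
  "inv_Sigma a r \<theta> = 1 / Sigma_fn a r \<theta>"

definition inv_sin :: "real \<Rightarrow> real" where
  "inv_sin \<theta> = 1 / sin \<theta>"

lemma Sigma_pos: "r > 0 \<Longrightarrow> Sigma_fn a r \<theta> > 0"
  by (simp add: Sigma_fn_def add_pos_nonneg)

lemma DERIV_inv_Sigma_r:
  assumes "r > 0"
  shows "((\<lambda>r. inv_Sigma a r \<theta>) has_real_derivative - (2 * r * (inv_Sigma a r \<theta>)^2)) (at r)"
proof -
  have "((\<lambda>r. 1 / (r\<^sup>2 + a\<^sup>2 * (cos \<theta>)\<^sup>2)) has_real_derivative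
      - (2 * r) / (r\<^sup>2 + a\<^sup>2 * (cos \<theta>)\<^sup>2)^2) (at r)"
    using Sigma_pos[OF assms, of a \<theta>]
    by (auto intro!: derivative_eq_intros simp: Sigma_fn_def power2_eq_square)
  then show ?thesis
    by (simp add: inv_Sigma_def Sigma_fn_def power_divide)
qed

lemma DERIV_inv_Sigma_\<theta>:
  assumes "r > 0"
  shows "((\<lambda>\<theta>. inv_Sigma a r \<theta>) has_real_derivative 2 * a^2 * sin \<theta> * cos \<theta> * (inv_Sigma a r \<theta>)^2) (at \<theta>)"
proof -
  have "((\<lambda>\<theta>. 1 / (r\<^sup>2 + a\<^sup>2 * (cos \<theta>)\<^sup>2)) has_real_derivative
      2 * a^2 * sin \<theta> * cos \<theta> / (r\<^sup>2 + a\<^sup>2 * (cos \<theta>)\<^sup>2)^2) (at \<theta>)"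
    using Sigma_pos[OF assms, of a \<theta>]
    by (auto intro!: derivative_eq_intros simp: Sigma_fn_def power2_eq_square)
  then show ?thesis
    by (simp add: inv_Sigma_def Sigma_fn_def power_divide)
qed

lemma DERIV_inv_sin:
  assumes "sin \<theta> \<noteq> 0"
  shows "(inv_sin has_real_derivative - (cos \<theta> * (inv_sin \<theta>)^2)) (at \<theta>)"
proof -
  have "((\<lambda>\<theta>. 1 / sin \<theta>) has_real_derivative - (cos \<theta>) / (sin \<theta>)^2) (at \<theta>)"
    using assms by (auto intro!: derivative_eq_intros simp: power2_eq_square)
  then show ?thesis
    by (simp add: inv_sin_def[abs_def] power_divide)
qed

lemma DERIV_carter_conn_r:
  assumes "r > 0" "(A has_real_derivative A1 r) (at r)" "(A1 has_real_derivative A2) (at r)"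
  shows "((\<lambda>r. carter_conn a r s c (A r) (A1 r) (inv_Sigma a r \<theta>) v $ k $ i $ j) has_real_derivative
    carter_conn_dr a r s c (A r) (A1 r) A2 (inv_Sigma a r \<theta>) v $ k $ i $ j) (at r)"
proof -
  have "\<forall>k i j. ((\<lambda>r. carter_conn a r s c (A r) (A1 r) (inv_Sigma a r \<theta>) v $ k $ i $ j) has_real_derivative
    carter_conn_dr a r s c (A r) (A1 r) A2 (inv_Sigma a r \<theta>) v $ k $ i $ j) (at r)"
    unfolding forall_4 carter_conn_def carter_conn_dr_def vector_4
    by (intro conjI;
      (auto intro!: derivative_eq_intros assms DERIV_inv_Sigma_r[OF assms(1)]
        simp: field_simps power2_eq_square power3_eq_cube numeral_eq_Suc))
  then show ?thesis by blast
qed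

lemma DERIV_carter_conn_\<theta>:
  assumes "r > 0" "sin \<theta> \<noteq> 0"
  shows "((\<lambda>\<theta>. carter_conn a r (sin \<theta>) (cos \<theta>) A A1 (inv_Sigma a r \<theta>) (inv_sin \<theta>) $ k $ i $ j) has_real_derivative
    carter_conn_d\<theta> a r (sin \<theta>) (cos \<theta>) A A1 (inv_Sigma a r \<theta>) (inv_sin \<theta>) $ k $ i $ j) (at \<theta>)"
proof -
  have "\<forall>k i j. ((\<lambda>\<theta>. carter_conn a r (sin \<theta>) (cos \<theta>) A A1 (inv_Sigma a r \<theta>) (inv_sin \<theta>) $ k $ i $ j) has_real_derivative
    carter_conn_d\<theta> a r (sin \<theta>) (cos \<theta>) A A1 (inv_Sigma a r \<theta>) (inv_sin \<theta>) $ k $ i $ j) (at \<theta>)"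
    unfolding forall_4 carter_conn_def carter_conn_d\<theta>_def vector_4
    by (intro conjI;
      (auto intro!: derivative_eq_intros DERIV_inv_Sigma_\<theta>[OF assms(1)] DERIV_inv_sin[OF assms(2)]
        simp: field_simps power2_eq_square power3_eq_cube numeral_eq_Suc))
  then show ?thesis by blast
qed

section \<open>The frame, its metric, and the structure equations as polynomial identities\<close>

definition carter_coframe :: "real \<Rightarrow> real \<Rightarrow> real \<Rightarrow> real \<Rightarrow> real \<Rightarrow> real^4^4" where
  "carter_coframe a r s c K = vector [
     vector [1, (r^2 + a^2 * c^2) * K, 0, - (a * s^2)],
     vector [0, 1, 0, 0],
     vector [0, 0, 1, 0],
     vector [a, 0, 0, - (r^2 + a^2)]]"

text \<open>The columns are the frame vectors. The second is d/dr - K ((r^2 + a^2) d/dt + a d/dphi),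
  a null vector, and the third is d/dtheta; the other two have no components along r and
  theta.\<close>

definition carter_frame :: "real \<Rightarrow> real \<Rightarrow> real \<Rightarrow> real \<Rightarrow> real \<Rightarrow> real^4^4" where
  "carter_frame a r s K u = vector [
     vector [(r^2 + a^2) * u, - (K * (r^2 + a^2)), 0, - (a * s^2 * u)],
     vector [0, 1, 0, 0],
     vector [0, 0, 1, 0],
     vector [a * u, - (K * a), 0, - u]]"

definition carter_metric_lr :: "real \<Rightarrow> real \<Rightarrow> real^4^4" where
  "carter_metric_lr A u = vector [
     vector [- (A * u), 1, 0, 0], vector [1, 0, 0, 0], vector [0, 0, 0, 0], vector [0, 0, 0, 0]]"

definition carter_metric_ang :: "real \<Rightarrow> real \<Rightarrow> real \<Rightarrow> real \<Rightarrow> real \<Rightarrow> real^4^4" where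
  "carter_metric_ang a r s c u = vector [
     vector [0, 0, 0, 0], vector [0, 0, 0, 0],
     vector [0, 0, r^2 + a^2 * c^2, 0], vector [0, 0, 0, s^2 * u]]"

definition carter_metric_inv :: "real \<Rightarrow> real \<Rightarrow> real \<Rightarrow> real \<Rightarrow> real \<Rightarrow> real \<Rightarrow> real^4^4" where
  "carter_metric_inv a r c A u v = vector [
     vector [0, 1, 0, 0], vector [1, A * u, 0, 0], vector [0, 0, u, 0],
     vector [0, 0, 0, (r^2 + a^2 * c^2) * v^2]]"

text \<open>In the applications the \<open>q\<^sub>i\<close> are the quotients of the polynomial \<open>x - y\<close> by the relations
  \<open>p\<^sub>i = 1\<close>.\<close>

lemma linear_combination3:
  fixes x y :: real
  assumes "p1 = 1" "p2 = 1" "p3 = 1"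
    and "x - y = q1 * (p1 - 1) + q2 * (p2 - 1) + q3 * (p3 - 1)"
  shows "x = y"
  using assms by simp

definition carter_coframe_dr :: "real \<Rightarrow> real \<Rightarrow> real \<Rightarrow> real \<Rightarrow> real \<Rightarrow> real^4^4" where
  "carter_coframe_dr a r c K K1 = vector [
     vector [0, 2 * r * K + (r^2 + a^2 * c^2) * K1, 0, 0],
     vector [0, 0, 0, 0],
     vector [0, 0, 0, 0],
     vector [0, 0, 0, - (2 * r)]]"

definition carter_coframe_d\<theta> :: "real \<Rightarrow> real \<Rightarrow> real \<Rightarrow> real \<Rightarrow> real^4^4" where
  "carter_coframe_d\<theta> a s c K = vector [
     vector [0, - (2 * a^2 * s * c * K), 0, - (2 * a * s * c)],
     vector [0, 0, 0, 0],
     vector [0, 0, 0, 0],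
     vector [0, 0, 0, 0]]"

definition carter_metric :: "real \<Rightarrow> real \<Rightarrow> real \<Rightarrow> real \<Rightarrow> real \<Rightarrow> real \<Rightarrow> real^4^4" where
  "carter_metric a r s c A u = carter_metric_lr A u + carter_metric_ang a r s c u"

definition carter_metric_dr :: "real \<Rightarrow> real \<Rightarrow> real \<Rightarrow> real \<Rightarrow> real \<Rightarrow> real^4^4" where
  "carter_metric_dr r s A A1 u = vector [
     vector [2 * r * A * u^2 - A1 * u, 0, 0, 0], vector [0, 0, 0, 0],
     vector [0, 0, 2 * r, 0], vector [0, 0, 0, - (2 * r * s^2 * u^2)]]"

definition carter_metric_d\<theta> :: "real \<Rightarrow> real \<Rightarrow> real \<Rightarrow> real \<Rightarrow> real \<Rightarrow> real^4^4" where
  "carter_metric_d\<theta> a s c A u = vector [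
     vector [- (2 * a^2 * s * c * A * u^2), 0, 0, 0], vector [0, 0, 0, 0],
     vector [0, 0, - (2 * a^2 * s * c), 0], vector [0, 0, 0, 2 * s * c * u + 2 * a^2 * s^3 * c * u^2]]"

context
  fixes a r s c A A1 A2 K K1 u v :: real
  assumes rel: "(r^2 + a^2 * c^2) * u = 1" "s * v = 1" "s^2 + c^2 = 1"
begin

lemma carter_dual:
  "carter_frame a r s K u ** carter_coframe a r s c K = mat 1"
proof -
  note c = linear_combination3[OF rel]
  note poly = algebra_simps add_divide_distrib diff_divide_distrib power2_eq_square power3_eq_cube numeral_eq_Suc
  note defs = sum_4 matrix_matrix_mult_def carter_frame_def carter_coframe_def vector_4 mat_def
  let ?P = "\<lambda>i j. (carter_frame a r s K u ** carter_coframe a r s c K) $ i $ j = mat 1 $ i $ j"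
  have p11: "?P 1 1"
    by (rule c[of _ _ "1" "0" "- (a^2 * u)"]) (simp add: defs poly)
  have p12: "?P 1 2"
    by (rule c[of _ _ "r^2 * K + a^2 * K" "0" "0"]) (simp add: defs poly)
  have p42: "?P 4 2"
    by (rule c[of _ _ "a * K" "0" "0"]) (simp add: defs poly)
  have p44: "?P 4 4"
    by (rule c[of _ _ "1" "0" "- (a^2 * u)"]) (simp add: defs poly)
  \<comment> \<open>The entries not listed above hold by expansion alone, without the
    relations.\<close>
  have "\<forall>i j. ?P i j"
    unfolding forall_4 by (intro conjI; (rule p11 p12 p42 p44 | (simp add: defs poly; fail)))
  then show ?thesis
    by (simp add: vec_eq_iff)
qed

lemma carter_metric_inv:
  "carter_metric a r s c A u ** carter_metric_inv a r c A u v = mat 1"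
proof -
  have "s^2 * u * ((r^2 + a^2 * c^2) * v^2) = ((r^2 + a^2 * c^2) * u) * (s * v)^2"
    by (simp add: power_mult_distrib)
  then show ?thesis
    using rel by (simp add: vec_eq_iff forall_4 sum_4 matrix_matrix_mult_def carter_metric_def
        carter_metric_lr_def carter_metric_ang_def carter_metric_inv_def vector_4 mat_def)
qed

text \<open>On functions of r and theta the frame vectors e_2 and e_3 act as d/dr and d/dtheta,
  while e_1 and e_4 act as zero. The left-hand side is therefore the derivative of the frame metric
  along e_k.\<close>

lemma carter_compatible:
  "(if k = 2 then carter_metric_dr r s A A1 u else if k = 3 then carter_metric_d\<theta> a s c A u else 0)
    = carter_metric a r s c A u ** carter_conn a r s c A A1 u v $ k
      + transpose (carter_metric a r s c A u ** carter_conn a r s c A A1 u v $ k)"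
proof -
  note c = linear_combination3[OF rel]
  note poly = algebra_simps add_divide_distrib diff_divide_distrib power2_eq_square power3_eq_cube numeral_eq_Suc
  note defs = sum_4 matrix_matrix_mult_def transpose_def carter_metric_def carter_metric_lr_def
    carter_metric_ang_def carter_metric_dr_def carter_metric_d\<theta>_def carter_conn_def vector_4
  let ?P = "\<lambda>k i j. (if k = 2 then carter_metric_dr r s A A1 u else if k = 3 then carter_metric_d\<theta> a s c A u else 0) $ i $ j
    = (carter_metric a r s c A u ** carter_conn a r s c A A1 u v $ k
      + transpose (carter_metric a r s c A u ** carter_conn a r s c A A1 u v $ k)) $ i $ j"
  have p113: "?P 1 1 3"
    by (rule c[of _ _ "a^2 * s * c * A * u^2" "0" "0"]) (simp add: defs poly)
  have p123: "?P 1 2 3"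
    by (rule c[of _ _ "- (a^2 * s * c * u)" "0" "0"]) (simp add: defs poly)
  have p131: "?P 1 3 1"
    by (rule c[of _ _ "a^2 * s * c * A * u^2" "0" "0"]) (simp add: defs poly)
  have p132: "?P 1 3 2"
    by (rule c[of _ _ "- (a^2 * s * c * u)" "0" "0"]) (simp add: defs poly)
  have p134: "?P 1 3 4"
    by (rule c[of _ _ "- (a * s * c * A * u^2)" "a * s * c * A * u^2" "0"]) (simp add: defs poly)
  have p143: "?P 1 4 3"
    by (rule c[of _ _ "- (a * s * c * A * u^2)" "a * s * c * A * u^2" "0"]) (simp add: defs poly)
  have p213: "?P 2 1 3"
    by (rule c[of _ _ "- (a^2 * s * c * u)" "0" "0"]) (simp add: defs poly)
  have p231: "?P 2 3 1"
    by (rule c[of _ _ "- (a^2 * s * c * u)" "0" "0"]) (simp add: defs poly)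
  have p233: "?P 2 3 3"
    by (rule c[of _ _ "- (2 * r)" "0" "0"]) (simp add: defs poly)
  have p234: "?P 2 3 4"
    by (rule c[of _ _ "a * s * c * u" "- (a * s * c * u)" "0"]) (simp add: defs poly)
  have p243: "?P 2 4 3"
    by (rule c[of _ _ "a * s * c * u" "- (a * s * c * u)" "0"]) (simp add: defs poly)
  have p314: "?P 3 1 4"
    by (rule c[of _ _ "0" "a * s * c * A * u^2" "0"]) (simp add: defs poly)
  have p323: "?P 3 2 3"
    by (rule c[of _ _ "- r" "0" "0"]) (simp add: defs poly)
  have p324: "?P 3 2 4"
    by (rule c[of _ _ "0" "- (a * s * c * u)" "0"]) (simp add: defs poly)
  have p332: "?P 3 3 2"
    by (rule c[of _ _ "- r" "0" "0"]) (simp add: defs poly)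
  have p333: "?P 3 3 3"
    by (rule c[of _ _ "2 * a^2 * s * c" "0" "0"]) (simp add: defs poly)
  have p341: "?P 3 4 1"
    by (rule c[of _ _ "0" "a * s * c * A * u^2" "0"]) (simp add: defs poly)
  have p342: "?P 3 4 2"
    by (rule c[of _ _ "0" "- (a * s * c * u)" "0"]) (simp add: defs poly)
  have p344: "?P 3 4 4"
    by (rule c[of _ _ "0" "- (2 * s * c * u)" "0"]) (simp add: defs poly)
  have p413: "?P 4 1 3"
    by (rule c[of _ _ "- (a * s * c * A * u^2)" "0" "0"]) (simp add: defs poly)
  have p423: "?P 4 2 3"
    by (rule c[of _ _ "a * s * c * u" "0" "0"]) (simp add: defs poly)
  have p431: "?P 4 3 1"
    by (rule c[of _ _ "- (a * s * c * A * u^2)" "0" "0"]) (simp add: defs poly)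
  have p432: "?P 4 3 2"
    by (rule c[of _ _ "a * s * c * u" "0" "0"]) (simp add: defs poly)
  have p434: "?P 4 3 4"
    by (rule c[of _ _ "r^2 * s * c * u^2 + a^2 * s * c * u^2 + s * c * u" "- (s * c * u)" "- (a^2 * s * c * u^2)"]) (simp add: defs poly)
  have p443: "?P 4 4 3"
    by (rule c[of _ _ "r^2 * s * c * u^2 + a^2 * s * c * u^2 + s * c * u" "- (s * c * u)" "- (a^2 * s * c * u^2)"]) (simp add: defs poly)
  have "\<forall>k i j. ?P k i j"
    unfolding forall_4 by (intro conjI; (rule p113 p123 p131 p132 p134 p143 p213 p231 p233 p234 p243 p314 p323 p324 p332 p333 p341 p342 p344 p413 p423 p431 p432 p434 p443 | (simp add: defs poly; fail)))
  then show ?thesis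
    by (simp add: vec_eq_iff)
qed

text \<open>The first structure equation, and the reason why \<open>carter_conn\<close> can be free
  of \<open>K\<close>: \<open>K1\<close> cancels under antisymmetrisation, since it occurs only in
  the r-derivative of a dr-component, and \<open>K\<close> enters both sides through the same
  dr-component.\<close>

lemma carter_torsion:
  defines "d \<equiv> \<lambda>k. if k = 2 then carter_coframe_dr a r c K K1 else if k = 3 then carter_coframe_d\<theta> a s c K else 0"
    and "t \<equiv> carter_coframe a r s c K"
  shows "d j $ i $ k - d k $ i $ j = (\<Sum>b\<in>UNIV. \<Sum>e\<in>UNIV.
    carter_conn a r s c A A1 u v $ e $ i $ b * (t $ b $ j * t $ e $ k - t $ b $ k * t $ e $ j))"
proof -
  note c = linear_combination3[OF rel]
  note poly = algebra_simps add_divide_distrib diff_divide_distrib power2_eq_square power3_eq_cube numeral_eq_Suc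
  note defs = sum_4 carter_coframe_def carter_coframe_dr_def carter_coframe_d\<theta>_def carter_conn_def
    vector_4 d_def t_def
  let ?P = "\<lambda>j i k. d j $ i $ k - d k $ i $ j = (\<Sum>b\<in>UNIV. \<Sum>e\<in>UNIV.
    carter_conn a r s c A A1 u v $ e $ i $ b * (t $ b $ j * t $ e $ k - t $ b $ k * t $ e $ j))"
  have p213: "?P 2 1 3"
    by (rule c[of _ _ "- (2 * a^2 * s * c * K)" "0" "0"]) (simp add: defs poly)
  have p244: "?P 2 4 4"
    by (rule c[of _ _ "2 * r" "0" "- (2 * r * a^2 * u)"]) (simp add: defs poly)
  have p312: "?P 3 1 2"
    by (rule c[of _ _ "2 * a^2 * s * c * K" "0" "0"]) (simp add: defs poly)
  have p314: "?P 3 1 4"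
    by (rule c[of _ _ "2 * a * s * c" "0" "- (2 * a^3 * s * c * u)"]) (simp add: defs poly)
  have p442: "?P 4 4 2"
    by (rule c[of _ _ "- (2 * r)" "0" "2 * r * a^2 * u"]) (simp add: defs poly)
  have p413: "?P 4 1 3"
    by (rule c[of _ _ "- (2 * a * s * c)" "0" "2 * a^3 * s * c * u"]) (simp add: defs poly)
  have "\<forall>j i k. ?P j i k"
    unfolding forall_4 by (intro conjI; (rule p213 p244 p312 p314 p442 p413 | (simp add: defs poly; fail)))
  then show ?thesis
    by blast
qed

text \<open>\<open>A\<close>, \<open>A1\<close>, \<open>A2\<close> are independent reals, so one
  identity serves every mass function. For \<open>A\<close> = Delta one gets \<open>\<rho>\<close> =
  2 r^2 M' / Sigma^2 and \<open>1 - A2 / 2\<close> = 2 M' + r M''.\<close>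

lemma carter_ricci:
  defines "W \<equiv> \<lambda>k. carter_conn a r s c A A1 u v $ k"
  defines "eW \<equiv> \<lambda>d k. if d = 2 then carter_conn_dr a r s c A A1 A2 u v $ k
      else if d = 3 then carter_conn_d\<theta> a r s c A A1 u v $ k else 0"
  defines "\<rho> \<equiv> (r^2 - r * A1 - a^2 + A) * u^2"
  shows "(\<Sum>i\<in>UNIV. (eW i d - eW d i + W i ** W d - W d ** W i
       + (\<Sum>e\<in>UNIV. (W d $ e $ i - W i $ e $ d) *\<^sub>R W e)) $ i $ b)
    = (((1 - A2 / 2) * u - \<rho>) *\<^sub>R carter_metric_lr A u + \<rho> *\<^sub>R carter_metric_ang a r s c u) $ b $ d"
proof -
  note c = linear_combination3[OF rel]
  note poly = algebra_simps add_divide_distrib diff_divide_distrib power2_eq_square power3_eq_cube numeral_eq_Suc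
  note defs = sum_4 carter_metric_lr_def carter_metric_ang_def W_def eW_def carter_conn_def
    carter_conn_dr_def carter_conn_d\<theta>_def vector_4 matrix_matrix_mult_def \<rho>_def
  let ?P = "\<lambda>b d. (\<Sum>i\<in>UNIV. (eW i d - eW d i + W i ** W d - W d ** W i
       + (\<Sum>e\<in>UNIV. (W d $ e $ i - W i $ e $ d) *\<^sub>R W e)) $ i $ b)
    = (((1 - A2 / 2) * u - \<rho>) *\<^sub>R carter_metric_lr A u + \<rho> *\<^sub>R carter_metric_ang a r s c u) $ b $ d"
  have p11: "?P 1 1"
    by (rule c[of _ _ "2 * A^2 * u^3 - A * u^2 + 2 * a^2 * c^2 * A * u^3 - 2 * a^2 * A * u^3" "2 * a^2 * c^2 * A^2 * u^4 - a^2 * c^2 * A * u^3" "- (2 * a^4 * c^2 * A * u^4) - 2 * r^2 * a^2 * A * u^4 + a^2 * A * u^3"]) (simp add: defs poly)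
  have p12: "?P 1 2"
    by (rule c[of _ _ "- (2 * A * u^2) + u - 2 * a^2 * c^2 * u^2 + 2 * a^2 * u^2" "- (2 * a^2 * c^2 * A * u^3) + a^2 * c^2 * u^2" "2 * a^4 * c^2 * u^3 + 2 * r^2 * a^2 * u^3 - a^2 * u^2"]) (simp add: defs poly)
  have p13: "?P 1 3"
    by (simp add: defs poly)
  have p14: "?P 1 4"
    by (rule c[of _ _ "- (a * c^2 * A * u^3)" "- (r^2 * a * c^2 * A * u^4) - a^3 * c^2 * A * u^4" "a^3 * c^2 * A * u^4"]) (simp add: defs poly)
  have p21: "?P 2 1"
    by (rule c[of _ _ "- (2 * A * u^2) + u - 2 * a^2 * c^2 * u^2 + 2 * a^2 * u^2" "- (2 * a^2 * c^2 * A * u^3) + a^2 * c^2 * u^2" "2 * a^4 * c^2 * u^3 + 2 * r^2 * a^2 * u^3 - a^2 * u^2"]) (simp add: defs poly)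
  have p22: "?P 2 2"
    by (rule c[of _ _ "2 * u" "2 * a^2 * c^2 * u^2" "0"]) (simp add: defs poly)
  have p23: "?P 2 3"
    by (rule c[of _ _ "0" "r * a^2 * s * c * u^2" "0"]) (simp add: defs poly)
  have p24: "?P 2 4"
    by (rule c[of _ _ "a * c^2 * u^2" "r^2 * a * c^2 * u^3 + a^3 * c^2 * u^3" "- (a^3 * c^2 * u^3)"]) (simp add: defs poly)
  have p31: "?P 3 1"
    by (simp add: defs poly)
  have p32: "?P 3 2"
    by (rule c[of _ _ "0" "r * a^2 * s * c * u^2" "0"]) (simp add: defs poly)
  have p33: "?P 3 3"
    by (rule c[of _ _ "A * u - r^2 * u + r * A1 * u + a^2 * u - 1" "2 * a^2 * c^2 * A * u^2 + 1 - 3 * a^2 * c^2 * u" "- (a^2 * u)"]) (simp add: defs poly)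
  have p34: "?P 3 4"
    by (simp add: defs poly)
  have p41: "?P 4 1"
    by (rule c[of _ _ "- (a * c^2 * A * u^3)" "- (r^2 * a * c^2 * A * u^4) - a^3 * c^2 * A * u^4" "a^3 * c^2 * A * u^4"]) (simp add: defs poly)
  have p42: "?P 4 2"
    by (rule c[of _ _ "a * c^2 * u^2" "r^2 * a * c^2 * u^3 + a^3 * c^2 * u^3" "- (a^3 * c^2 * u^3)"]) (simp add: defs poly)
  have p43: "?P 4 3"
    by (simp add: defs poly)
  have p44: "?P 4 4"
    by (rule c[of _ _ "- (2 * c^2 * A * u^3) + 2 * A * u^3 + 2 * a^2 * c^2 * u^3 - 2 * a^2 * u^3" "r^2 * c^2 * u^3 + a^2 * c^2 * u^3" "2 * r^2 * A * u^4 - 2 * r^2 * a^2 * s^2 * u^4 - 2 * a^4 * c^2 * u^4 + 2 * a^2 * c^2 * A * u^4 - 2 * A * u^3 + 2 * a^2 * u^3 - 2 * r^2 * a^2 * u^4"]) (simp add: defs poly)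
  have "\<forall>b d. ?P b d"
    unfolding forall_4 by (intro conjI; rule p11 p12 p13 p14 p21 p22 p23 p24 p31 p32 p33 p34 p41 p42 p43 p44)
  then show ?thesis
    by blast
qed

end

section \<open>The dominant energy condition off the axis\<close>

text \<open>With one index raised, \<open>G\<close> is multiplication by \<open>- \<rho>\<close> on
  one block and by \<open>p\<close> on the other. So the energy density is \<open>- \<rho>\<close>
  times g(v,v) plus \<open>p + \<rho>\<close> times g2(v,v), and the square of the current is
  \<open>\<rho>\<^sup>2\<close> times g(v,v) minus \<open>\<rho>\<^sup>2 - p\<^sup>2\<close> times
  g2(v,v). For timelike v both signs follow from \<open>psd\<close> and
  \<open>bound\<close>.\<close>

lemma dominant_energy_condition_blocks:
  fixes g g1 g2 G H :: "real^'n^'n::finite"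
  assumes g: "g = g1 + g2" and inv: "H ** g = mat 1"
    and sym: "transpose g1 = g1" "transpose g2 = g2" and orth: "g1 ** H ** g2 = 0"
    and psd: "\<And>v. v \<bullet> (g2 *v v) \<ge> 0"
    and G: "G = (- \<rho>) *\<^sub>R g1 + p *\<^sub>R g2" and bound: "\<bar>p\<bar> \<le> \<rho>"
  shows "dominant_energy_condition g G"
  unfolding dominant_energy_condition_def matrix_inv_eqI[OF inv] Let_def
proof (intro allI impI conjI)
  fix v :: "real^'n"
  assume timelike: "v \<bullet> (g *v v) < 0"
  \<comment> \<open>The components of \<open>v\<close> in the two blocks; \<open>orth\<close> makes
    each of them invisible to the form of the other block.\<close>
  define a b where "a = H *v (g1 *v v)" and "b = H *v (g2 *v v)"
  have gH: "g ** H = mat 1"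
    using inv matrix_left_right_inverse by blast
  have ab: "a + b = v"
    unfolding a_def b_def using inv
    by (simp add: g matrix_vector_mul_assoc matrix_add_ldistrib flip: matrix_vector_mult_add_rdistrib matrix_vector_right_distrib)
  have g1b: "g1 *v b = 0"
    by (simp add: b_def matrix_vector_mul_assoc orth matrix_mul_assoc)
  have g1a: "g1 *v a = g1 *v v"
    using ab g1b by (metis add.right_neutral matrix_vector_right_distrib)
  have "g *v a = g1 *v v"
    by (simp add: a_def matrix_vector_mul_assoc matrix_mul_assoc gH)
  then have g2a: "g2 *v a = 0"
    by (simp add: g matrix_vector_mult_add_rdistrib g1a)
  have g2b: "g2 *v b = g2 *v v"
    using ab g2a by (metis add.left_neutral matrix_vector_right_distrib)
  have symD: "x \<bullet> (A *v y) = (A *v x) \<bullet> y" if "transpose A = A" for A :: "real^'n^'n" and x y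
    using dot_lmul_matrix[of x A y] that by (metis transpose_matrix_vector)
  have q1: "v \<bullet> (g1 *v v) = a \<bullet> (g1 *v a)"
    using ab g1b symD[OF sym(1)] by (metis add.right_neutral g1a inner_commute inner_add_left inner_zero_left)
  have q2: "v \<bullet> (g2 *v v) = b \<bullet> (g2 *v b)"
    using ab g2a symD[OF sym(2)] by (metis add.left_neutral g2b inner_commute inner_add_left inner_zero_left)
  have x1: "b \<bullet> (g1 *v v) = 0" and x2: "a \<bullet> (g2 *v v) = 0"
    by (simp_all add: symD[OF sym(1)] symD[OF sym(2)] g1b g2a)
  have Gv: "G *v v = (- \<rho>) *\<^sub>R (g1 *v v) + p *\<^sub>R (g2 *v v)"
    by (simp only: G matrix_vector_mult_add_rdistrib scaleR_matrix_vector_assoc)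
  have HGv: "(H ** G) *v v = (- \<rho>) *\<^sub>R a + p *\<^sub>R b"
    by (simp only: a_def b_def Gv matrix_vector_right_distrib matrix_vector_mult_scaleR
        flip: matrix_vector_mul_assoc)
  have gv: "v \<bullet> (g1 *v v) + v \<bullet> (g2 *v v) < 0"
    using timelike by (simp add: g matrix_vector_mult_add_rdistrib inner_add_right)
  have "\<rho> \<ge> 0" "p \<ge> - \<rho>" "p\<^sup>2 \<le> \<rho>\<^sup>2"
    using bound by (auto simp: abs_le_square_iff[symmetric])
  have "v \<bullet> (G *v v) = - \<rho> * (v \<bullet> (g1 *v v) + v \<bullet> (g2 *v v)) + (p + \<rho>) * (v \<bullet> (g2 *v v))"
    by (simp add: Gv inner_add_right algebra_simps)
  also have "\<dots> \<ge> 0"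
    using \<open>\<rho> \<ge> 0\<close> \<open>p \<ge> - \<rho>\<close> psd[of v] gv mult_nonneg_nonneg[of "p + \<rho>" "v \<bullet> (g2 *v v)"]
      mult_nonpos_nonpos[of "- \<rho>" "v \<bullet> (g1 *v v) + v \<bullet> (g2 *v v)"] by linarith
  finally show "v \<bullet> (G *v v) \<ge> 0" .
  have "- ((H ** G) *v v) \<bullet> (g *v (- ((H ** G) *v v))) = ((H ** G) *v v) \<bullet> (G *v v)"
    using matrix_vector_mult_scaleR[of g "-1" "(H ** G) *v v"]
    by (simp add: gH matrix_vector_mul_assoc matrix_mul_assoc)
  also have "\<dots> = \<rho>\<^sup>2 * (v \<bullet> (g1 *v v)) + p\<^sup>2 * (v \<bullet> (g2 *v v))"
    unfolding HGv Gv q1 q2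
    using x1 x2 by (simp add: inner_diff_right inner_diff_left g1a g2b power2_eq_square)
  also have "\<dots> = \<rho>\<^sup>2 * (v \<bullet> (g1 *v v) + v \<bullet> (g2 *v v)) - (\<rho>\<^sup>2 - p\<^sup>2) * (v \<bullet> (g2 *v v))"
    by (simp add: algebra_simps)
  also have "\<dots> \<le> 0"
    using \<open>p\<^sup>2 \<le> \<rho>\<^sup>2\<close> psd[of v] gv mult_nonneg_nonpos[of "\<rho>\<^sup>2" "v \<bullet> (g1 *v v) + v \<bullet> (g2 *v v)"]
      mult_nonneg_nonneg[of "\<rho>\<^sup>2 - p\<^sup>2" "v \<bullet> (g2 *v v)"] zero_le_power2[of \<rho>] by linarith
  finally show "- ((H ** G) *v v) \<bullet> (g *v (- ((H ** G) *v v))) \<le> 0" .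
qed

lemma has_mpd_coordinates:
  fixes F :: "real \<Rightarrow> real \<Rightarrow> real^'q^'p" and y :: "real^4"
  assumes "\<And>i j. ((\<lambda>r. F r (y $ 3) $ i $ j) has_real_derivative Dr $ i $ j) (at (y $ 2))"
    and "\<And>i j. ((\<lambda>\<theta>. F (y $ 2) \<theta> $ i $ j) has_real_derivative D\<theta> $ i $ j) (at (y $ 3))"
  shows "has_mpd k (\<lambda>y. F (y $ 2) (y $ 3)) (if k = 2 then Dr else if k = 3 then D\<theta> else 0) y"
proof -
  have "k = 1 \<or> k = 2 \<or> k = 3 \<or> k = 4"
    by (rule exhaust_4)
  then show ?thesis
    using assms DERIV_shift[of _ _ 0 "y $ 2"] DERIV_shift[of _ _ 0 "y $ 3"]
    by (auto simp: has_mpd_def has_pd_def axis_def add.commute)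
qed

text \<open>With \<open>carter_frame_d\<theta>\<close>, the witness for the axiom
  \<open>E_diff\<close>.\<close>

definition carter_frame_dr :: "real \<Rightarrow> real \<Rightarrow> real \<Rightarrow> real \<Rightarrow> real \<Rightarrow> real \<Rightarrow> real^4^4" where
  "carter_frame_dr a r s K K1 u = vector [
     vector [2 * r * u - (r^2 + a^2) * (2 * r * u^2), - (K1 * (r^2 + a^2)) - K * (2 * r), 0, a * s^2 * (2 * r * u^2)],
     vector [0, 0, 0, 0],
     vector [0, 0, 0, 0],
     vector [- (a * (2 * r * u^2)), - (K1 * a), 0, 2 * r * u^2]]"

definition carter_frame_d\<theta> :: "real \<Rightarrow> real \<Rightarrow> real \<Rightarrow> real \<Rightarrow> real \<Rightarrow> real^4^4" where
  "carter_frame_d\<theta> a r s c u = vector [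
     vector [(r^2 + a^2) * (2 * a^2 * s * c * u^2), 0, 0, - (a * (2 * s * c * u + s^2 * (2 * a^2 * s * c * u^2)))],
     vector [0, 0, 0, 0],
     vector [0, 0, 0, 0],
     vector [a * (2 * a^2 * s * c * u^2), 0, 0, - (2 * a^2 * s * c * u^2)]]"

definition carter_coframe_drr :: "real \<Rightarrow> real \<Rightarrow> real \<Rightarrow> real \<Rightarrow> real \<Rightarrow> real \<Rightarrow> real^4^4" where
  "carter_coframe_drr a r c K K1 K2 = vector [
     vector [0, 2 * K + 4 * r * K1 + (r^2 + a^2 * c^2) * K2, 0, 0],
     vector [0, 0, 0, 0],
     vector [0, 0, 0, 0],
     vector [0, 0, 0, - 2]]"

definition carter_coframe_dr\<theta> :: "real \<Rightarrow> real \<Rightarrow> real \<Rightarrow> real \<Rightarrow> real^4^4" where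
  "carter_coframe_dr\<theta> a s c K1 = vector [
     vector [0, - (2 * a^2 * s * c * K1), 0, 0],
     vector [0, 0, 0, 0],
     vector [0, 0, 0, 0],
     vector [0, 0, 0, 0]]"

definition carter_coframe_d\<theta>\<theta> :: "real \<Rightarrow> real \<Rightarrow> real \<Rightarrow> real \<Rightarrow> real^4^4" where
  "carter_coframe_d\<theta>\<theta> a s c K = vector [
     vector [0, - (2 * a^2 * (c^2 - s^2) * K), 0, - (2 * a * (c^2 - s^2))],
     vector [0, 0, 0, 0],
     vector [0, 0, 0, 0],
     vector [0, 0, 0, 0]]"

lemma has_mpd_carter:
  fixes y :: "real^4"
  assumes pos: "y $ 2 > 0" and sin: "sin (y $ 3) \<noteq> 0"
    and dA: "(A has_real_derivative A1 (y $ 2)) (at (y $ 2))"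
    and dK: "(K has_real_derivative K1 (y $ 2)) (at (y $ 2))"
    and dK1: "(K1 has_real_derivative K2) (at (y $ 2))"
  shows "has_mpd k (\<lambda>y. carter_coframe a (y $ 2) (sin (y $ 3)) (cos (y $ 3)) (K (y $ 2)))
      (if k = 2 then carter_coframe_dr a (y $ 2) (cos (y $ 3)) (K (y $ 2)) (K1 (y $ 2))
       else if k = 3 then carter_coframe_d\<theta> a (sin (y $ 3)) (cos (y $ 3)) (K (y $ 2)) else 0) y" (is ?th1)
    and "has_mpd k (\<lambda>y. carter_coframe_dr a (y $ 2) (cos (y $ 3)) (K (y $ 2)) (K1 (y $ 2)))
      (if k = 2 then carter_coframe_drr a (y $ 2) (cos (y $ 3)) (K (y $ 2)) (K1 (y $ 2)) K2
       else if k = 3 then carter_coframe_dr\<theta> a (sin (y $ 3)) (cos (y $ 3)) (K1 (y $ 2)) else 0) y" (is ?th2)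
    and "has_mpd k (\<lambda>y. carter_coframe_d\<theta> a (sin (y $ 3)) (cos (y $ 3)) (K (y $ 2)))
      (if k = 2 then carter_coframe_dr\<theta> a (sin (y $ 3)) (cos (y $ 3)) (K1 (y $ 2))
       else if k = 3 then carter_coframe_d\<theta>\<theta> a (sin (y $ 3)) (cos (y $ 3)) (K (y $ 2)) else 0) y" (is ?th3)
    and "has_mpd k (\<lambda>y. carter_frame a (y $ 2) (sin (y $ 3)) (K (y $ 2)) (inv_Sigma a (y $ 2) (y $ 3)))
      (if k = 2 then carter_frame_dr a (y $ 2) (sin (y $ 3)) (K (y $ 2)) (K1 (y $ 2)) (inv_Sigma a (y $ 2) (y $ 3))
       else if k = 3 then carter_frame_d\<theta> a (y $ 2) (sin (y $ 3)) (cos (y $ 3)) (inv_Sigma a (y $ 2) (y $ 3)) else 0) y" (is ?th4)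
    and "has_mpd k (\<lambda>y. carter_metric a (y $ 2) (sin (y $ 3)) (cos (y $ 3)) (A (y $ 2)) (inv_Sigma a (y $ 2) (y $ 3)))
      (if k = 2 then carter_metric_dr (y $ 2) (sin (y $ 3)) (A (y $ 2)) (A1 (y $ 2)) (inv_Sigma a (y $ 2) (y $ 3))
       else if k = 3 then carter_metric_d\<theta> a (sin (y $ 3)) (cos (y $ 3)) (A (y $ 2)) (inv_Sigma a (y $ 2) (y $ 3)) else 0) y" (is ?th5)
proof -
  note deriv = derivative_eq_intros dA dK dK1 DERIV_inv_Sigma_r[OF pos] DERIV_inv_Sigma_\<theta>[OF pos]
  note poly = algebra_simps power2_eq_square power3_eq_cube
  have "\<forall>i j. ((\<lambda>r. carter_coframe a r (sin (y $ 3)) (cos (y $ 3)) (K r) $ i $ j) has_real_derivative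
      carter_coframe_dr a (y $ 2) (cos (y $ 3)) (K (y $ 2)) (K1 (y $ 2)) $ i $ j) (at (y $ 2))"
    unfolding forall_4 carter_coframe_def carter_coframe_dr_def vector_4
    by (intro conjI; (auto intro!: deriv simp: poly))
  moreover have "\<forall>i j. ((\<lambda>\<theta>. carter_coframe a (y $ 2) (sin \<theta>) (cos \<theta>) (K (y $ 2)) $ i $ j) has_real_derivative
      carter_coframe_d\<theta> a (sin (y $ 3)) (cos (y $ 3)) (K (y $ 2)) $ i $ j) (at (y $ 3))"
    unfolding forall_4 carter_coframe_def carter_coframe_d\<theta>_def vector_4
    by (intro conjI; (auto intro!: deriv simp: poly))
  ultimately show ?th1
    by (intro has_mpd_coordinates) blast+
  have "\<forall>i j. ((\<lambda>r. carter_coframe_dr a r (cos (y $ 3)) (K r) (K1 r) $ i $ j) has_real_derivative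
      carter_coframe_drr a (y $ 2) (cos (y $ 3)) (K (y $ 2)) (K1 (y $ 2)) K2 $ i $ j) (at (y $ 2))"
    unfolding forall_4 carter_coframe_dr_def carter_coframe_drr_def vector_4
    by (intro conjI; (auto intro!: deriv simp: poly))
  moreover have "\<forall>i j. ((\<lambda>\<theta>. carter_coframe_dr a (y $ 2) (cos \<theta>) (K (y $ 2)) (K1 (y $ 2)) $ i $ j) has_real_derivative
      carter_coframe_dr\<theta> a (sin (y $ 3)) (cos (y $ 3)) (K1 (y $ 2)) $ i $ j) (at (y $ 3))"
    unfolding forall_4 carter_coframe_dr_def carter_coframe_dr\<theta>_def vector_4
    by (intro conjI; (auto intro!: deriv simp: poly))
  ultimately show ?th2
    by (intro has_mpd_coordinates) blast+
  have "\<forall>i j. ((\<lambda>r. carter_coframe_d\<theta> a (sin (y $ 3)) (cos (y $ 3)) (K r) $ i $ j) has_real_derivative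
      carter_coframe_dr\<theta> a (sin (y $ 3)) (cos (y $ 3)) (K1 (y $ 2)) $ i $ j) (at (y $ 2))"
    unfolding forall_4 carter_coframe_d\<theta>_def carter_coframe_dr\<theta>_def vector_4
    by (intro conjI; (auto intro!: deriv simp: poly))
  moreover have "\<forall>i j. ((\<lambda>\<theta>. carter_coframe_d\<theta> a (sin \<theta>) (cos \<theta>) (K (y $ 2)) $ i $ j) has_real_derivative
      carter_coframe_d\<theta>\<theta> a (sin (y $ 3)) (cos (y $ 3)) (K (y $ 2)) $ i $ j) (at (y $ 3))"
    unfolding forall_4 carter_coframe_d\<theta>_def carter_coframe_d\<theta>\<theta>_def vector_4
    by (intro conjI; (auto intro!: deriv simp: poly))
  ultimately show ?th3
    by (intro has_mpd_coordinates) blast+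
  have "\<forall>i j. ((\<lambda>r. carter_frame a r (sin (y $ 3)) (K r) (inv_Sigma a r (y $ 3)) $ i $ j) has_real_derivative
      carter_frame_dr a (y $ 2) (sin (y $ 3)) (K (y $ 2)) (K1 (y $ 2)) (inv_Sigma a (y $ 2) (y $ 3)) $ i $ j) (at (y $ 2))"
    unfolding forall_4 carter_frame_def carter_frame_dr_def vector_4
    by (intro conjI; (auto intro!: deriv simp: poly))
  moreover have "\<forall>i j. ((\<lambda>\<theta>. carter_frame a (y $ 2) (sin \<theta>) (K (y $ 2)) (inv_Sigma a (y $ 2) \<theta>) $ i $ j) has_real_derivative
      carter_frame_d\<theta> a (y $ 2) (sin (y $ 3)) (cos (y $ 3)) (inv_Sigma a (y $ 2) (y $ 3)) $ i $ j) (at (y $ 3))"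
    unfolding forall_4 carter_frame_def carter_frame_d\<theta>_def vector_4
    by (intro conjI; (auto intro!: deriv simp: poly))
  ultimately show ?th4
    by (intro has_mpd_coordinates) blast+
  have "\<forall>i j. ((\<lambda>r. carter_metric a r (sin (y $ 3)) (cos (y $ 3)) (A r) (inv_Sigma a r (y $ 3)) $ i $ j) has_real_derivative
      carter_metric_dr (y $ 2) (sin (y $ 3)) (A (y $ 2)) (A1 (y $ 2)) (inv_Sigma a (y $ 2) (y $ 3)) $ i $ j) (at (y $ 2))"
    unfolding forall_4 carter_metric_def carter_metric_lr_def carter_metric_ang_def carter_metric_dr_def
      vector_4 vector_add_component
    by (intro conjI; (auto intro!: deriv simp: poly))
  moreover have "\<forall>i j. ((\<lambda>\<theta>. carter_metric a (y $ 2) (sin \<theta>) (cos \<theta>) (A (y $ 2)) (inv_Sigma a (y $ 2) \<theta>) $ i $ j) has_real_derivative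
      carter_metric_d\<theta> a (sin (y $ 3)) (cos (y $ 3)) (A (y $ 2)) (inv_Sigma a (y $ 2) (y $ 3)) $ i $ j) (at (y $ 3))"
    unfolding forall_4 carter_metric_def carter_metric_lr_def carter_metric_ang_def carter_metric_d\<theta>_def
      vector_4 vector_add_component
    by (intro conjI; (auto intro!: deriv simp: poly))
  ultimately show ?th5
    by (intro has_mpd_coordinates) blast+
qed

lemma carter_metric_parts:
  "transpose (carter_metric_lr A u) = carter_metric_lr A u"
  "transpose (carter_metric_ang a r s c u) = carter_metric_ang a r s c u"
  "carter_metric_lr A u ** carter_metric_inv a r c A u v ** carter_metric_ang a r s c u = 0"
  by (simp_all add: vec_eq_iff forall_4 sum_4 matrix_matrix_mult_def transpose_def vector_4
      carter_metric_lr_def carter_metric_ang_def carter_metric_inv_def)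

lemma carter_metric_ang_psd:
  "u \<ge> 0 \<Longrightarrow> w \<bullet> (carter_metric_ang a r s c u *v w) \<ge> 0"
  by (simp add: inner_vec_def matrix_vector_mult_def sum_4 carter_metric_ang_def vector_4
      mult.left_commute[of "w $ _"] power2_eq_square[symmetric])

text \<open>The Boyer-Lindquist form is the case \<open>K = 1 / A\<close>, the Doran form another choice of \<open>K\<close>; the
  one-form \<open>S K dr\<close> in the coframe only reparametrises \<open>t\<close> and \<open>\<phi>\<close> along \<open>r\<close>,
  so \<open>K\<close> does not enter the curvature.\<close>

lemma effective_DEC_carter:
  fixes A A1 A2 K K1 K2 :: "real \<Rightarrow> real" and x :: "real^4"
  assumes I: "open I" and pos: "\<And>r. r \<in> I \<Longrightarrow> r > 0"
    and dA: "\<And>r. r \<in> I \<Longrightarrow> (A has_real_derivative A1 r) (at r)"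
    and dA1: "\<And>r. r \<in> I \<Longrightarrow> (A1 has_real_derivative A2 r) (at r)"
    and dK: "\<And>r. r \<in> I \<Longrightarrow> (K has_real_derivative K1 r) (at r)"
    and dK1: "\<And>r. r \<in> I \<Longrightarrow> (K1 has_real_derivative K2 r) (at r)"
    and g: "\<And>y. y $ 2 \<in> I \<Longrightarrow> 0 < y $ 3 \<Longrightarrow> y $ 3 < pi \<Longrightarrow> g y =
      transpose (carter_coframe a (y $ 2) (sin (y $ 3)) (cos (y $ 3)) (K (y $ 2)))
      ** carter_metric a (y $ 2) (sin (y $ 3)) (cos (y $ 3)) (A (y $ 2)) (inv_Sigma a (y $ 2) (y $ 3))
      ** carter_coframe a (y $ 2) (sin (y $ 3)) (cos (y $ 3)) (K (y $ 2))"
    and x: "x $ 2 = r" "x $ 3 = \<theta>" "r \<in> I" "0 < \<theta>" "\<theta> < pi"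
    and bound: "\<bar>(r^2 - r * A1 r - a^2 + A r) * (inv_Sigma a r \<theta>)^2 - (1 - A2 r / 2) * inv_Sigma a r \<theta>\<bar>
      \<le> (r^2 - r * A1 r - a^2 + A r) * (inv_Sigma a r \<theta>)^2"
  shows "effective_DEC g x"
proof -
  define U where "U = {y :: real^4. y $ 2 \<in> I \<and> y $ 3 \<in> {0<..<pi}}"
  have xU: "x \<in> U"
    using x by (simp add: U_def)
  have "open ((\<lambda>y :: real^4. y $ 2) -` I \<inter> (\<lambda>y. y $ 3) -` {0<..<pi})"
    by (intro open_Int open_vimage I continuous_intros)
  also have "(\<lambda>y :: real^4. y $ 2) -` I \<inter> (\<lambda>y. y $ 3) -` {0<..<pi} = U"
    by (auto simp: U_def)
  finally have "open U" .
  let ?C = "\<lambda>f (y :: real^4). f (y $ 2) (sin (y $ 3)) (cos (y $ 3)) (inv_Sigma a (y $ 2) (y $ 3)) (inv_sin (y $ 3))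
      (A (y $ 2)) (A1 (y $ 2)) (A2 (y $ 2)) (K (y $ 2)) (K1 (y $ 2)) (K2 (y $ 2))"
  define th where "th = ?C (\<lambda>r s c u v A A1 A2 K K1 K2. carter_coframe a r s c K)"
  define E where "E = ?C (\<lambda>r s c u v A A1 A2 K K1 K2. carter_frame a r s K u)"
  define eta where "eta = ?C (\<lambda>r s c u v A A1 A2 K K1 K2. carter_metric a r s c A u)"
  define kap where "kap = ?C (\<lambda>r s c u v A A1 A2 K K1 K2. carter_metric_inv a r c A u v)"
  define dth where "dth k = ?C (\<lambda>r s c u v A A1 A2 K K1 K2.
      if k = 2 then carter_coframe_dr a r c K K1 else if k = 3 then carter_coframe_d\<theta> a s c K else 0)"
    for k :: 4
  define ddth where "ddth l k = ?C (\<lambda>r s c u v A A1 A2 K K1 K2.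
      if k = 2 then (if l = 2 then carter_coframe_drr a r c K K1 K2
        else if l = 3 then carter_coframe_dr\<theta> a s c K1 else 0)
      else if k = 3 then (if l = 2 then carter_coframe_dr\<theta> a s c K1
        else if l = 3 then carter_coframe_d\<theta>\<theta> a s c K else 0) else 0)"
    for l k :: 4
  define W where "W k = ?C (\<lambda>r s c u v A A1 A2 K K1 K2. carter_conn a r s c A A1 u v $ k)" for k :: 4
  define eW where "eW d k = ?C (\<lambda>r s c u v A A1 A2 K K1 K2. if d = 2 then carter_conn_dr a r s c A A1 A2 u v $ k
      else if d = 3 then carter_conn_d\<theta> a r s c A A1 u v $ k else 0)" for d k :: 4
  have rel: "((y $ 2)^2 + a^2 * (cos (y $ 3))^2) * inv_Sigma a (y $ 2) (y $ 3) = 1"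
    "sin (y $ 3) * inv_sin (y $ 3) = 1" "(sin (y $ 3))^2 + (cos (y $ 3))^2 = 1"
    and y: "y $ 2 > 0" "sin (y $ 3) \<noteq> 0" "y $ 2 \<in> I" if "y \<in> U" for y
    using that pos[of "y $ 2"] Sigma_pos[of "y $ 2" a "y $ 3"] sin_gt_zero[of "y $ 3"]
    by (auto simp: U_def inv_Sigma_def inv_sin_def Sigma_fn_def)
  \<comment> \<open>Rows 2 and 3 of the coframe are dr and dtheta, so weighting derivatives along
    the frame vectors by the coframe returns coordinate derivatives.\<close>
  have th_sel: "(\<Sum>d\<in>UNIV. th y $ d $ k *\<^sub>R (if d = 2 then X else if d = 3 then Y else 0))
      = (if k = 2 then X else if k = 3 then Y else 0)" for y k and X Y :: "real^4^4"
  proof -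
    have "\<forall>k. (\<Sum>d\<in>UNIV. th y $ d $ k *\<^sub>R (if d = 2 then X else if d = 3 then Y else 0))
      = (if k = 2 then X else if k = 3 then Y else 0)"
      unfolding forall_4 by (simp add: sum_4 th_def carter_coframe_def vector_4)
    then show ?thesis by blast
  qed
  interpret moving_frame U g th E eta kap dth ddth W eW
  proof
    show "open U" by fact
    fix y assume yU: "y \<in> U"
    note mpd = has_mpd_carter[where A=A and ?A1.0=A1 and K=K and ?K1.0=K1, OF y(1,2)[OF yU]
        dA[OF y(3)[OF yU]] dK[OF y(3)[OF yU]] dK1[OF y(3)[OF yU]], where a=a]
    show "g y = transpose (th y) ** eta y ** th y"
      using yU g by (simp add: U_def th_def eta_def)
    show "E y ** th y = mat 1"
      using carter_dual[OF rel[OF yU]] by (simp add: E_def th_def)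
    show "eta y ** kap y = mat 1"
      using carter_metric_inv[OF rel[OF yU]] by (simp add: eta_def kap_def)
    show "transpose (eta y) = eta y"
      by (simp add: eta_def carter_metric_def carter_metric_parts transpose_add)
    show "has_mpd k th (dth k y) y" for k
      unfolding th_def dth_def using mpd(1) by simp
    show "has_mpd l (dth k) (ddth l k y) y" for l k
    proof -
      consider "k = 2" | "k = 3" | "k \<noteq> 2" "k \<noteq> 3" by blast
      then show ?thesis
        using mpd(2)[of l] mpd(3)[of l] has_mpd_const[of l 0 y]
        by cases (simp_all add: dth_def ddth_def cong: if_cong)
    qed
    show "ddth l k y = ddth k l y" for l k
      by (simp add: ddth_def)
    show "\<exists>D. has_mpd k E D y" for k
      unfolding E_def using mpd(4) by blast
    show "has_mpd k eta (\<Sum>c\<in>UNIV. th y $ c $ k *\<^sub>R (eta y ** W c y + transpose (eta y ** W c y))) y" for k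
      using mpd(5)[of k]
      unfolding eta_def W_def carter_compatible[OF rel[OF yU], symmetric] th_sel by simp
    show "has_mpd k (W c) (\<Sum>d\<in>UNIV. th y $ d $ k *\<^sub>R eW d c y) y" for k c
      unfolding eW_def th_sel unfolding W_def
      by (rule has_mpd_coordinates[where F="\<lambda>r \<theta>. carter_conn a r (sin \<theta>) (cos \<theta>) (A r) (A1 r)
            (inv_Sigma a r \<theta>) (inv_sin \<theta>) $ c"])
        (intro DERIV_carter_conn_r DERIV_carter_conn_\<theta> y yU dA dA1)+
    show "dth j y $ i $ k - dth k y $ i $ j = (\<Sum>b\<in>UNIV. \<Sum>c\<in>UNIV.
        W c y $ i $ b * (th y $ b $ j * th y $ c $ k - th y $ b $ k * th y $ c $ j))" for j i k
      unfolding dth_def W_def th_def by (rule carter_torsion[OF rel[OF yU]])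
  qed
  let ?u = "inv_Sigma a r \<theta>"
  define \<rho> where "\<rho> = (r^2 - r * A1 r - a^2 + A r) * ?u^2"
  define p where "p = \<rho> - (1 - A2 r / 2) * ?u"
  define m1 where "m1 = carter_metric_lr (A r) ?u"
  define m2 where "m2 = carter_metric_ang a r (sin \<theta>) (cos \<theta>) ?u"
  note relx = rel[OF xU, unfolded x]
  have eta: "eta x = m1 + m2"
    by (simp add: eta_def m1_def m2_def carter_metric_def x)
  have ric: "frame_ricci x = (- p) *\<^sub>R m1 + \<rho> *\<^sub>R m2"
  proof -
    have "frame_ricci x $ b $ d = ((- p) *\<^sub>R m1 + \<rho> *\<^sub>R m2) $ b $ d" for b d
      using carter_ricci[OF relx, where ?A1.0="A1 r" and ?A2.0="A2 r" and A="A r" and d=d and b=b]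
      by (simp add: frame_ricci_def frame_curvature_def W_def eW_def x p_def \<rho>_def m1_def m2_def cong: if_cong)
    then show ?thesis
      by (simp add: vec_eq_iff)
  qed
  \<comment> \<open>Each block is two-dimensional and contributes twice its coefficient. Subtracting
    half of this trace times the metric turns the coefficients \<open>- p\<close>,
    \<open>\<rho>\<close> of the Ricci tensor into \<open>- \<rho>\<close>, \<open>p\<close> for the
    Einstein tensor.\<close>
  have trace: "(\<Sum>b\<in>UNIV. \<Sum>d\<in>UNIV. kap x $ b $ d * frame_ricci x $ b $ d) = 2 * (\<rho> - p)"
  proof -
    have "(r^2 + a^2 * (cos \<theta>)^2) * (inv_sin \<theta>)^2 * (\<rho> * ((sin \<theta>)^2 * ?u))
        = \<rho> * ((r^2 + a^2 * (cos \<theta>)^2) * ?u) * (sin \<theta> * inv_sin \<theta>)^2"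
      by (simp add: power_mult_distrib)
    then have sin: "(r^2 + a^2 * (cos \<theta>)^2) * (inv_sin \<theta>)^2 * (\<rho> * ((sin \<theta>)^2 * ?u)) = \<rho>"
      by (simp only: relx mult_1_right power_one)
    have "?u * (\<rho> * (r^2 + a^2 * (cos \<theta>)^2)) = \<rho> * ((r^2 + a^2 * (cos \<theta>)^2) * ?u)"
      by simp
    then have cos: "?u * (\<rho> * (r^2 + a^2 * (cos \<theta>)^2)) = \<rho>"
      by (simp only: relx mult_1_right power_one)
    have "(\<Sum>b\<in>UNIV. \<Sum>d\<in>UNIV. kap x $ b $ d * frame_ricci x $ b $ d)
        = ?u * (\<rho> * (r^2 + a^2 * (cos \<theta>)^2))
          + (r^2 + a^2 * (cos \<theta>)^2) * (inv_sin \<theta>)^2 * (\<rho> * ((sin \<theta>)^2 * ?u)) - 2 * p"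
      by (simp add: ric sum_4 kap_def x m1_def m2_def carter_metric_lr_def
          carter_metric_ang_def carter_metric_inv_def vector_4)
    then show ?thesis
      unfolding sin cos by simp
  qed
  have G: "einstein g x = (- \<rho>) *\<^sub>R (transpose (th x) ** m1 ** th x) + p *\<^sub>R (transpose (th x) ** m2 ** th x)"
  proof -
    have "(- p) *\<^sub>R m1 + \<rho> *\<^sub>R m2 - (2 * (\<rho> - p) / 2) *\<^sub>R (m1 + m2) = (- \<rho>) *\<^sub>R m1 + p *\<^sub>R m2"
      by (simp add: vec_eq_iff field_simps)
    then have "einstein g x = transpose (th x) ** ((- \<rho>) *\<^sub>R m1 + p *\<^sub>R m2) ** th x"
      unfolding einstein_eq[OF xU] trace unfolding ric eta by (simp only:)
    then show ?thesis
      by (simp only: matrix_add_ldistrib matrix_add_rdistrib matrix_scalar_ac flip: scalar_matrix_assoc)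
  qed
  show ?thesis
    unfolding effective_DEC_def
  proof (rule dominant_energy_condition_blocks[OF _ _ _ _ _ _ G])
    let ?H = "E x ** kap x ** transpose (E x)"
    show "g x = transpose (th x) ** m1 ** th x + transpose (th x) ** m2 ** th x"
      by (simp add: metric[OF xU] eta matrix_add_ldistrib matrix_add_rdistrib)
    show "?H ** g x = mat 1"
      using inverse_metric[OF xU] by simp
    show "transpose (transpose (th x) ** m1 ** th x) = transpose (th x) ** m1 ** th x"
      "transpose (transpose (th x) ** m2 ** th x) = transpose (th x) ** m2 ** th x"
      by (simp_all add: matrix_transpose_mul m1_def m2_def carter_metric_parts flip: matrix_mul_assoc)
    have t: "transpose (E x) ** (transpose (th x) ** X) = X" for X :: "real^4^4"
      using arg_cong[OF dual'[OF xU], of transpose]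
      by (simp add: matrix_transpose_mul matrix_mul_assoc)
    have "m1 ** (kap x ** (m2 ** X)) = 0" for X :: "real^4^4"
      using carter_metric_parts(3)[of "A r" ?u a r "cos \<theta>" "inv_sin \<theta>" "sin \<theta>"]
      by (simp add: m1_def m2_def kap_def x matrix_mul_assoc)
    then show "transpose (th x) ** m1 ** th x ** ?H ** (transpose (th x) ** m2 ** th x) = 0"
      by (simp add: dual_cancel[OF xU] t flip: matrix_mul_assoc)
    show "v \<bullet> (transpose (th x) ** m2 ** th x *v v) \<ge> 0" for v
    proof -
      have "v \<bullet> (transpose (th x) ** m2 ** th x *v v) = (th x *v v) \<bullet> (m2 *v (th x *v v))"
        using dot_lmul_matrix[of v "transpose (th x)" "m2 *v (th x *v v)"]
        by (simp add: matrix_vector_mul_assoc matrix_mul_assoc transpose_matrix_vector[symmetric])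
      also have "\<dots> \<ge> 0"
        using Sigma_pos[OF pos[OF x(3)], of a \<theta>]
        unfolding m2_def by (intro carter_metric_ang_psd) (simp add: inv_Sigma_def)
      finally show ?thesis .
    qed
    show "\<bar>p\<bar> \<le> \<rho>"
      using bound by (simp add: p_def \<rho>_def)
  qed
qed

section \<open>The dominant energy condition on the axis\<close>

lemma ricci_of_two_jet:
  fixes g H :: "real^'n \<Rightarrow> real^'n^'n::finite" and D :: "'n \<Rightarrow> real^'n \<Rightarrow> real^'n^'n"
    and DD :: "'n \<Rightarrow> 'n \<Rightarrow> real^'n^'n" and dH :: "'n \<Rightarrow> real^'n^'n"
  assumes U: "open U" "x \<in> U"
    and inv: "\<And>y. y \<in> U \<Longrightarrow> H y ** g y = mat 1"
    and dg: "\<And>k y. y \<in> U \<Longrightarrow> has_mpd k g (D k y) y"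
    and ddg: "\<And>l k. has_mpd l (D k) (DD l k) x"
    and dH: "\<And>l. has_mpd l H (dH l) x"
  defines "L \<equiv> \<lambda>p j k. D j x $ p $ k + D k x $ p $ j - D p x $ j $ k"
    and "LL \<equiv> \<lambda>l p j k. DD l j $ p $ k + DD l k $ p $ j - DD l p $ j $ k"
  defines "G \<equiv> \<lambda>i j k. (\<Sum>p\<in>UNIV. H x $ i $ p * L p j k) / 2"
    and "dG \<equiv> \<lambda>l i j k. (\<Sum>p\<in>UNIV. dH l $ i $ p * L p j k + H x $ i $ p * LL l p j k) / 2"
  shows "ricci g x $ j $ k = (\<Sum>i\<in>UNIV. dG i i j k) - (\<Sum>i\<in>UNIV. dG k i i j)
     + (\<Sum>i\<in>UNIV. \<Sum>p\<in>UNIV. G i i p * G p j k) - (\<Sum>i\<in>UNIV. \<Sum>p\<in>UNIV. G i k p * G p i j)"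
proof -
  have pdg: "pd k (\<lambda>z. g z $ p $ q) y = D k y $ p $ q" if "y \<in> U" for y k p q
    using dg[OF that, of k] by (auto simp: has_mpd_def intro: has_pd_imp_pd)
  have chr: "christoffel g i j k y
      = (\<Sum>p\<in>UNIV. H y $ i $ p * (D j y $ p $ k + D k y $ p $ j - D p y $ j $ k)) * (1 / 2)" if "y \<in> U" for y i j k
    using that by (simp add: christoffel_def pdg matrix_inv_eqI[OF inv])
  have "pd l (christoffel g i j k) x = dG l i j k" for l i j k
  proof (rule has_pd_imp_pd)
    have minus: "has_pd l (\<lambda>y. f y - h y) (f' - h') x" if "has_pd l f f' x" "has_pd l h h' x" for f h f' h'
      using that unfolding has_pd_def by (rule DERIV_diff)
    have "has_pd l (\<lambda>y. (\<Sum>p\<in>UNIV. H y $ i $ p * (D j y $ p $ k + D k y $ p $ j - D p y $ j $ k)) * (1 / 2))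
      ((\<Sum>p\<in>UNIV. dH l $ i $ p * (D j x $ p $ k + D k x $ p $ j - D p x $ j $ k)
        + H x $ i $ p * (DD l j $ p $ k + DD l k $ p $ j - DD l p $ j $ k)) * (1 / 2)
       + (\<Sum>p\<in>UNIV. H x $ i $ p * (D j x $ p $ k + D k x $ p $ j - D p x $ j $ k)) * 0) x"
      using ddg dH unfolding has_mpd_def
      by (intro has_pd_mult has_pd_sum minus has_pd_add has_pd_const) blast+
    moreover have "has_pd l (christoffel g i j k) d x \<longleftrightarrow> has_pd l (\<lambda>y. (\<Sum>p\<in>UNIV.
        H y $ i $ p * (D j y $ p $ k + D k y $ p $ j - D p y $ j $ k)) * (1 / 2)) d x" for d
      by (rule has_pd_cong[OF U]) (rule chr)
    ultimately show "has_pd l (christoffel g i j k) (dG l i j k) x"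
      by (simp add: dG_def L_def LL_def)
  qed
  moreover have "christoffel g i j k x = G i j k" for i j k
    by (simp add: chr[OF U(2)] G_def L_def)
  ultimately show ?thesis
    by (simp add: ricci_def)
qed

text \<open>The arguments \<open>u, j, w, e\<close> stand for \<open>1 / \<Sigma>\<close>, \<open>1 / (1 - X\<^sup>2 - Y\<^sup>2)\<close>, \<open>1 / (r\<^sup>2 + a\<^sup>2)\<close> and
  \<open>(r\<^sup>2 + a\<^sup>2) / \<Sigma>\<close>, and \<open>b, b1, b2\<close> for \<open>sqrt (2 M r / (r\<^sup>2 + a\<^sup>2))\<close> and its derivatives. Second
  derivatives of the metric and first derivatives of its inverse are only needed on the axis.\<close>

definition polar_metric :: "real \<Rightarrow> real \<Rightarrow> real \<Rightarrow> real \<Rightarrow> real \<Rightarrow> real \<Rightarrow> real \<Rightarrow> real \<Rightarrow> real^4^4" where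
  "polar_metric a r X Y b j w e = vector [
     vector [- 1 + b^2 * e, b, a * Y * b^2 * e, - (a * X * b^2 * e)],
     vector [b, 1 - a^2 * X^2 * w - a^2 * Y^2 * w, a * Y * b, - (a * X * b)],
     vector [a * Y * b^2 * e, a * Y * b, r^2 + a^2 + r^2 * X^2 * j + a^2 * Y^2 * b^2 * e, r^2 * X * Y * j - a^2 * X * Y * b^2 * e],
     vector [- (a * X * b^2 * e), - (a * X * b), r^2 * X * Y * j - a^2 * X * Y * b^2 * e, r^2 + a^2 + r^2 * Y^2 * j + a^2 * X^2 * b^2 * e]]"

definition polar_metric_inv :: "real \<Rightarrow> real \<Rightarrow> real \<Rightarrow> real \<Rightarrow> real \<Rightarrow> real \<Rightarrow> real \<Rightarrow> real \<Rightarrow> real^4^4" where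
  "polar_metric_inv a r X Y b u w e = vector [
     vector [- 1, b * e, 0, 0],
     vector [b * e, e - b^2 * e, - (a * Y * b * u), a * X * b * u],
     vector [0, - (a * Y * b * u), u - X^2 * u - a^2 * Y^2 * u * w, a^2 * X * Y * u * w - X * Y * u],
     vector [0, a * X * b * u, a^2 * X * Y * u * w - X * Y * u, u - Y^2 * u - a^2 * X^2 * u * w]]"

definition polar_metric_dr :: "real \<Rightarrow> real \<Rightarrow> real \<Rightarrow> real \<Rightarrow> real \<Rightarrow> real \<Rightarrow> real \<Rightarrow> real \<Rightarrow> real \<Rightarrow> real \<Rightarrow> real^4^4" where
  "polar_metric_dr a r X Y b b1 u j w e = vector [
     vector [2 * b * b1 * e - 2 * r * b^2 * u * e + 2 * r * b^2 * u, b1, 2 * a * Y * b * b1 * e - 2 * r * a * Y * b^2 * u * e + 2 * r * a * Y * b^2 * u, - (2 * a * X * b * b1 * e) + 2 * r * a * X * b^2 * u * e - 2 * r * a * X * b^2 * u],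
     vector [b1, 2 * r * a^2 * X^2 * w^2 + 2 * r * a^2 * Y^2 * w^2, a * Y * b1, - (a * X * b1)],
     vector [2 * a * Y * b * b1 * e - 2 * r * a * Y * b^2 * u * e + 2 * r * a * Y * b^2 * u, a * Y * b1, 2 * r + 2 * r * X^2 * j + 2 * a^2 * Y^2 * b * b1 * e - 2 * r * a^2 * Y^2 * b^2 * u * e + 2 * r * a^2 * Y^2 * b^2 * u, 2 * r * X * Y * j - 2 * a^2 * X * Y * b * b1 * e + 2 * r * a^2 * X * Y * b^2 * u * e - 2 * r * a^2 * X * Y * b^2 * u],
     vector [- (2 * a * X * b * b1 * e) + 2 * r * a * X * b^2 * u * e - 2 * r * a * X * b^2 * u, - (a * X * b1), 2 * r * X * Y * j - 2 * a^2 * X * Y * b * b1 * e + 2 * r * a^2 * X * Y * b^2 * u * e - 2 * r * a^2 * X * Y * b^2 * u, 2 * r + 2 * r * Y^2 * j + 2 * a^2 * X^2 * b * b1 * e - 2 * r * a^2 * X^2 * b^2 * u * e + 2 * r * a^2 * X^2 * b^2 * u]]"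

definition polar_metric_dX :: "real \<Rightarrow> real \<Rightarrow> real \<Rightarrow> real \<Rightarrow> real \<Rightarrow> real \<Rightarrow> real \<Rightarrow> real \<Rightarrow> real \<Rightarrow> real \<Rightarrow> real^4^4" where
  "polar_metric_dX a r X Y b b1 u j w e = vector [
     vector [2 * a^2 * X * b^2 * u * e, 0, 2 * a^3 * X * Y * b^2 * u * e, - (a * b^2 * e) - 2 * a^3 * X^2 * b^2 * u * e],
     vector [0, - (2 * a^2 * X * w), 0, - (a * b)],
     vector [2 * a^3 * X * Y * b^2 * u * e, 0, 2 * r^2 * X * j + 2 * r^2 * X^3 * j^2 + 2 * a^4 * X * Y^2 * b^2 * u * e, r^2 * Y * j - a^2 * Y * b^2 * e + 2 * r^2 * X^2 * Y * j^2 - 2 * a^4 * X^2 * Y * b^2 * u * e],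
     vector [- (a * b^2 * e) - 2 * a^3 * X^2 * b^2 * u * e, - (a * b), r^2 * Y * j - a^2 * Y * b^2 * e + 2 * r^2 * X^2 * Y * j^2 - 2 * a^4 * X^2 * Y * b^2 * u * e, 2 * a^2 * X * b^2 * e + 2 * r^2 * X * Y^2 * j^2 + 2 * a^4 * X^3 * b^2 * u * e]]"

definition polar_metric_dY :: "real \<Rightarrow> real \<Rightarrow> real \<Rightarrow> real \<Rightarrow> real \<Rightarrow> real \<Rightarrow> real \<Rightarrow> real \<Rightarrow> real \<Rightarrow> real \<Rightarrow> real^4^4" where
  "polar_metric_dY a r X Y b b1 u j w e = vector [
     vector [2 * a^2 * Y * b^2 * u * e, 0, a * b^2 * e + 2 * a^3 * Y^2 * b^2 * u * e, - (2 * a^3 * X * Y * b^2 * u * e)],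
     vector [0, - (2 * a^2 * Y * w), a * b, 0],
     vector [a * b^2 * e + 2 * a^3 * Y^2 * b^2 * u * e, a * b, 2 * a^2 * Y * b^2 * e + 2 * r^2 * X^2 * Y * j^2 + 2 * a^4 * Y^3 * b^2 * u * e, r^2 * X * j - a^2 * X * b^2 * e + 2 * r^2 * X * Y^2 * j^2 - 2 * a^4 * X * Y^2 * b^2 * u * e],
     vector [- (2 * a^3 * X * Y * b^2 * u * e), 0, r^2 * X * j - a^2 * X * b^2 * e + 2 * r^2 * X * Y^2 * j^2 - 2 * a^4 * X * Y^2 * b^2 * u * e, 2 * r^2 * Y * j + 2 * r^2 * Y^3 * j^2 + 2 * a^4 * X^2 * Y * b^2 * u * e]]"

text \<open>The block \<open>$ l $ k\<close> is the derivative along \<open>l\<close> of the first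
  derivative along \<open>k\<close>, taken at X = Y = 0, where \<open>u = w\<close> and
  \<open>j = e = 1\<close>.\<close>

definition polar_jet2 :: "real \<Rightarrow> real \<Rightarrow> real \<Rightarrow> real \<Rightarrow> real \<Rightarrow> real \<Rightarrow> real^4^4^4^4" where
  "polar_jet2 a r b b1 b2 w = vector [
   0,
   vector [
    0,
    vector [
     vector [2 * b1^2 + 2 * b * b2, b2, 0, 0],
     vector [b2, 0, 0, 0],
     vector [0, 0, 2, 0],
     vector [0, 0, 0, 2]],
    vector [
     vector [0, 0, 0, - (2 * a * b * b1)],
     vector [0, 0, 0, - (a * b1)],
     vector [0, 0, 0, 0],
     vector [- (2 * a * b * b1), - (a * b1), 0, 0]],
    vector [
     vector [0, 0, 2 * a * b * b1, 0],
     vector [0, 0, a * b1, 0],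
     vector [2 * a * b * b1, a * b1, 0, 0],
     vector [0, 0, 0, 0]]],
   vector [
    0,
    vector [
     vector [0, 0, 0, - (2 * a * b * b1)],
     vector [0, 0, 0, - (a * b1)],
     vector [0, 0, 0, 0],
     vector [- (2 * a * b * b1), - (a * b1), 0, 0]],
    vector [
     vector [2 * a^2 * b^2 * w, 0, 0, 0],
     vector [0, - (2 * a^2 * w), 0, 0],
     vector [0, 0, 2 * r^2, 0],
     vector [0, 0, 0, 2 * a^2 * b^2]],
    vector [
     vector [0, 0, 0, 0],
     vector [0, 0, 0, 0],
     vector [0, 0, 0, r^2 - a^2 * b^2],
     vector [0, 0, r^2 - a^2 * b^2, 0]]],
   vector [
    0,
    vector [
     vector [0, 0, 2 * a * b * b1, 0],
     vector [0, 0, a * b1, 0],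
     vector [2 * a * b * b1, a * b1, 0, 0],
     vector [0, 0, 0, 0]],
    vector [
     vector [0, 0, 0, 0],
     vector [0, 0, 0, 0],
     vector [0, 0, 0, r^2 - a^2 * b^2],
     vector [0, 0, r^2 - a^2 * b^2, 0]],
    vector [
     vector [2 * a^2 * b^2 * w, 0, 0, 0],
     vector [0, - (2 * a^2 * w), 0, 0],
     vector [0, 0, 2 * a^2 * b^2, 0],
     vector [0, 0, 0, 2 * r^2]]]]"

definition polar_inv_jet :: "real \<Rightarrow> real \<Rightarrow> real \<Rightarrow> real \<Rightarrow> real \<Rightarrow> real^4^4^4" where
  "polar_inv_jet a r b b1 w = vector [
    0,
    vector [
     vector [0, b1, 0, 0],
     vector [b1, - (2 * b * b1), 0, 0],
     vector [0, 0, - (2 * r * w^2), 0],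
     vector [0, 0, 0, - (2 * r * w^2)]],
    vector [
     vector [0, 0, 0, 0],
     vector [0, 0, 0, a * b * w],
     vector [0, 0, 0, 0],
     vector [0, a * b * w, 0, 0]],
    vector [
     vector [0, 0, 0, 0],
     vector [0, 0, - (a * b * w), 0],
     vector [0, - (a * b * w), 0, 0],
     vector [0, 0, 0, 0]]]"

lemma polar_metric_inverse:
  fixes a r X Y b u j w :: real
  assumes rel: "u * (r^2 + a^2 * (1 - X^2 - Y^2)) = 1" "w * (r^2 + a^2) = 1" "j * (1 - X^2 - Y^2) = 1"
  defines "e \<equiv> 1 + a^2 * (X^2 + Y^2) * u"
  shows "polar_metric_inv a r X Y b u w e ** polar_metric a r X Y b j w e = mat 1"
proof -
  note c = linear_combination3[OF rel]
  note poly = algebra_simps power2_eq_square power3_eq_cube numeral_eq_Suc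
  note defs = sum_4 matrix_matrix_mult_def polar_metric_def polar_metric_inv_def vector_4 mat_def e_def
  let ?P = "\<lambda>i k. (polar_metric_inv a r X Y b u w e ** polar_metric a r X Y b j w e) $ i $ k = mat 1 $ i $ k"
  have p12: "?P 1 2"
    by (rule c[of _ _
        "a^2 * X^2 * b * w + a^2 * Y^2 * b * w"
        "- (a^2 * X^2 * b * u) - a^2 * Y^2 * b * u"
        "0"]) (simp add: defs poly)
  have p21: "?P 2 1"
    by (rule c[of _ _
        "0"
        "0"
        "0"]) (simp add: defs poly)
  have p22: "?P 2 2"
    by (rule c[of _ _
        "a^2 * X^2 * w + a^2 * Y^2 * w - a^2 * X^2 * b^2 * w - a^2 * Y^2 * b^2 * w"
        "- (a^2 * X^2 * u) - a^2 * Y^2 * u + a^2 * X^2 * b^2 * u + a^2 * Y^2 * b^2 * u"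
        "0"]) (simp add: defs poly)
  have p23: "?P 2 3"
    by (rule c[of _ _
        "- (a * Y * b)"
        "0"
        "0"]) (simp add: defs poly)
  have p24: "?P 2 4"
    by (rule c[of _ _
        "a * X * b"
        "0"
        "0"]) (simp add: defs poly)
  have p31: "?P 3 1"
    by (rule c[of _ _
        "a^3 * Y^3 * b^2 * u * w + a^3 * X^2 * Y * b^2 * u * w"
        "- (a^3 * Y^3 * b^2 * u^2) - a^3 * X^2 * Y * b^2 * u^2"
        "0"]) (simp add: defs poly)
  have p33: "?P 3 3"
    by (rule c[of _ _
        "1 + X^2 * j - X^2 - X^4 * j + a^4 * Y^4 * b^2 * u * w + a^4 * X^2 * Y^2 * b^2 * u * w - X^2 * Y^2 * j"
        "- (a^4 * Y^4 * b^2 * u^2) - a^4 * X^2 * Y^2 * b^2 * u^2 - a^2 * Y^2 * u"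
        "- (a^2 * X^2 * u) + a^2 * X^4 * u + a^2 * X^2 * Y^2 * u + X^2"]) (simp add: defs poly)
  have p34: "?P 3 4"
    by (rule c[of _ _
        "X * Y * j - X^3 * Y * j - a^4 * X * Y^3 * b^2 * u * w - a^4 * X^3 * Y * b^2 * u * w - X * Y - X * Y^3 * j"
        "a^4 * X * Y^3 * b^2 * u^2 + a^4 * X^3 * Y * b^2 * u^2 + a^2 * X * Y * u"
        "- (a^2 * X * Y * u) + a^2 * X^3 * Y * u + a^2 * X * Y^3 * u + X * Y"]) (simp add: defs poly)
  have p41: "?P 4 1"
    by (rule c[of _ _
        "- (a^3 * X * Y^2 * b^2 * u * w) - a^3 * X^3 * b^2 * u * w"
        "a^3 * X * Y^2 * b^2 * u^2 + a^3 * X^3 * b^2 * u^2"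
        "0"]) (simp add: defs poly)
  have p43: "?P 4 3"
    by (rule c[of _ _
        "- (a^4 * X * Y^3 * b^2 * u * w) - X * Y - X^3 * Y * j + X * Y * j - X * Y^3 * j - a^4 * X^3 * Y * b^2 * u * w"
        "a^4 * X * Y^3 * b^2 * u^2 + a^4 * X^3 * Y * b^2 * u^2 + a^2 * X * Y * u"
        "- (a^2 * X * Y * u) + a^2 * X^3 * Y * u + a^2 * X * Y^3 * u + X * Y"]) (simp add: defs poly)
  have p44: "?P 4 4"
    by (rule c[of _ _
        "a^4 * X^2 * Y^2 * b^2 * u * w - X^2 * Y^2 * j + 1 + Y^2 * j - Y^2 - Y^4 * j + a^4 * X^4 * b^2 * u * w"
        "- (a^4 * X^2 * Y^2 * b^2 * u^2) - a^4 * X^4 * b^2 * u^2 - a^2 * X^2 * u"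
        "- (a^2 * Y^2 * u) + a^2 * X^2 * Y^2 * u + a^2 * Y^4 * u + Y^2"]) (simp add: defs poly)
  have "\<forall>i k. ?P i k"
    unfolding forall_4 by (intro conjI; (rule p12 p21 p22 p23 p24 p31 p33 p34 p41 p43 p44 | (simp add: defs poly; fail)))
  then show ?thesis
    by (simp add: vec_eq_iff)
qed

text \<open>The (t,r) block on the axis has Painleve-Gullstrand form and again determinant
  -1.\<close>

definition polar_axis_lr :: "real \<Rightarrow> real^4^4" where
  "polar_axis_lr b = vector [
     vector [b^2 - 1, b, 0, 0], vector [b, 1, 0, 0], vector [0, 0, 0, 0], vector [0, 0, 0, 0]]"

definition polar_axis_ang :: "real \<Rightarrow> real \<Rightarrow> real^4^4" where
  "polar_axis_ang a r = vector [
     vector [0, 0, 0, 0], vector [0, 0, 0, 0], vector [0, 0, r^2 + a^2, 0], vector [0, 0, 0, r^2 + a^2]]"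

text \<open>\<open>b\<close>, \<open>b1\<close>, \<open>b2\<close> are free reals here. Once b^2
  (r^2 + a^2) = 2 r M is differentiated, \<open>\<rho>\<close> becomes 2 r^2 M' / (r^2 + a^2)^2 and
  \<open>\<rho> - p\<close> becomes (2 M' + r M'') / (r^2 + a^2), the values off the axis with Sigma
  = r^2 + a^2.\<close>

lemma polar_ricci:
  fixes a r b b1 b2 w :: real
  assumes rel: "r^2 * w + a^2 * w = 1"
  defines "H \<equiv> polar_metric_inv a r 0 0 b w w 1" and "dH \<equiv> \<lambda>l. polar_inv_jet a r b b1 w $ l"
    and "DD \<equiv> \<lambda>l k. polar_jet2 a r b b1 b2 w $ l $ k"
    and "D \<equiv> \<lambda>k :: 4. if k = 2 then polar_metric_dr a r 0 0 b b1 w 1 w 1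
      else if k = 3 then polar_metric_dX a r 0 0 b b1 w 1 w 1
      else if k = 4 then polar_metric_dY a r 0 0 b b1 w 1 w 1 else 0"
  defines "L \<equiv> \<lambda>p j k. D j $ p $ k + D k $ p $ j - D p $ j $ k"
    and "LL \<equiv> \<lambda>l p j k. DD l j $ p $ k + DD l k $ p $ j - DD l p $ j $ k"
  defines "G \<equiv> \<lambda>i j k. (\<Sum>p\<in>UNIV. H $ i $ p * L p j k) / 2"
    and "dG \<equiv> \<lambda>l i j k. (\<Sum>p\<in>UNIV. dH l $ i $ p * L p j k + H $ i $ p * LL l p j k) / 2"
  defines "\<rho> \<equiv> (r * (2 * b * b1 * (r^2 + a^2) + 2 * r * b^2) - b^2 * (r^2 + a^2)) * w^2"
  defines "p \<equiv> \<rho> - (2 * (b1^2 + b * b2) * (r^2 + a^2) + 8 * r * b * b1 + 2 * b^2) / 2 * w"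
  shows "(\<Sum>i\<in>UNIV. dG i i j k) - (\<Sum>i\<in>UNIV. dG k i i j)
     + (\<Sum>i\<in>UNIV. \<Sum>p\<in>UNIV. G i i p * G p j k) - (\<Sum>i\<in>UNIV. \<Sum>p\<in>UNIV. G i k p * G p i j)
    = ((- p) *\<^sub>R polar_axis_lr b + \<rho> *\<^sub>R polar_axis_ang a r) $ j $ k"
proof -
  \<comment> \<open>A single relation suffices on the axis; the other two slots hold 1 = 1.\<close>
  note c = linear_combination3[OF rel refl[of 1] refl[of 1]]
  note poly = algebra_simps add_divide_distrib diff_divide_distrib power2_eq_square power3_eq_cube numeral_eq_Suc
  have L: "L p j k = D j $ p $ k + D k $ p $ j - D p $ j $ k"
    and LL: "LL l p j k = DD l j $ p $ k + DD l k $ p $ j - DD l p $ j $ k" for l p j k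
    by (simp_all add: L_def LL_def)
  have D: "D 1 = 0" "D 2 = polar_metric_dr a r 0 0 b b1 w 1 w 1"
    "D 3 = polar_metric_dX a r 0 0 b b1 w 1 w 1" "D 4 = polar_metric_dY a r 0 0 b b1 w 1 w 1"
    by (simp_all add: D_def)
  \<comment> \<open>The Christoffel symbols on the axis in simplified form. Inserting these numbers
    before forming the quadratic terms keeps the expansions below manageable.\<close>
  define GT :: "real^4^4^4" where "GT = vector [
     vector [
       vector [- (b^2 * b1), - (b * b1), 0, 0],
       vector [- (b * b1), - b1, 0, 0],
       vector [0, 0, - (r * b), 0],
       vector [0, 0, 0, - (r * b)]],
     vector [
       vector [- (b * b1) + b^3 * b1, b^2 * b1, 0, 0],
       vector [b^2 * b1, b * b1, 0, 0],
       vector [0, 0, - r + r * b^2, 0],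
       vector [0, 0, 0, - r + r * b^2]],
     vector [
       vector [0, 0, 0, a * b^2 * w],
       vector [0, 0, r * w, a * b * w],
       vector [0, r * w, 0, 0],
       vector [a * b^2 * w, a * b * w, 0, 0]],
     vector [
       vector [0, 0, - (a * b^2 * w), 0],
       vector [0, 0, - (a * b * w), r * w],
       vector [- (a * b^2 * w), - (a * b * w), 0, 0],
       vector [0, r * w, 0, 0]]]"
  have G_all: "\<forall>i j k. G i j k = GT $ i $ j $ k"
    unfolding forall_4 G_def GT_def vector_4 sum_4 L D H_def
    by (intro conjI; simp add: polar_metric_dr_def polar_metric_dX_def polar_metric_dY_def
      polar_metric_inv_def vector_4; simp add: poly; fail)
  then have G: "G i j k = GT $ i $ j $ k" for i j k
    by blast
  have dG: "dG l i j k = (\<Sum>p\<in>UNIV. polar_inv_jet a r b b1 w $ l $ i $ p * L p j k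
      + H $ i $ p * LL l p j k) / 2" for l i j k
    by (simp add: dG_def dH_def)
  note defs = sum_4 G dG GT_def L LL D H_def DD_def polar_inv_jet_def polar_jet2_def
    polar_metric_dr_def polar_metric_dX_def polar_metric_dY_def polar_metric_inv_def
    polar_axis_lr_def polar_axis_ang_def vector_4 p_def \<rho>_def
  let ?P = "\<lambda>j k. (\<Sum>i\<in>UNIV. dG i i j k) - (\<Sum>i\<in>UNIV. dG k i i j)
     + (\<Sum>i\<in>UNIV. \<Sum>p\<in>UNIV. G i i p * G p j k) - (\<Sum>i\<in>UNIV. \<Sum>p\<in>UNIV. G i k p * G p i j)
    = ((- p) *\<^sub>R polar_axis_lr b + \<rho> *\<^sub>R polar_axis_ang a r) $ j $ k"
  have p11: "?P 1 1"
    by (rule c[of _ _ "- (2 * r * b * b1 * w) + 2 * r * b^3 * b1 * w - b^2 * w + b^4 * w + b1^2 - b^2 * b1^2 + b * b2 - b^3 * b2" 0 0]) (simp add: defs poly)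
  have p12: "?P 1 2"
    by (rule c[of _ _ "2 * r * b^2 * b1 * w + b^3 * w - b * b1^2 - b^2 * b2" 0 0]) (simp add: defs poly)
  have p13: "?P 1 3"
    by (rule c[of _ _ "0" 0 0]) (simp add: defs poly)
  have p14: "?P 1 4"
    by (rule c[of _ _ "0" 0 0]) (simp add: defs poly)
  have p21: "?P 2 1"
    by (rule c[of _ _ "2 * r * b^2 * b1 * w + b^3 * w - b * b1^2 - b^2 * b2" 0 0]) (simp add: defs poly)
  have p22: "?P 2 2"
    by (rule c[of _ _ "2 * w + 2 * r * b * b1 * w + b^2 * w - b1^2 - b * b2" 0 0]) (simp add: defs poly)
  have p23: "?P 2 3"
    by (rule c[of _ _ "0" 0 0]) (simp add: defs poly)
  have p24: "?P 2 4"
    by (rule c[of _ _ "0" 0 0]) (simp add: defs poly)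
  have p31: "?P 3 1"
    by (rule c[of _ _ "0" 0 0]) (simp add: defs poly)
  have p32: "?P 3 2"
    by (rule c[of _ _ "0" 0 0]) (simp add: defs poly)
  have p33: "?P 3 3"
    by (rule c[of _ _ "1 - 2 * r^3 * b * b1 * w - 2 * r * a^2 * b * b1 * w - r^2 * b^2 * w - 2 * r * b * b1 + a^2 * b^2 * w - b^2" 0 0]) (simp add: defs poly)
  have p34: "?P 3 4"
    by (rule c[of _ _ "0" 0 0]) (simp add: defs poly)
  have p41: "?P 4 1"
    by (rule c[of _ _ "0" 0 0]) (simp add: defs poly)
  have p42: "?P 4 2"
    by (rule c[of _ _ "0" 0 0]) (simp add: defs poly)
  have p43: "?P 4 3"
    by (rule c[of _ _ "0" 0 0]) (simp add: defs poly)
  have p44: "?P 4 4"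
    by (rule c[of _ _ "1 - 2 * r^3 * b * b1 * w - 2 * r * a^2 * b * b1 * w - r^2 * b^2 * w - 2 * r * b * b1 + a^2 * b^2 * w - b^2" 0 0]) (simp add: defs poly)
  have "\<forall>j k. ?P j k"
    unfolding forall_4 by (intro conjI; rule p11 p12 p13 p14 p21 p22 p23 p24 p31 p32 p33 p34 p41 p42 p43 p44)
  then show ?thesis
    by blast
qed

section \<open>Derivatives of the polar metric near the axis\<close>

definition polar_u :: "real \<Rightarrow> real \<Rightarrow> real \<Rightarrow> real \<Rightarrow> real" where
  "polar_u a r X Y = 1 / (r^2 + a^2 * (1 - X^2 - Y^2))"

definition polar_w :: "real \<Rightarrow> real \<Rightarrow> real" where
  "polar_w a r = 1 / (r^2 + a^2)"

definition polar_j :: "real \<Rightarrow> real \<Rightarrow> real" where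
  "polar_j X Y = 1 / (1 - X^2 - Y^2)"

text \<open>Written through \<open>polar_u\<close> instead of as a quotient, so that the relation
  for \<open>u\<close> covers it and its derivatives are polynomial in \<open>u\<close> and
  \<open>e\<close>.\<close>

definition polar_e :: "real \<Rightarrow> real \<Rightarrow> real \<Rightarrow> real \<Rightarrow> real" where
  "polar_e a r X Y = 1 + a^2 * (X^2 + Y^2) * polar_u a r X Y"

lemma polar_axis_values [simp]:
  "polar_u a r 0 0 = polar_w a r" "polar_j 0 0 = 1" "polar_e a r 0 0 = 1"
  by (simp_all add: polar_u_def polar_w_def polar_j_def polar_e_def)

context
  fixes a r X Y :: real
  assumes r: "r > 0" and XY: "X^2 + Y^2 < 1"
begin

lemma polar_denominators: "r^2 + a^2 * (1 - X^2 - Y^2) > 0" "r^2 + a^2 > 0" "1 - X^2 - Y^2 > 0"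
  using r XY by (auto intro!: add_pos_nonneg mult_nonneg_nonneg)

lemma DERIV_polar_u:
  "((\<lambda>r. polar_u a r X Y) has_real_derivative - (2 * r * (polar_u a r X Y)^2)) (at r)"
  "((\<lambda>X. polar_u a r X Y) has_real_derivative 2 * a^2 * X * (polar_u a r X Y)^2) (at X)"
  "((\<lambda>Y. polar_u a r X Y) has_real_derivative 2 * a^2 * Y * (polar_u a r X Y)^2) (at Y)"
  unfolding polar_u_def using polar_denominators(1)
  by (auto intro!: derivative_eq_intros simp: power2_eq_square)

lemma DERIV_polar_w: "((\<lambda>r. polar_w a r) has_real_derivative - (2 * r * (polar_w a r)^2)) (at r)"
  unfolding polar_w_def using polar_denominators(2)
  by (auto intro!: derivative_eq_intros simp: power2_eq_square)

lemma DERIV_polar_j: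
  "((\<lambda>X. polar_j X Y) has_real_derivative 2 * X * (polar_j X Y)^2) (at X)"
  "((\<lambda>Y. polar_j X Y) has_real_derivative 2 * Y * (polar_j X Y)^2) (at Y)"
  unfolding polar_j_def using polar_denominators(3)
  by (auto intro!: derivative_eq_intros simp: power2_eq_square)

lemma DERIV_polar_e:
  "((\<lambda>r. polar_e a r X Y) has_real_derivative - (2 * r * polar_u a r X Y * (polar_e a r X Y - 1))) (at r)"
  "((\<lambda>X. polar_e a r X Y) has_real_derivative 2 * a^2 * X * polar_u a r X Y * polar_e a r X Y) (at X)"
  "((\<lambda>Y. polar_e a r X Y) has_real_derivative 2 * a^2 * Y * polar_u a r X Y * polar_e a r X Y) (at Y)"
  unfolding polar_e_def
  by (auto intro!: derivative_eq_intros DERIV_polar_u simp: algebra_simps power2_eq_square)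

lemma polar_relations:
  "polar_u a r X Y * (r^2 + a^2 * (1 - X^2 - Y^2)) = 1" "polar_w a r * (r^2 + a^2) = 1"
  "polar_j X Y * (1 - X^2 - Y^2) = 1"
  using polar_denominators r by (simp_all add: polar_u_def polar_w_def polar_j_def)

lemma DERIV_polar_metric:
  fixes b b1 :: "real \<Rightarrow> real"
  assumes b: "(b has_real_derivative b1 r) (at r)"
  shows "((\<lambda>r. polar_metric a r X Y (b r) (polar_j X Y) (polar_w a r) (polar_e a r X Y) $ i $ j) has_real_derivative
      polar_metric_dr a r X Y (b r) (b1 r) (polar_u a r X Y) (polar_j X Y) (polar_w a r) (polar_e a r X Y) $ i $ j) (at r)" (is ?r)
    and "((\<lambda>X. polar_metric a r X Y (b r) (polar_j X Y) (polar_w a r) (polar_e a r X Y) $ i $ j) has_real_derivative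
      polar_metric_dX a r X Y (b r) (b1 r) (polar_u a r X Y) (polar_j X Y) (polar_w a r) (polar_e a r X Y) $ i $ j) (at X)" (is ?X)
    and "((\<lambda>Y. polar_metric a r X Y (b r) (polar_j X Y) (polar_w a r) (polar_e a r X Y) $ i $ j) has_real_derivative
      polar_metric_dY a r X Y (b r) (b1 r) (polar_u a r X Y) (polar_j X Y) (polar_w a r) (polar_e a r X Y) $ i $ j) (at Y)" (is ?Y)
proof -
  note deriv = derivative_eq_intros b DERIV_polar_w DERIV_polar_j DERIV_polar_e
  note poly = algebra_simps power2_eq_square power3_eq_cube numeral_eq_Suc
  have "\<forall>i j. ((\<lambda>r. polar_metric a r X Y (b r) (polar_j X Y) (polar_w a r) (polar_e a r X Y) $ i $ j) has_real_derivative
      polar_metric_dr a r X Y (b r) (b1 r) (polar_u a r X Y) (polar_j X Y) (polar_w a r) (polar_e a r X Y) $ i $ j) (at r)"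
    unfolding forall_4 polar_metric_def polar_metric_dr_def vector_4
    by (intro conjI; (auto intro!: deriv simp: poly))
  then show ?r by blast
  have "\<forall>i j. ((\<lambda>X. polar_metric a r X Y (b r) (polar_j X Y) (polar_w a r) (polar_e a r X Y) $ i $ j) has_real_derivative
      polar_metric_dX a r X Y (b r) (b1 r) (polar_u a r X Y) (polar_j X Y) (polar_w a r) (polar_e a r X Y) $ i $ j) (at X)"
    unfolding forall_4 polar_metric_def polar_metric_dX_def vector_4
    by (intro conjI; (auto intro!: deriv simp: poly))
  then show ?X by blast
  have "\<forall>i j. ((\<lambda>Y. polar_metric a r X Y (b r) (polar_j X Y) (polar_w a r) (polar_e a r X Y) $ i $ j) has_real_derivative
      polar_metric_dY a r X Y (b r) (b1 r) (polar_u a r X Y) (polar_j X Y) (polar_w a r) (polar_e a r X Y) $ i $ j) (at Y)"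
    unfolding forall_4 polar_metric_def polar_metric_dY_def vector_4
    by (intro conjI; (auto intro!: deriv simp: poly))
  then show ?Y by blast
qed

end

lemma has_mpd_coordinates3:
  fixes F :: "real \<Rightarrow> real \<Rightarrow> real \<Rightarrow> real^'q^'p" and y :: "real^4"
  assumes "\<And>i j. ((\<lambda>r. F r (y $ 3) (y $ 4) $ i $ j) has_real_derivative D2 $ i $ j) (at (y $ 2))"
    and "\<And>i j. ((\<lambda>X. F (y $ 2) X (y $ 4) $ i $ j) has_real_derivative D3 $ i $ j) (at (y $ 3))"
    and "\<And>i j. ((\<lambda>Y. F (y $ 2) (y $ 3) Y $ i $ j) has_real_derivative D4 $ i $ j) (at (y $ 4))"
  shows "has_mpd k (\<lambda>y. F (y $ 2) (y $ 3) (y $ 4))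
    (if k = 2 then D2 else if k = 3 then D3 else if k = 4 then D4 else 0) y"
proof -
  have "k = 1 \<or> k = 2 \<or> k = 3 \<or> k = 4"
    by (rule exhaust_4)
  then show ?thesis
    using assms DERIV_shift[of _ _ 0 "y $ 2"] DERIV_shift[of _ _ 0 "y $ 3"] DERIV_shift[of _ _ 0 "y $ 4"]
    by (auto simp: has_mpd_def has_pd_def axis_def add.commute)
qed

context
  fixes a r b2 :: real and b b1 :: "real \<Rightarrow> real"
  assumes r: "r > 0"
    and db: "(b has_real_derivative b1 r) (at r)" and db1: "(b1 has_real_derivative b2) (at r)"
begin

lemma DERIV_polar_inv_axis:
  "((\<lambda>r. polar_metric_inv a r 0 0 (b r) (polar_u a r 0 0) (polar_w a r) (polar_e a r 0 0) $ i $ j) has_real_derivative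
      polar_inv_jet a r (b r) (b1 r) (polar_w a r) $ 2 $ i $ j) (at r)" (is ?r)
  "((\<lambda>X. polar_metric_inv a r X 0 (b r) (polar_u a r X 0) (polar_w a r) (polar_e a r X 0) $ i $ j) has_real_derivative
      polar_inv_jet a r (b r) (b1 r) (polar_w a r) $ 3 $ i $ j) (at 0)" (is ?X)
  "((\<lambda>Y. polar_metric_inv a r 0 Y (b r) (polar_u a r 0 Y) (polar_w a r) (polar_e a r 0 Y) $ i $ j) has_real_derivative
      polar_inv_jet a r (b r) (b1 r) (polar_w a r) $ 4 $ i $ j) (at 0)" (is ?Y)
proof -
  have 0: "(0::real)^2 + 0^2 < 1" by simp
  note deriv = derivative_eq_intros db DERIV_polar_w[OF r 0] DERIV_polar_u[OF r 0] DERIV_polar_e[OF r 0]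
  note poly = algebra_simps power2_eq_square power3_eq_cube numeral_eq_Suc
  have "\<forall>i j. ((\<lambda>r. polar_metric_inv a r 0 0 (b r) (polar_u a r 0 0) (polar_w a r) (polar_e a r 0 0) $ i $ j) has_real_derivative
      polar_inv_jet a r (b r) (b1 r) (polar_w a r) $ 2 $ i $ j) (at r)"
    unfolding forall_4 polar_metric_inv_def polar_inv_jet_def vector_4 polar_axis_values
    by (intro conjI; (auto intro!: deriv DERIV_polar_w[OF r 0, THEN DERIV_cong] simp: poly))
  then show ?r by blast
  have "\<forall>i j. ((\<lambda>X. polar_metric_inv a r X 0 (b r) (polar_u a r X 0) (polar_w a r) (polar_e a r X 0) $ i $ j) has_real_derivative
      polar_inv_jet a r (b r) (b1 r) (polar_w a r) $ 3 $ i $ j) (at 0)"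
    unfolding forall_4 polar_metric_inv_def polar_inv_jet_def vector_4
    by (intro conjI; (auto intro!: deriv simp: poly))
  then show ?X by blast
  have "\<forall>i j. ((\<lambda>Y. polar_metric_inv a r 0 Y (b r) (polar_u a r 0 Y) (polar_w a r) (polar_e a r 0 Y) $ i $ j) has_real_derivative
      polar_inv_jet a r (b r) (b1 r) (polar_w a r) $ 4 $ i $ j) (at 0)"
    unfolding forall_4 polar_metric_inv_def polar_inv_jet_def vector_4
    by (intro conjI; (auto intro!: deriv simp: poly))
  then show ?Y by blast
qed

text \<open>The first derivatives \<open>F k\<close> of the metric, differentiated along the coordinate lines through a
  point of the axis.\<close>

lemma DERIV_polar_jet2:
  defines "F \<equiv> \<lambda>(k::4) r X Y. (if k = 2 then polar_metric_dr else if k = 3 then polar_metric_dX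
      else if k = 4 then polar_metric_dY else (\<lambda>_ _ _ _ _ _ _ _ _ _. 0))
    a r X Y (b r) (b1 r) (polar_u a r X Y) (polar_j X Y) (polar_w a r) (polar_e a r X Y)"
  shows "((\<lambda>r. F k r 0 0 $ i $ j) has_real_derivative
      polar_jet2 a r (b r) (b1 r) b2 (polar_w a r) $ 2 $ k $ i $ j) (at r)" (is ?r)
    and "((\<lambda>X. F k r X 0 $ i $ j) has_real_derivative
      polar_jet2 a r (b r) (b1 r) b2 (polar_w a r) $ 3 $ k $ i $ j) (at 0)" (is ?X)
    and "((\<lambda>Y. F k r 0 Y $ i $ j) has_real_derivative
      polar_jet2 a r (b r) (b1 r) b2 (polar_w a r) $ 4 $ k $ i $ j) (at 0)" (is ?Y)
proof -
  have 0: "(0::real)^2 + 0^2 < 1" by simp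
  note deriv = derivative_eq_intros db db1 DERIV_polar_w[OF r 0] DERIV_polar_u[OF r 0]
    DERIV_polar_j[OF r 0] DERIV_polar_e[OF r 0]
  note poly = algebra_simps power2_eq_square power3_eq_cube numeral_eq_Suc
  have F: "F 1 = (\<lambda>_ _ _. 0)"
    "F 2 = (\<lambda>r X Y. polar_metric_dr a r X Y (b r) (b1 r) (polar_u a r X Y) (polar_j X Y) (polar_w a r) (polar_e a r X Y))"
    "F 3 = (\<lambda>r X Y. polar_metric_dX a r X Y (b r) (b1 r) (polar_u a r X Y) (polar_j X Y) (polar_w a r) (polar_e a r X Y))"
    "F 4 = (\<lambda>r X Y. polar_metric_dY a r X Y (b r) (b1 r) (polar_u a r X Y) (polar_j X Y) (polar_w a r) (polar_e a r X Y))"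
    by (simp_all add: F_def)
  note defs = polar_metric_dr_def polar_metric_dX_def polar_metric_dY_def polar_jet2_def vector_4
    zero_index
  have "\<forall>k i j. ((\<lambda>r. F k r 0 0 $ i $ j) has_real_derivative
      polar_jet2 a r (b r) (b1 r) b2 (polar_w a r) $ 2 $ k $ i $ j) (at r)"
    unfolding forall_4 F defs polar_axis_values
    by (intro conjI; (auto intro!: deriv simp: poly))
  then show ?r by blast
  have "\<forall>k i j. ((\<lambda>X. F k r X 0 $ i $ j) has_real_derivative
      polar_jet2 a r (b r) (b1 r) b2 (polar_w a r) $ 3 $ k $ i $ j) (at 0)"
    unfolding forall_4 F defs
    by (intro conjI; (auto intro!: deriv simp: poly))
  then show ?X by blast
  have "\<forall>k i j. ((\<lambda>Y. F k r 0 Y $ i $ j) has_real_derivative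
      polar_jet2 a r (b r) (b1 r) b2 (polar_w a r) $ 4 $ k $ i $ j) (at 0)"
    unfolding forall_4 F defs
    by (intro conjI; (auto intro!: deriv simp: poly))
  then show ?Y by blast
qed

end

text \<open>The parameter \<open>f\<close> is the square of the shift \<open>b\<close>, in terms of which
  \<open>2 r M = f (r\<^sup>2 + a\<^sup>2)\<close>.\<close>

lemma effective_DEC_polar_axis:
  fixes b b1 b2 :: "real \<Rightarrow> real" and x :: "real^4"
  assumes I: "open I" and pos: "\<And>r. r \<in> I \<Longrightarrow> r > 0"
    and db: "\<And>r. r \<in> I \<Longrightarrow> (b has_real_derivative b1 r) (at r)"
    and db1: "\<And>r. r \<in> I \<Longrightarrow> (b1 has_real_derivative b2 r) (at r)"
    and g: "\<And>y. y $ 2 \<in> I \<Longrightarrow> (y $ 3)^2 + (y $ 4)^2 < 1 \<Longrightarrow> g y = polar_metric a (y $ 2) (y $ 3) (y $ 4)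
      (b (y $ 2)) (polar_j (y $ 3) (y $ 4)) (polar_w a (y $ 2)) (polar_e a (y $ 2) (y $ 3) (y $ 4))"
    and x: "x $ 2 = r" "x $ 3 = 0" "x $ 4 = 0" "r \<in> I"
  defines "f \<equiv> (b r)^2" and "f1 \<equiv> 2 * b r * b1 r" and "f2 \<equiv> 2 * ((b1 r)^2 + b r * b2 r)"
  defines "\<rho> \<equiv> (r * (f1 * (r^2 + a^2) + 2 * r * f) - f * (r^2 + a^2)) / (r^2 + a^2)^2"
  defines "p \<equiv> \<rho> - (f2 * (r^2 + a^2) + 4 * r * f1 + 2 * f) / 2 / (r^2 + a^2)"
  assumes bound: "\<bar>p\<bar> \<le> \<rho>"
  shows "effective_DEC g x"
proof -
  define U where "U = {y :: real^4. y $ 2 \<in> I \<and> (y $ 3)^2 + (y $ 4)^2 < 1}"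
  have xU: "x \<in> U"
    using x by (simp add: U_def)
  have "open ((\<lambda>y :: real^4. y $ 2) -` I \<inter> (\<lambda>y. (y $ 3)^2 + (y $ 4)^2) -` {..<1})"
    by (intro open_Int open_vimage I continuous_intros open_lessThan)
  also have "(\<lambda>y :: real^4. y $ 2) -` I \<inter> (\<lambda>y. (y $ 3)^2 + (y $ 4)^2) -` {..<1} = U"
    by (auto simp: U_def)
  finally have U: "open U" .
  have r: "r > 0"
    using pos x by simp
  let ?w = "polar_w a r"
  define Fg where "Fg = (\<lambda>r X Y. polar_metric a r X Y (b r) (polar_j X Y) (polar_w a r) (polar_e a r X Y))"
  define FH where "FH = (\<lambda>r X Y. polar_metric_inv a r X Y (b r) (polar_u a r X Y) (polar_w a r) (polar_e a r X Y))"
  define F where "F = (\<lambda>(k::4) r X Y. (if k = 2 then polar_metric_dr else if k = 3 then polar_metric_dX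
      else if k = 4 then polar_metric_dY else (\<lambda>_ _ _ _ _ _ _ _ _ _. 0))
    a r X Y (b r) (b1 r) (polar_u a r X Y) (polar_j X Y) (polar_w a r) (polar_e a r X Y))"
  define H where "H y = FH (y $ 2) (y $ 3) (y $ 4)" for y :: "real^4"
  define D where "D k y = F k (y $ 2) (y $ 3) (y $ 4)" for k and y :: "real^4"
  define DD where "DD l k = polar_jet2 a r (b r) (b1 r) (b2 r) ?w $ l $ k" for l k
  define dH where "dH l = polar_inv_jet a r (b r) (b1 r) ?w $ l" for l
  have inv: "H y ** g y = mat 1" if "y \<in> U" for y
    using that pos[of "y $ 2"] unfolding H_def FH_def
    by (subst g) (auto simp: U_def polar_e_def intro!: polar_metric_inverse polar_relations)
  have dg: "has_mpd k g (D k y) y" if "y \<in> U" for k y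
  proof -
    have y: "y $ 2 > 0" "(y $ 3)^2 + (y $ 4)^2 < 1" "(b has_real_derivative b1 (y $ 2)) (at (y $ 2))"
      using that pos db by (auto simp: U_def)
    have "has_mpd k (\<lambda>y. Fg (y $ 2) (y $ 3) (y $ 4))
      (if k = 2 then F 2 (y $ 2) (y $ 3) (y $ 4) else if k = 3 then F 3 (y $ 2) (y $ 3) (y $ 4)
       else if k = 4 then F 4 (y $ 2) (y $ 3) (y $ 4) else 0) y"
      unfolding Fg_def F_def
      by (rule has_mpd_coordinates3; simp; rule DERIV_polar_metric[where b=b and ?b1.0=b1, OF y])
    also have "(if k = 2 then F 2 (y $ 2) (y $ 3) (y $ 4) else if k = 3 then F 3 (y $ 2) (y $ 3) (y $ 4)
       else if k = 4 then F 4 (y $ 2) (y $ 3) (y $ 4) else 0) = D k y"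
      by (simp add: D_def F_def)
    finally show ?thesis
      using has_mpd_cong[OF U that, of g "\<lambda>y. Fg (y $ 2) (y $ 3) (y $ 4)"] g
      by (auto simp: U_def Fg_def)
  qed
  have jet_zero: "polar_jet2 a r b b1 b2 w $ 1 = 0" "polar_inv_jet a r b b1 w $ 1 = 0" for b b1 b2 w
    by (simp_all add: polar_jet2_def polar_inv_jet_def vector_4)
  have split4: "(if l = 2 then A $ 2 else if l = 3 then A $ 3 else if l = 4 then A $ 4 else 0) = A $ l"
    if "A $ 1 = 0" for A :: "'z::zero^4" and l
    using exhaust_4[of l] that by auto
  have ddg: "has_mpd l (D k) (DD l k) x" for l k
  proof -
    let ?A = "polar_jet2 a r (b r) (b1 r) (b2 r) ?w"
    have "has_mpd l (\<lambda>y. F k (y $ 2) (y $ 3) (y $ 4))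
      (if l = 2 then ?A $ 2 $ k else if l = 3 then ?A $ 3 $ k else if l = 4 then ?A $ 4 $ k else 0) x"
      unfolding F_def
      by (rule has_mpd_coordinates3; unfold x; rule DERIV_polar_jet2[where b=b and ?b1.0=b1, OF r db[OF x(4)] db1[OF x(4)]])
    also have "(if l = 2 then ?A $ 2 $ k else if l = 3 then ?A $ 3 $ k else if l = 4 then ?A $ 4 $ k else 0)
        = DD l k"
      using split4[of "\<chi> l. ?A $ l $ k" l] by (simp add: DD_def jet_zero cong: if_cong)
    finally show ?thesis
      by (simp add: D_def[abs_def])
  qed
  have dH: "has_mpd l H (dH l) x" for l
  proof -
    let ?A = "polar_inv_jet a r (b r) (b1 r) ?w"
    have "has_mpd l (\<lambda>y. FH (y $ 2) (y $ 3) (y $ 4))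
      (if l = 2 then ?A $ 2 else if l = 3 then ?A $ 3 else if l = 4 then ?A $ 4 else 0) x"
      unfolding FH_def
      by (rule has_mpd_coordinates3; unfold x; rule DERIV_polar_inv_axis[where b=b and ?b1.0=b1, OF r db[OF x(4)] db1[OF x(4)]])
    then show ?thesis
      using split4[of ?A l] by (simp add: H_def[abs_def] dH_def jet_zero)
  qed
  define m1 where "m1 = polar_axis_lr (b r)"
  define m2 where "m2 = polar_axis_ang a r"
  have w: "r^2 * ?w + a^2 * ?w = 1" "?w = 1 / (r^2 + a^2)"
    using polar_relations(2)[of r 0 0 a] r by (simp add: algebra_simps, simp add: polar_w_def)
  have Hx: "H x = polar_metric_inv a r 0 0 (b r) ?w ?w 1"
    by (simp add: H_def FH_def x)
  have Dx: "D k x = (if k = 2 then polar_metric_dr a r 0 0 (b r) (b1 r) ?w 1 ?w 1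
      else if k = 3 then polar_metric_dX a r 0 0 (b r) (b1 r) ?w 1 ?w 1
      else if k = 4 then polar_metric_dY a r 0 0 (b r) (b1 r) ?w 1 ?w 1 else 0)" for k
    by (simp add: D_def F_def x)
  have rho: "\<rho> = (r * (2 * b r * b1 r * (r^2 + a^2) + 2 * r * (b r)^2) - (b r)^2 * (r^2 + a^2)) * ?w^2"
    by (simp add: \<rho>_def f_def f1_def w(2) power_divide)
  have p: "p = \<rho> - (2 * ((b1 r)^2 + b r * b2 r) * (r^2 + a^2) + 8 * r * b r * b1 r + 2 * (b r)^2) / 2 * ?w"
    by (simp add: p_def f_def f1_def f2_def w(2))
  have ric: "ricci g x = (- p) *\<^sub>R m1 + \<rho> *\<^sub>R m2"
  proof -
    have "ricci g x $ j $ k = ((- p) *\<^sub>R m1 + \<rho> *\<^sub>R m2) $ j $ k" for j k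
      by (subst ricci_of_two_jet[where D=D and DD=DD and H=H and dH=dH, OF U xU])
        (simp_all only: inv dg ddg[unfolded DD_def] dH[unfolded dH_def] Hx Dx DD_def dH_def m1_def m2_def p rho polar_ricci[OF w(1)])
    then show ?thesis
      by (simp add: vec_eq_iff)
  qed
  have gx: "g x = m1 + m2"
    using g[of x] x by (simp add: vec_eq_iff forall_4 polar_metric_def vector_4 m1_def m2_def
        polar_axis_lr_def polar_axis_ang_def)
  have orth: "m1 ** H x ** m2 = 0" and sym: "transpose m1 = m1" "transpose m2 = m2"
    by (simp_all add: vec_eq_iff forall_4 sum_4 matrix_matrix_mult_def transpose_def vector_4
        Hx polar_metric_inv_def m1_def m2_def polar_axis_lr_def polar_axis_ang_def algebra_simps)
  have "scalar_curvature g x = 2 * (\<rho> - p)"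
  proof -
    have "scalar_curvature g x = - 2 * p + 2 * \<rho> * (r^2 * ?w + a^2 * ?w)"
      unfolding scalar_curvature_def matrix_inv_eqI[OF inv[OF xU]] ric
      by (simp add: sum_4 vector_4 Hx polar_metric_inv_def m1_def m2_def polar_axis_lr_def
          polar_axis_ang_def algebra_simps power2_eq_square)
    then show ?thesis
      unfolding w(1) by simp
  qed
  then have scal: "scalar_curvature g x / 2 = \<rho> - p"
    by simp
  have G: "einstein g x = (- \<rho>) *\<^sub>R m1 + p *\<^sub>R m2"
    unfolding einstein_def ric gx scal by (simp add: vec_eq_iff algebra_simps)
  show ?thesis
    unfolding effective_DEC_def
  proof (rule dominant_energy_condition_blocks[OF gx inv[OF xU] sym orth _ G bound])
    show "v \<bullet> (m2 *v v) \<ge> 0" for v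
      by (simp add: m2_def polar_axis_ang_def inner_vec_def matrix_vector_mult_def sum_4 vector_4
          mult.left_commute[of "v $ _"] power2_eq_square[symmetric])
  qed
qed

section \<open>The charts of the Gurses-Gursey metric\<close>

text \<open>Shows how \<open>K\<close> selects the chart. If \<open>A * K = 1\<close>, the cross
  terms with dr vanish and dr^2 gets S K = Sigma / Delta; if \<open>A * K = 1 - b\<close>, the dt dr
  entry is \<open>b\<close> and dr^2 gets Sigma / (r^2 + a^2).\<close>

lemma carter_metric_components:
  fixes a r s c A K u :: real
  assumes "(r^2 + a^2 * c^2) * u = 1"
  shows "transpose (carter_coframe a r s c K) ** carter_metric a r s c A u ** carter_coframe a r s c K = vector [
     vector [(a^2 * s^2 - A) * u, 1 - A * K, 0, a * s^2 * (A - (r^2 + a^2)) * u],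
     vector [1 - A * K, (r^2 + a^2 * c^2) * K * (2 - A * K), 0, - (a * s^2 * (1 - A * K))],
     vector [0, 0, r^2 + a^2 * c^2, 0],
     vector [a * s^2 * (A - (r^2 + a^2)) * u, - (a * s^2 * (1 - A * K)), 0,
       s^2 * ((r^2 + a^2)^2 - A * a^2 * s^2) * u]]"
proof -
  define S where "S = r^2 + a^2 * c^2"
  have u: "S * u = 1" and u': "S * (u * x) = x" for x
    using assms by (simp_all add: S_def mult.assoc[symmetric])
  show ?thesis
    unfolding vec_eq_iff forall_4 matrix_matrix_mult_def transpose_def vec_lambda_beta sum_4
      carter_coframe_def carter_metric_def carter_metric_lr_def carter_metric_ang_def
      vector_add_component vector_4 S_def[symmetric]
    by (intro conjI; (simp add: algebra_simps power2_eq_square u u'; fail)?)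
qed

lemma Sigma_fn_eq: "Sigma_fn a r \<theta> = (r^2 + a^2) - a^2 * (sin \<theta>)^2"
  by (simp add: Sigma_fn_def cos_squared_eq algebra_simps)

lemma gg_metric_eq:
  fixes y :: "real^4"
  assumes "y $ 2 > 0" "Delta_fn M a (y $ 2) \<noteq> 0"
  shows "gg_metric M a y =
    transpose (carter_coframe a (y $ 2) (sin (y $ 3)) (cos (y $ 3)) (1 / Delta_fn M a (y $ 2)))
      ** carter_metric a (y $ 2) (sin (y $ 3)) (cos (y $ 3)) (Delta_fn M a (y $ 2)) (inv_Sigma a (y $ 2) (y $ 3))
      ** carter_coframe a (y $ 2) (sin (y $ 3)) (cos (y $ 3)) (1 / Delta_fn M a (y $ 2))"
proof -
  define r \<theta> S A where "r = y $ 2" and "\<theta> = y $ 3" and "S = Sigma_fn a r \<theta>" and "A = Delta_fn M a r"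
  have S: "S > 0" "S = r^2 + a^2 * (cos \<theta>)^2" "S = (r^2 + a^2) - a^2 * (sin \<theta>)^2"
    using Sigma_pos[of r a \<theta>] assms
    by (simp add: S_def r_def, simp add: S_def Sigma_fn_def, simp add: S_def Sigma_fn_eq)
  have A: "A \<noteq> 0" "2 * M r * r = r^2 + a^2 - A"
    using assms by (simp_all add: A_def Delta_fn_def r_def)
  have u: "(r^2 + a^2 * (cos \<theta>)^2) * inv_Sigma a r \<theta> = 1" "inv_Sigma a r \<theta> = 1 / S"
    using S by (simp_all add: inv_Sigma_def S_def)
  \<comment> \<open>The frame form of the metric knows the mass only through \<open>A\<close>, so
    \<open>M\<close> is eliminated in its favour.\<close>
  have W: "4 * a * M r * r * X = 2 * a * (r^2 + a^2 - A) * X" "2 * a^2 * M r * r * X = a^2 * (r^2 + a^2 - A) * X" for X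
    unfolding A(2)[symmetric] by simp_all
  show ?thesis
    unfolding carter_metric_components[OF u(1)[unfolded r_def \<theta>_def]]
    unfolding r_def[symmetric] \<theta>_def[symmetric] A_def[symmetric] u(2) S(2)[symmetric]
    using A(1) S(1)
    by (simp add: gg_metric_def Let_def r_def[symmetric] \<theta>_def[symmetric] S_def[symmetric] A_def[symmetric]
        symprod_def axis_def vec_eq_iff forall_4 vector_4 W A(2))
      (simp add: S(3) field_simps power2_eq_square)
qed

lemma doran_metric_eq:
  fixes y :: "real^4"
  assumes r: "y $ 2 > 0" and b: "b \<ge> 0" "b^2 * ((y $ 2)^2 + a^2) = 2 * y $ 2 * M (y $ 2)"
  shows "doran_metric M a y =
    transpose (carter_coframe a (y $ 2) (sin (y $ 3)) (cos (y $ 3)) (1 / (((y $ 2)^2 + a^2) * (1 + b))))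
      ** carter_metric a (y $ 2) (sin (y $ 3)) (cos (y $ 3)) (Delta_fn M a (y $ 2)) (inv_Sigma a (y $ 2) (y $ 3))
      ** carter_coframe a (y $ 2) (sin (y $ 3)) (cos (y $ 3)) (1 / (((y $ 2)^2 + a^2) * (1 + b)))"
proof -
  define r \<theta> S P where "r = y $ 2" and "\<theta> = y $ 3" and "S = Sigma_fn a r \<theta>" and "P = r^2 + a^2"
  have S: "S > 0" "S = r^2 + a^2 * (cos \<theta>)^2" "S = P - a^2 * (sin \<theta>)^2"
    using Sigma_pos[of r a \<theta>] r
    by (simp add: S_def r_def, simp add: S_def Sigma_fn_def, simp add: S_def Sigma_fn_eq P_def)
  have P: "P > 0"
    using r by (simp add: P_def r_def add_pos_nonneg)
  have A: "Delta_fn M a r = P * (1 - b^2)"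
    using b by (simp add: Delta_fn_def P_def r_def algebra_simps)
  \<comment> \<open>Delta factors as (r^2 + a^2) (1 - b) (1 + b). Dividing only by the factor that
    stays positive keeps \<open>K\<close> finite at the horizon b = 1.\<close>
  have AK: "P * (1 - b^2) * (1 / (P * (1 + b))) = 1 - b"
  proof -
    have "1 - b^2 = (1 - b) * (1 + b)"
      by (simp add: algebra_simps power2_eq_square)
    then show ?thesis
      using P b(1) by simp
  qed
  have u: "(r^2 + a^2 * (cos \<theta>)^2) * inv_Sigma a r \<theta> = 1" "inv_Sigma a r \<theta> = 1 / S"
    using S by (simp_all add: inv_Sigma_def S_def)
  have "(b * P)^2 = (b^2 * P) * P"
    by (simp add: power2_eq_square)
  then have "2 * M r * r * P = (b * P)^2"
    using b(2) by (simp add: P_def r_def)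
  then have sqrt: "sqrt (2 * M r * r * P) = b * P"
    using b(1) P by simp
  show ?thesis
    unfolding carter_metric_components[OF u(1)[unfolded r_def \<theta>_def]]
    unfolding r_def[symmetric] \<theta>_def[symmetric] u(2) S(2)[symmetric] P_def[symmetric] A AK
    using P S(1) b(1)
    by (simp add: doran_metric_def Let_def r_def[symmetric] \<theta>_def[symmetric] S_def[symmetric] P_def[symmetric] sqrt
        symprod_def axis_def vec_eq_iff forall_4 vector_4)
      (simp add: S(3) field_simps power2_eq_square)
qed

lemma doran_polar_metric_eq:
  fixes y :: "real^4"
  assumes r: "y $ 2 > 0" and XY: "(y $ 3)^2 + (y $ 4)^2 < 1"
    and b: "b \<ge> 0" "b^2 * ((y $ 2)^2 + a^2) = 2 * y $ 2 * M (y $ 2)"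
  shows "doran_polar_metric M a y = polar_metric a (y $ 2) (y $ 3) (y $ 4) b (polar_j (y $ 3) (y $ 4))
    (polar_w a (y $ 2)) (polar_e a (y $ 2) (y $ 3) (y $ 4))"
proof -
  define r X Y S P where "r = y $ 2" and "X = y $ 3" and "Y = y $ 4"
    and "S = r^2 + a^2 * (1 - X^2 - Y^2)" and "P = r^2 + a^2"
  have pos: "S > 0" "P > 0" "1 - X^2 - Y^2 > 0"
    using polar_denominators(1,2)[OF r XY, where a=a] polar_denominators(3)[OF r XY] by (simp_all add: S_def P_def r_def X_def Y_def)
  have "(b * P)^2 = (b^2 * P) * P"
    by (simp add: power2_eq_square)
  then have "2 * M r * r * P = (b * P)^2"
    using b(2) by (simp add: P_def r_def)
  then have sqrt: "sqrt (2 * M r * r * P) = b * P"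
    using b(1) pos by simp
  have e: "polar_e a r X Y = P / S"
  proof -
    have "P = S + a^2 * (X^2 + Y^2)"
      by (simp add: S_def P_def algebra_simps)
    then show ?thesis
      using pos(1) by (simp add: polar_e_def polar_u_def S_def[symmetric] add_divide_distrib)
  qed
  have S': "S = P - a^2 * X^2 - a^2 * Y^2"
    by (simp add: S_def P_def algebra_simps)
  show ?thesis
    unfolding r_def[symmetric] X_def[symmetric] Y_def[symmetric] e polar_w_def polar_j_def P_def[symmetric]
    using pos
    by (simp add: doran_polar_metric_def polar_metric_def Let_def r_def[symmetric] X_def[symmetric] Y_def[symmetric]
        S_def[symmetric] P_def[symmetric] sqrt symprod_def axis_def vec_eq_iff forall_4 vector_4)
      (simp add: S' field_simps power2_eq_square)
qed

section \<open>From bounds on the mass function to the energy condition in all charts\<close>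

lemma DERIV_recip_twice:
  fixes d d1 :: "real \<Rightarrow> real"
  assumes "(d has_real_derivative d1 r) (at r)" "(d1 has_real_derivative d2) (at r)" "d r \<noteq> 0"
  shows "((\<lambda>r. 1 / d r) has_real_derivative - d1 r / (d r)^2) (at r)"
    and "((\<lambda>r. - d1 r / (d r)^2) has_real_derivative - d2 / (d r)^2 + 2 * (d1 r)^2 / (d r)^3) (at r)"
  using assms(3) by (auto intro!: derivative_eq_intros assms(1,2)
      simp: power2_eq_square power3_eq_cube field_simps)

text \<open>\<open>S\<close>, \<open>P\<close>, \<open>q\<close>, \<open>k\<close> stand for Sigma,
  r^2 + a^2, 2 M' + r M'', r^2 M', so that rho = 2 k / S^2 and p = rho - q / S. Thus |p| <= rho
  means 0 <= q S <= 4 k, which is most restrictive at the largest value of Sigma, on the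
  axis.\<close>

lemma energy_bound:
  fixes S P q k :: real
  assumes "S > 0" "S \<le> P" "0 \<le> q" "q * P \<le> 4 * k"
  shows "\<bar>2 * k / S^2 - q / S\<bar> \<le> 2 * k / S^2"
proof -
  have "q * S \<le> 4 * k"
    using assms mult_left_mono[of S P q] by linarith
  then have "q / S \<le> 4 * k / S^2"
    using assms(1) by (simp add: power2_eq_square field_simps)
  moreover have "0 \<le> q / S"
    using assms by simp
  ultimately show ?thesis
    by linarith
qed

text \<open>\<open>R\<close> may be a closed half-line, while curvature needs derivatives on an open
  set of radii; hence the smoothness assumptions for all r > 0. Positivity of \<open>M\<close> keeps
  the square root b differentiable.\<close>

theorem DEC_on_radii_criterion:
  fixes M M1 M2 :: "real \<Rightarrow> real"
  assumes M: "\<And>r. r > 0 \<Longrightarrow> M r > 0"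
    and dM: "\<And>r. r > 0 \<Longrightarrow> (M has_real_derivative M1 r) (at r)"
    and dM1: "\<And>r. r > 0 \<Longrightarrow> (M1 has_real_derivative M2 r) (at r)"
    and R: "\<And>r. r \<in> R \<Longrightarrow> r > 0"
    and bound: "\<And>r. r \<in> R \<Longrightarrow> 0 \<le> 2 * M1 r + r * M2 r"
      "\<And>r. r \<in> R \<Longrightarrow> (2 * M1 r + r * M2 r) * (r^2 + a^2) \<le> 4 * (r^2 * M1 r)"
  shows "DEC_on_radii M a R"
proof -
  define A where "A = Delta_fn M a"
  define A1 where "A1 r = 2 * r - 2 * M r - 2 * r * M1 r" for r
  define A2 where "A2 r = 2 - 4 * M1 r - 2 * r * M2 r" for r
  have dA: "(A has_real_derivative A1 r) (at r)" if "r > 0" for r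
    unfolding A_def Delta_fn_def A1_def
    by (auto intro!: derivative_eq_intros dM[OF that] simp: algebra_simps)
  have dA1: "(A1 has_real_derivative A2 r) (at r)" if "r > 0" for r
    unfolding A1_def A2_def
    by (auto intro!: derivative_eq_intros dM[OF that] dM1[OF that] simp: algebra_simps)
  have sph: "\<bar>(r^2 - r * A1 r - a^2 + A r) * (inv_Sigma a r \<theta>)^2 - (1 - A2 r / 2) * inv_Sigma a r \<theta>\<bar>
      \<le> (r^2 - r * A1 r - a^2 + A r) * (inv_Sigma a r \<theta>)^2" if "r \<in> R" for r \<theta>
  proof -
    have "r^2 - r * A1 r - a^2 + A r = 2 * (r^2 * M1 r)" "1 - A2 r / 2 = 2 * M1 r + r * M2 r"
      by (simp_all add: A1_def A2_def A_def Delta_fn_def field_simps power2_eq_square)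
    moreover have "Sigma_fn a r \<theta> \<le> r^2 + a^2"
      by (simp add: Sigma_fn_eq)
    ultimately show ?thesis
      using energy_bound[OF Sigma_pos[OF R[OF that]] _ bound[OF that], of a \<theta>]
      by (simp add: inv_Sigma_def power_divide)
  qed

  \<comment> \<open>\<open>f\<close> is the square of the shift \<open>b\<close>. \<open>f1\<close>
    and \<open>f2\<close> solve the first and second derivative of
    \<open>f r * (r^2 + a^2) = 2 * r * M r\<close>, and \<open>b1\<close>, \<open>b2\<close> solve
    those of \<open>(b r)^2 = f r\<close>.\<close>
  define f where "f r = 2 * r * M r / (r^2 + a^2)" for r
  define f1 where "f1 r = (2 * M r + 2 * r * M1 r - 2 * r * f r) / (r^2 + a^2)" for r
  define f2 where "f2 r = (4 * M1 r + 2 * r * M2 r - 4 * r * f1 r - 2 * f r) / (r^2 + a^2)" for r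
  define b where "b r = sqrt (f r)" for r
  define b1 where "b1 r = f1 r / (2 * b r)" for r
  define b2 where "b2 r = (f2 r - 2 * (b1 r)^2) / (2 * b r)" for r
  have P: "r^2 + a^2 > 0" if "r > 0" for r
    using that by (simp add: add_pos_nonneg)
  have fP: "f r * (r^2 + a^2) = 2 * r * M r"
    and f1P: "f1 r * (r^2 + a^2) = 2 * M r + 2 * r * M1 r - 2 * r * f r"
    and f2P: "f2 r * (r^2 + a^2) = 4 * M1 r + 2 * r * M2 r - 4 * r * f1 r - 2 * f r" if "r > 0" for r
    using P[OF that] that by (simp_all add: f_def f1_def f2_def)
  have quotient: "((\<lambda>r. h r / (r^2 + a^2)) has_real_derivative (h' - 2 * r * (h r / (r^2 + a^2))) / (r^2 + a^2)) (at r)"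
    if "r > 0" "(h has_real_derivative h') (at r)" for h h' r
    using P[OF that(1)] that(1) by (auto intro!: derivative_eq_intros that(2) simp: field_simps power2_eq_square)
  have df: "(f has_real_derivative f1 r) (at r)" if "r > 0" for r
  proof -
    have "((\<lambda>r. 2 * r * M r) has_real_derivative 2 * M r + 2 * r * M1 r) (at r)"
      by (auto intro!: derivative_eq_intros dM[OF that])
    from quotient[OF that this] show ?thesis
      by (simp add: f_def[abs_def] f1_def)
  qed
  have df1: "(f1 has_real_derivative f2 r) (at r)" if "r > 0" for r
  proof -
    have "((\<lambda>r. 2 * M r + 2 * r * M1 r - 2 * r * f r) has_real_derivative
        4 * M1 r + 2 * r * M2 r - 2 * f r - 2 * r * f1 r) (at r)"
      by (auto intro!: derivative_eq_intros dM[OF that] dM1[OF that] df[OF that])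
    from quotient[OF that this, folded f1_def] show ?thesis
      by (simp add: f2_def algebra_simps)
  qed
  have f_pos: "f r > 0" if "r > 0" for r
    using P[OF that] M[OF that] that by (simp add: f_def)
  have b_pos: "b r > 0" and b_sq: "(b r)^2 = f r" if "r > 0" for r
    using f_pos[OF that] by (simp_all add: b_def)
  have db: "(b has_real_derivative b1 r) (at r)" if "r > 0" for r
    using f_pos[OF that] unfolding b_def b1_def
    by (auto intro!: derivative_eq_intros df[OF that] simp: field_simps)
  have db1: "(b1 has_real_derivative b2 r) (at r)" if "r > 0" for r
  proof -
    have "((\<lambda>r. f1 r / (2 * b r)) has_real_derivative (f2 r * (2 * b r) - f1 r * (2 * b1 r)) / (2 * b r * (2 * b r))) (at r)"
      using b_pos[OF that] by (auto intro!: derivative_eq_intros df1[OF that] db[OF that])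
    also have "(f2 r * (2 * b r) - f1 r * (2 * b1 r)) / (2 * b r * (2 * b r)) = b2 r"
      using b_pos[OF that] by (simp add: b2_def b1_def field_simps power2_eq_square)
    finally show ?thesis
      by (simp add: b1_def[abs_def])
  qed
  have bP: "(b r)^2 * (r^2 + a^2) = 2 * r * M r" if "r > 0" for r
    using b_sq[OF that] fP[OF that] by simp

  have BL: "effective_DEC (gg_metric M a) (vector [t, r, \<theta>, \<phi>])"
    if r: "r \<in> R" and \<theta>: "0 < \<theta>" "\<theta> < pi" and "Delta_fn M a r \<noteq> 0" for t r \<theta> \<phi>
  \<comment> \<open>The Boyer-Lindquist choice K = 1 / A forces the neighbourhood to avoid the roots
    of \<open>A\<close>; it is open by continuity of \<open>A\<close>.\<close>
  proof (rule effective_DEC_carter[where I="{r \<in> {0<..}. A r \<noteq> 0}" and r=r and \<theta>=\<theta> and A=A and ?A1.0=A1 and ?A2.0=A2 and K="\<lambda>r. 1 / A r"])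
    have "continuous_on {0<..} A"
      by (meson DERIV_isCont continuous_at_imp_continuous_on dA greaterThan_iff)
    then show "open {r \<in> {0<..}. A r \<noteq> 0}"
      using continuous_open_preimage[of "{0<..}" A "- {0}"] by (simp add: vimage_def Int_def open_Compl)
    show "((\<lambda>r. 1 / A r) has_real_derivative - A1 r / (A r)^2) (at r)"
      "((\<lambda>r. - A1 r / (A r)^2) has_real_derivative - A2 r / (A r)^2 + 2 * (A1 r)^2 / (A r)^3) (at r)"
      if "r \<in> {r \<in> {0<..}. A r \<noteq> 0}" for r
      using that DERIV_recip_twice[OF dA dA1] by auto
    show "gg_metric M a y =
      transpose (carter_coframe a (y $ 2) (sin (y $ 3)) (cos (y $ 3)) (1 / A (y $ 2)))
      ** carter_metric a (y $ 2) (sin (y $ 3)) (cos (y $ 3)) (A (y $ 2)) (inv_Sigma a (y $ 2) (y $ 3))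
      ** carter_coframe a (y $ 2) (sin (y $ 3)) (cos (y $ 3)) (1 / A (y $ 2))"
      if "y $ 2 \<in> {r \<in> {0<..}. A r \<noteq> 0}" for y
      using that gg_metric_eq[of y M a] by (simp add: A_def)
  qed (use that R sph in \<open>auto simp: vector_4 A_def intro: dA[unfolded A_def] dA1\<close>)

  have doran: "effective_DEC (doran_metric M a) (vector [t, r, \<theta>, \<phi>])"
    if r: "r \<in> R" and \<theta>: "0 < \<theta>" "\<theta> < pi" for t r \<theta> \<phi>
  proof -
    define d where "d r = (r^2 + a^2) * (1 + b r)" for r
    define d1 where "d1 r = 2 * r * (1 + b r) + (r^2 + a^2) * b1 r" for r
    define d2 where "d2 r = 2 * (1 + b r) + 4 * r * b1 r + (r^2 + a^2) * b2 r" for r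
    have d: "(d has_real_derivative d1 r) (at r)" "(d1 has_real_derivative d2 r) (at r)"
      if "r > 0" for r
      unfolding d_def d1_def d2_def
      by (auto intro!: derivative_eq_intros db[OF that] db1[OF that] simp: algebra_simps)
    have d_pos: "d r > 0" if "r > 0" for r
      using P[OF that] b_pos[OF that] by (simp add: d_def)
    show ?thesis
    proof (rule effective_DEC_carter[where I="{0<..}" and r=r and \<theta>=\<theta> and A=A and ?A1.0=A1 and ?A2.0=A2 and K="\<lambda>r. 1 / d r"])
      show "((\<lambda>r. 1 / d r) has_real_derivative - d1 r / (d r)^2) (at r)"
        "((\<lambda>r. - d1 r / (d r)^2) has_real_derivative - d2 r / (d r)^2 + 2 * (d1 r)^2 / (d r)^3) (at r)"
        if "r \<in> {0<..}" for r
        using that DERIV_recip_twice[OF d] d_pos[of r] by auto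
      show "doran_metric M a y =
        transpose (carter_coframe a (y $ 2) (sin (y $ 3)) (cos (y $ 3)) (1 / d (y $ 2)))
        ** carter_metric a (y $ 2) (sin (y $ 3)) (cos (y $ 3)) (A (y $ 2)) (inv_Sigma a (y $ 2) (y $ 3))
        ** carter_coframe a (y $ 2) (sin (y $ 3)) (cos (y $ 3)) (1 / d (y $ 2))"
        if "y $ 2 \<in> {0<..}" for y
        using that doran_metric_eq[of y "b (y $ 2)" a M] b_pos[of "y $ 2"] bP[of "y $ 2"]
        by (simp add: A_def d_def)
    qed (use that R sph in \<open>auto simp: vector_4 A_def intro: dA[unfolded A_def] dA1\<close>)
  qed

  have polar: "effective_DEC (doran_polar_metric M a) (vector [t, r, 0, 0])" if r: "r \<in> R" for t r
  proof (rule effective_DEC_polar_axis[where I="{0<..}" and r=r and b=b and ?b1.0=b1 and ?b2.0=b2 and a=a])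
    have r0: "r > 0"
      using R r by simp
    have b1': "2 * b r * b1 r = f1 r" and b2': "2 * ((b1 r)^2 + b r * b2 r) = f2 r"
      using b_pos[OF r0] by (simp add: b1_def, simp add: b2_def field_simps)
    \<comment> \<open>Put h = 2 r M, which is f times r^2 + a^2. The two expressions of the polar
      computation are r h' - h = 2 r^2 M' and h'' / 2 = 2 M' + r M''.\<close>
    have rho: "r * (f1 r * (r^2 + a^2) + 2 * r * f r) - f r * (r^2 + a^2) = 2 * (r^2 * M1 r)"
      unfolding fP[OF r0] f1P[OF r0] by (simp add: algebra_simps power2_eq_square)
    have p: "(f2 r * (r^2 + a^2) + 4 * r * f1 r + 2 * f r) / 2 = 2 * M1 r + r * M2 r"
      unfolding f2P[OF r0] by simp
    show "\<bar>(r * (2 * b r * b1 r * (r^2 + a^2) + 2 * r * (b r)^2) - (b r)^2 * (r^2 + a^2)) / (r^2 + a^2)^2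
        - (2 * ((b1 r)^2 + b r * b2 r) * (r^2 + a^2) + 4 * r * (2 * b r * b1 r) + 2 * (b r)^2) / 2 / (r^2 + a^2)\<bar>
      \<le> (r * (2 * b r * b1 r * (r^2 + a^2) + 2 * r * (b r)^2) - (b r)^2 * (r^2 + a^2)) / (r^2 + a^2)^2"
      unfolding b1' b2' b_sq[OF r0] rho p by (rule energy_bound[OF P[OF r0] order_refl bound[OF r]])
    show "doran_polar_metric M a y = polar_metric a (y $ 2) (y $ 3) (y $ 4) (b (y $ 2)) (polar_j (y $ 3) (y $ 4))
        (polar_w a (y $ 2)) (polar_e a (y $ 2) (y $ 3) (y $ 4))"
      if "y $ 2 \<in> {0<..}" "(y $ 3)^2 + (y $ 4)^2 < 1" for y
      using that doran_polar_metric_eq[of y "b (y $ 2)" a M] b_pos[of "y $ 2"] bP[of "y $ 2"] by simp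
  qed (use that R in \<open>auto simp: vector_4 intro: db db1\<close>)

  show ?thesis
    unfolding DEC_on_radii_def using BL doran polar by blast
qed

section \<open>The Dymnikova mass function\<close>

definition mass_profile :: "real \<Rightarrow> real \<Rightarrow> real" where
  "mass_profile l r = arctan (r / l) - l * r / (r\<^sup>2 + l\<^sup>2)"

context
  fixes l :: real
  assumes l: "l > 0"
begin

lemma mass_profile_denominator: "r^2 + l^2 > 0"
  using l by (simp add: add_nonneg_pos)

lemma DERIV_mass_profile:
  "(mass_profile l has_real_derivative 2 * l * r^2 / (r^2 + l^2)^2) (at r)"
proof -
  have q: "r^2 + l^2 > 0"
    by (rule mass_profile_denominator)
  have "((\<lambda>r. arctan (r / l) - l * r / (r\<^sup>2 + l\<^sup>2)) has_real_derivative
      1 / (1 + (r / l)^2) * (1 / l) - (l * (r^2 + l^2) - l * r * (2 * r)) / ((r^2 + l^2) * (r^2 + l^2))) (at r)"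
  proof (rule DERIV_diff)
    show "((\<lambda>r. arctan (r / l)) has_real_derivative 1 / (1 + (r / l)^2) * (1 / l)) (at r)"
      using l by (auto intro!: derivative_eq_intros simp: divide_inverse)
    show "((\<lambda>r. l * r / (r\<^sup>2 + l\<^sup>2)) has_real_derivative
        (l * (r^2 + l^2) - l * r * (2 * r)) / ((r^2 + l^2) * (r^2 + l^2))) (at r)"
      using q l by (auto intro!: derivative_eq_intros)
  qed
  moreover have "1 / (1 + (r / l)^2) * (1 / l) = l / (r^2 + l^2)"
  proof -
    have "1 + (r / l)^2 = (r^2 + l^2) / l^2"
      using l by (simp add: power_divide add_divide_distrib)
    then show ?thesis
      using l by (simp add: power2_eq_square)
  qed
  moreover have "l / (r^2 + l^2) - (l * (r^2 + l^2) - l * r * (2 * r)) / ((r^2 + l^2) * (r^2 + l^2))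
      = 2 * l * r^2 / (r^2 + l^2)^2"
  proof -
    have "l / d - (l * d - x) / (d * d) = x / d^2" if "d > 0" for d x
      using that by (simp add: field_simps power2_eq_square)
    from this[OF q, of "l * r * (2 * r)"] show ?thesis
      by (simp add: power2_eq_square mult_ac)
  qed
  ultimately show ?thesis
    by (simp add: mass_profile_def[abs_def])
qed

lemma mass_profile_0: "mass_profile l 0 = 0"
  by (simp add: mass_profile_def)

lemma continuous_on_mass_profile: "continuous_on S (mass_profile l)"
  using DERIV_mass_profile by (meson DERIV_isCont continuous_at_imp_continuous_on)

lemma mass_profile_pos:
  assumes "r > 0" shows "mass_profile l r > 0"
proof -
  have "mass_profile l 0 < mass_profile l r"
  proof (rule DERIV_pos_imp_increasing_open[OF assms])
    fix x assume "0 < x" "x < r"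
    then show "\<exists>y. DERIV (mass_profile l) x :> y \<and> y > 0"
      using mass_profile_denominator[of x] l
      by (intro exI[of _ "2 * l * x^2 / (x^2 + l^2)^2"] conjI DERIV_mass_profile) simp
  qed (rule continuous_on_mass_profile)
  then show ?thesis
    by (simp add: mass_profile_0)
qed

lemma mass_profile_less: "r > 0 \<Longrightarrow> mass_profile l r < pi / 2"
  using arctan_ubound[of "r / l"] mass_profile_denominator[of r] l
  by (simp add: mass_profile_def) (smt (verit) divide_nonneg_pos mult_pos_pos)

text \<open>Integrates the bound 2 r^2 / l^3 of the derivative, obtained by dropping r^2 from the
  denominator. The right-hand side is the leading term of the profile at 0.\<close>

lemma mass_profile_le_cubic:
  assumes "r > 0" shows "mass_profile l r \<le> 2 / 3 * (r / l)^3"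
proof -
  have "2 / 3 * (0 / l)^3 - mass_profile l 0 \<le> 2 / 3 * (r / l)^3 - mass_profile l r"
  proof (rule DERIV_nonneg_imp_nondecreasing[where f="\<lambda>r. 2 / 3 * (r / l)^3 - mass_profile l r"])
    fix x
    have "((\<lambda>r. 2 / 3 * (r / l)^3 - mass_profile l r) has_real_derivative
        2 * x^2 / l^3 - 2 * l * x^2 / (x^2 + l^2)^2) (at x)"
      using l by (auto intro!: derivative_eq_intros DERIV_mass_profile simp: power2_eq_square power3_eq_cube)
    moreover have "2 * l * x^2 / (x^2 + l^2)^2 \<le> 2 * x^2 / l^3"
    proof -
      have "(l^2)^2 \<le> (x^2 + l^2)^2"
        by (intro power_mono) auto
      then have "2 * l * x^2 / (x^2 + l^2)^2 \<le> 2 * l * x^2 / (l^2)^2"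
        using l by (intro divide_left_mono) (auto intro!: mult_pos_pos simp: sum_power2_eq_zero_iff)
      also have "\<dots> = 2 * x^2 / l^3"
        using l by (simp add: power2_eq_square power3_eq_cube)
      finally show ?thesis .
    qed
    ultimately show "\<exists>y. DERIV (\<lambda>r. 2 / 3 * (r / l)^3 - mass_profile l r) x :> y \<and> y \<ge> 0"
      by (intro exI conjI) auto
  qed (use assms in simp)
  then show ?thesis
    by (simp add: mass_profile_0)
qed

text \<open>Up to a positive factor, the left-hand side is the derivative of
  \<open>r p / (r\<^sup>2 + a\<^sup>2)\<close>, where \<open>p\<close> is the mass profile.\<close>

lemma inner_radii_slope:
  assumes "r > 0" "r^2 \<le> \<bar>a * l\<bar>"
  defines "p \<equiv> mass_profile l r"
  shows "p * (a^2 - r^2) + r * (2 * l * r^2 / (r^2 + l^2)^2) * (r^2 + a^2) > 0"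
proof -
  have p: "p > 0" "p \<le> 2 / 3 * (r / l)^3"
    using mass_profile_pos mass_profile_le_cubic assms by (simp_all add: p_def)
  have q: "r^2 + l^2 > 0"
    by (rule mass_profile_denominator)
  have s: "r * (2 * l * r^2 / (r^2 + l^2)^2) > 0"
    using assms(1) l q by simp
  show ?thesis
  \<comment> \<open>Only for r > |a| does the first summand become negative and need the cubic
    bound.\<close>
  proof (cases "r^2 \<le> a^2")
    case True
    then have "p * (a^2 - r^2) \<ge> 0" "r^2 + a^2 > 0"
      using p assms(1) by (simp_all add: add_pos_nonneg)
    then show ?thesis
      using mult_pos_pos[OF s, of "r^2 + a^2"] by linarith
  next
    case False
    have "(r^2)^2 \<le> \<bar>a * l\<bar>^2"
      using assms by (intro power_mono) auto
    \<comment> \<open>As a^2 decreases, r^2 - a^2 grows and r^2 + a^2 shrinks, so the smallest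
      admissible value a^2 = r^4 / l^2 is the worst case and may replace a^2 on both sides.\<close>
    then have a: "r^2 * (r^2 / l^2) \<le> a^2"
      using l by (simp add: power_mult_distrib power2_eq_square field_simps)
    have "p * (r^2 - a^2) \<le> 2 / 3 * (r / l)^3 * (r^2 - r^2 * (r^2 / l^2))"
      using p a False l assms(1) by (intro mult_mono) auto
    also have "\<dots> < r * (2 * l * r^2 / (r^2 + l^2)^2) * (r^2 + r^2 * (r^2 / l^2))"
    proof -
      have "2 / 3 * (r / l)^3 * (r^2 - r^2 * (r^2 / l^2)) = 2 * r^5 / (3 * l^5) * (l^2 - r^2)"
        using l by (simp add: field_simps power2_eq_square power3_eq_cube numeral_eq_Suc)
      also have "\<dots> < 2 * r^5 / (l * (r^2 + l^2))"
      proof -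
        \<comment> \<open>What remains after common factors are cancelled; the 3 stems from the
          cubic coefficient 2/3.\<close>
        have "(l^2 - r^2) * (r^2 + l^2) < 3 * l^4"
        proof -
          have "(l^2 - r^2) * (r^2 + l^2) = l^4 - r^4"
            by (simp add: algebra_simps flip: power_add)
          moreover have "l^4 > 0" "r^4 \<ge> 0"
            using l by simp_all
          ultimately show ?thesis
            by linarith
        qed
        then have "(l^2 - r^2) / (3 * l^4) < 1 / (r^2 + l^2)"
          using l q by (simp add: field_simps)
        then have "2 * r^5 / l * ((l^2 - r^2) / (3 * l^4)) < 2 * r^5 / l * (1 / (r^2 + l^2))"
          using l assms(1) by (intro mult_strict_left_mono) auto
        then show ?thesis
          using l by (simp add: numeral_eq_Suc algebra_simps)
      qed
      also have "\<dots> = r * (2 * l * r^2 / (r^2 + l^2)^2) * (r^2 + r^2 * (r^2 / l^2))"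
      proof -
        have "r^2 + r^2 * (r^2 / l^2) = r^2 * (r^2 + l^2) / l^2"
          using l by (simp add: field_simps)
        moreover have "2 * r^5 / (l * d) = r * (2 * l * r^2 / d^2) * (r^2 * d / l^2)" if "d > 0" for d
          using l that by (simp add: field_simps numeral_eq_Suc)
        ultimately show ?thesis
          using q by simp
      qed
      finally show ?thesis .
    qed
    also have "\<dots> \<le> r * (2 * l * r^2 / (r^2 + l^2)^2) * (r^2 + a^2)"
      using s a by (intro mult_left_mono) auto
    finally show ?thesis
      by (simp add: algebra_simps)
  qed
qed

lemma DEC_on_radii_dymnikova:
  assumes m: "m > 0" and R: "\<And>r. r \<in> R \<Longrightarrow> r > 0 \<and> \<bar>a * l\<bar> \<le> r^2"
  shows "DEC_on_radii (dymnikova_mass l m) a R"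
proof (rule DEC_on_radii_criterion)
  define c where "c = 2 * m / pi"
  let ?M1 = "\<lambda>r. c * (2 * l * r^2 / (r^2 + l^2)^2)"
  let ?M2 = "\<lambda>r. c * (4 * l * r * (l^2 - r^2) / (r^2 + l^2)^3)"
  have c: "c > 0"
    using m by (simp add: c_def)
  have M: "dymnikova_mass l m = (\<lambda>r. c * mass_profile l r)"
    by (simp add: fun_eq_iff dymnikova_mass_def mass_profile_def c_def)
  show "dymnikova_mass l m r > 0" if "r > 0" for r
    unfolding M using c mass_profile_pos[OF that] by simp
  show "(dymnikova_mass l m has_real_derivative ?M1 r) (at r)" for r
    unfolding M by (rule DERIV_cmult[OF DERIV_mass_profile])
  show "(?M1 has_real_derivative ?M2 r) (at r)" for r
  proof (rule DERIV_cmult)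
    have q: "r^2 + l^2 > 0"
      by (rule mass_profile_denominator)
    have "((\<lambda>r. 2 * l * r^2 / (r^2 + l^2)^2) has_real_derivative
        (4 * l * r * (r^2 + l^2)^2 - 2 * l * r^2 * (4 * r * (r^2 + l^2))) / ((r^2 + l^2)^2 * (r^2 + l^2)^2)) (at r)"
      using q l by (auto intro!: derivative_eq_intros simp: sum_power2_eq_zero_iff algebra_simps)
    also have "(4 * l * r * (r^2 + l^2)^2 - 2 * l * r^2 * (4 * r * (r^2 + l^2))) / ((r^2 + l^2)^2 * (r^2 + l^2)^2)
        = (r^2 + l^2) * (4 * l * r * (l^2 - r^2)) / ((r^2 + l^2) * (r^2 + l^2)^3)"
      by (rule arg_cong2[of _ _ _ _ "(/)"]) (simp_all add: algebra_simps power2_eq_square power3_eq_cube)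
    also have "\<dots> = 4 * l * r * (l^2 - r^2) / (r^2 + l^2)^3"
      using q by simp
    finally show "((\<lambda>r. 2 * l * r^2 / (r^2 + l^2)^2) has_real_derivative 4 * l * r * (l^2 - r^2) / (r^2 + l^2)^3) (at r)" .
  qed
  show "r > 0" if "r \<in> R" for r
    using R[OF that] by simp
  \<comment> \<open>The r^4 terms in the numerator cancel, which is why this combination is
    nonnegative at every radius.\<close>
  have q: "2 * ?M1 r + r * ?M2 r = c * (8 * l^3 * r^2 / (r^2 + l^2)^3)" for r
  proof -
    have "r^2 + l^2 > 0"
      by (rule mass_profile_denominator)
    then have "2 * l * r^2 / (r^2 + l^2)^2 = 2 * l * r^2 * (r^2 + l^2) / (r^2 + l^2)^3"
      by (simp add: power2_eq_square power3_eq_cube)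
    moreover have "2 * (c * (x / d)) + r * (c * (y / d)) = c * ((2 * x + r * y) / d)" for x y d
      by (simp add: add_divide_distrib distrib_left mult.left_commute)
    ultimately have "2 * ?M1 r + r * ?M2 r
        = c * ((2 * (2 * l * r^2 * (r^2 + l^2)) + r * (4 * l * r * (l^2 - r^2))) / (r^2 + l^2)^3)"
      by metis
    also have "2 * (2 * l * r^2 * (r^2 + l^2)) + r * (4 * l * r * (l^2 - r^2)) = 8 * l^3 * r^2"
      by (simp add: algebra_simps power2_eq_square power3_eq_cube)
    finally show ?thesis .
  qed
  show "0 \<le> 2 * ?M1 r + r * ?M2 r" for r
    unfolding q using c l mass_profile_denominator[of r] by simp
  show "(2 * ?M1 r + r * ?M2 r) * (r^2 + a^2) \<le> 4 * (r^2 * ?M1 r)" if "r \<in> R" for r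
  proof -
    have d: "r^2 + l^2 > 0"
      by (rule mass_profile_denominator)
    \<comment> \<open>Up to a common positive factor the two sides of the goal are l^2 (r^2 + a^2)
      and r^2 (r^2 + l^2); the shared l^2 r^2 drops out and a^2 l^2 <= r^4 is left.\<close>
    have "\<bar>a * l\<bar>^2 \<le> (r^2)^2"
      using R[OF that] by (intro power_mono) auto
    then have "l^2 * (r^2 + a^2) \<le> r^2 * (r^2 + l^2)"
      by (simp add: power_mult_distrib algebra_simps power2_eq_square)
    then have "c * (8 * l * r^2 / (r^2 + l^2)^3) * (l^2 * (r^2 + a^2))
        \<le> c * (8 * l * r^2 / (r^2 + l^2)^3) * (r^2 * (r^2 + l^2))"
      using c l d by (intro mult_left_mono) auto
    moreover have "c * (8 * l * r^2 / d^3) * (r^2 * d) = 4 * (r^2 * (c * (2 * l * r^2 / d^2)))" if "d > 0" for d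
      using that by (simp add: field_simps power2_eq_square power3_eq_cube)
    note this[OF d]
    ultimately show ?thesis
      unfolding q by (simp add: power2_eq_square power3_eq_cube mult_ac)
  qed
qed

section \<open>The horizon mass and its minimum\<close>

lemma horizon_mass_eq: "horizon_mass l a r = pi * (r\<^sup>2 + a\<^sup>2) / (4 * r * mass_profile l r)"
  by (simp add: horizon_mass_def mass_profile_def field_simps)

lemma horizon_mass_pos: "r > 0 \<Longrightarrow> horizon_mass l a r > 0"
  using mass_profile_pos[of r] by (simp add: horizon_mass_eq add_pos_nonneg)

text \<open>The cubic bound on the profile would give growth like r^-4. It is weakened to 1 / r by
  \<open>r \<le> 1\<close>, so that the cut-off radius in the search for the minimum can be solved
  for directly.\<close>

lemma horizon_mass_ge_near_0:
  assumes "0 < r" "r \<le> 1"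
  shows "3 * pi * a\<^sup>2 * l^3 / (8 * r) \<le> horizon_mass l a r"
proof -
  have p: "mass_profile l r > 0" "mass_profile l r \<le> 2 / 3 * (r / l)^3"
    using mass_profile_pos mass_profile_le_cubic assms by simp_all
  have "r * mass_profile l r \<le> 1 * (2 / 3 * (r / l)^3)"
    using p assms by (intro mult_mono) auto
  also have "\<dots> = 2 * r^3 / (3 * l^3)"
    by (simp add: power_divide)
  also have "\<dots> \<le> 2 * r / (3 * l^3)"
    using assms l power_le_one_iff[of r 2] by (intro divide_right_mono) (auto simp: power3_eq_cube mult_le_one)
  finally have "4 * r * mass_profile l r \<le> 8 * r / (3 * l^3)"
    by simp
  then have "pi * a\<^sup>2 / (8 * r / (3 * l^3)) \<le> pi * (r\<^sup>2 + a\<^sup>2) / (4 * r * mass_profile l r)"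
    using p assms l by (intro frac_le) auto
  then show ?thesis
    by (simp add: horizon_mass_eq mult_ac)
qed

lemma horizon_mass_ge_linear:
  assumes "0 < r" shows "r / 2 \<le> horizon_mass l a r"
proof -
  have p: "mass_profile l r > 0" "mass_profile l r < pi / 2"
    using mass_profile_pos mass_profile_less assms by simp_all
  have "pi * r\<^sup>2 / (4 * r * (pi / 2)) \<le> pi * (r\<^sup>2 + a\<^sup>2) / (4 * r * mass_profile l r)"
    using p assms by (intro frac_le) auto
  then show ?thesis
    using assms by (simp add: horizon_mass_eq power2_eq_square)
qed

text \<open>m_h tends to infinity at both ends of the half-line, at 0 because
  \<open>a \<noteq> 0\<close>, so the minimum over a suitable compact interval is global.\<close>

lemma horizon_mass_has_minimum:
  assumes "a \<noteq> 0"
  obtains r0 where "r0 > 0" "\<And>r. r > 0 \<Longrightarrow> horizon_mass l a r0 \<le> horizon_mass l a r"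
proof -
  define h1 where "h1 = horizon_mass l a 1"
  \<comment> \<open>The two lower bounds reach the reference value \<open>h1\<close> at these radii;
    capping with 1 keeps the radius 1, where \<open>h1\<close> is attained, inside the
    interval.\<close>
  define \<epsilon> where "\<epsilon> = min 1 (3 * pi * a\<^sup>2 * l^3 / (8 * h1))"
  define N where "N = max 1 (2 * h1)"
  have h1: "h1 > 0"
    by (simp add: h1_def horizon_mass_pos)
  have \<epsilon>: "\<epsilon> > 0" "\<epsilon> \<le> 1"
    using h1 l assms by (simp_all add: \<epsilon>_def)
  have "continuous_on {\<epsilon>..N} (horizon_mass l a)"
    unfolding horizon_mass_eq[abs_def] using \<epsilon> mass_profile_pos
    by (intro continuous_intros continuous_on_mass_profile) (auto simp: less_le)
  moreover have "1 \<in> {\<epsilon>..N}"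
    using \<epsilon> by (simp add: N_def)
  ultimately obtain r0 where r0: "r0 \<in> {\<epsilon>..N}" "\<And>r. r \<in> {\<epsilon>..N} \<Longrightarrow> horizon_mass l a r0 \<le> horizon_mass l a r"
    using continuous_attains_inf[of "{\<epsilon>..N}" "horizon_mass l a"] by auto
  have "horizon_mass l a r0 \<le> horizon_mass l a r" if "r > 0" for r
  proof -
    consider "r < \<epsilon>" | "r \<in> {\<epsilon>..N}" | "r > N"
      by fastforce
    then show ?thesis
    proof cases
      case 1
      then have "r \<le> 3 * pi * a\<^sup>2 * l^3 / (8 * h1)" "r \<le> 1"
        by (auto simp: \<epsilon>_def)
      then have "h1 \<le> 3 * pi * a\<^sup>2 * l^3 / (8 * r)"
        using that h1 by (simp add: field_simps)
      then show ?thesis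
        using horizon_mass_ge_near_0[OF that \<open>r \<le> 1\<close>, of a] r0(2)[OF \<open>1 \<in> {\<epsilon>..N}\<close>] by (simp add: h1_def)
    next
      case 2
      then show ?thesis by (rule r0(2))
    next
      case 3
      then have "h1 \<le> r / 2"
        by (simp add: N_def)
      then show ?thesis
        using horizon_mass_ge_linear[OF that, of a] r0(2)[OF \<open>1 \<in> {\<epsilon>..N}\<close>] by (simp add: h1_def)
    qed
  qed
  then show thesis
    using that[of r0] r0(1) \<epsilon>(1) by simp
qed

text \<open>\<open>?k\<close> is the reciprocal of m_h up to the factor pi / 4, so \<open>r0\<close>
  maximises it and its derivative vanishes there. By \<open>inner_radii_slope\<close> that
  derivative is positive if r0^2 <= |a l|.\<close>

lemma minimum_radius_bound:
  assumes "r0 > 0" and min: "\<And>r. r > 0 \<Longrightarrow> horizon_mass l a r0 \<le> horizon_mass l a r"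
  shows "\<bar>a * l\<bar> < r0\<^sup>2"
proof (rule ccontr)
  assume "\<not> \<bar>a * l\<bar> < r0\<^sup>2"
  then have slope: "mass_profile l r0 * (a^2 - r0^2) + r0 * (2 * l * r0^2 / (r0^2 + l^2)^2) * (r0^2 + a^2) > 0"
    (is "?D > 0")
    using inner_radii_slope[of r0 a] assms(1) by simp
  let ?k = "\<lambda>r. r * mass_profile l r / (r\<^sup>2 + a\<^sup>2)"
  have P: "r\<^sup>2 + a\<^sup>2 > 0" if "r > 0" for r
    using that by (simp add: add_pos_nonneg)
  have inverse_mono: "x \<le> y" if "pi / 4 / y \<le> pi / 4 / x" "x > 0" "y > 0" for x y :: real
    using that by (simp add: field_simps)
  have k: "?k r \<le> ?k r0" if "r > 0" for r
  proof -
    have "horizon_mass l a r = pi / 4 / ?k r" for r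
      by (simp add: horizon_mass_eq)
    moreover have "?k r > 0" "?k r0 > 0"
      using that assms(1) P mass_profile_pos by simp_all
    ultimately show ?thesis
      using min[OF that] inverse_mono by simp
  qed
  have "(?k has_real_derivative ((mass_profile l r0 + r0 * (2 * l * r0^2 / (r0^2 + l^2)^2)) * (r0\<^sup>2 + a\<^sup>2)
      - r0 * mass_profile l r0 * (2 * r0)) / ((r0\<^sup>2 + a\<^sup>2) * (r0\<^sup>2 + a\<^sup>2))) (at r0)"
    using P[OF assms(1)] assms(1) by (auto intro!: derivative_eq_intros DERIV_mass_profile)
  \<comment> \<open>The neighbourhood of \<open>r0\<close> has radius \<open>r0\<close> itself, so
    it contains positive radii only, as \<open>k\<close> requires.\<close>
  then have "((mass_profile l r0 + r0 * (2 * l * r0^2 / (r0^2 + l^2)^2)) * (r0\<^sup>2 + a\<^sup>2)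
      - r0 * mass_profile l r0 * (2 * r0)) / ((r0\<^sup>2 + a\<^sup>2) * (r0\<^sup>2 + a\<^sup>2)) = 0"
    by (rule DERIV_local_max[OF _ assms(1)]) (use k in auto)
  moreover have "(mass_profile l r0 + r0 * (2 * l * r0^2 / (r0^2 + l^2)^2)) * (r0\<^sup>2 + a\<^sup>2)
      - r0 * mass_profile l r0 * (2 * r0) = ?D"
    by (simp add: distrib_right left_diff_distrib right_diff_distrib distrib_left power2_eq_square)
  ultimately show False
    using slope P[OF assms(1)] by simp
qed

section \<open>Roots of Delta and the event horizon radius\<close>

lemma Delta_dymnikova:
  "Delta_fn (dymnikova_mass l m) a r = r\<^sup>2 + a\<^sup>2 - 4 * m / pi * (r * mass_profile l r)"
  by (simp add: Delta_fn_def dymnikova_mass_def mass_profile_def)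

lemma Delta_dymnikova_nonpos_iff:
  assumes "r > 0"
  shows "Delta_fn (dymnikova_mass l m) a r \<le> 0 \<longleftrightarrow> horizon_mass l a r \<le> m"
  using assms mass_profile_pos[OF assms]
  by (simp add: Delta_dymnikova horizon_mass_eq field_simps)

lemma Delta_dymnikova_pos:
  assumes "r > 0" "m > 0" "r \<ge> 2 * m"
  shows "Delta_fn (dymnikova_mass l m) a r > 0"
proof -
  have "4 * m / pi * (r * mass_profile l r) < 4 * m / pi * (r * (pi / 2))"
    using assms mass_profile_less[OF assms(1)] by (intro mult_strict_left_mono) auto
  also have "\<dots> = 2 * m * r"
    by simp
  also have "\<dots> \<le> r\<^sup>2"
    using assms by (simp add: power2_eq_square)
  finally show ?thesis
    unfolding Delta_dymnikova using zero_le_power2[of a] by linarith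
qed

text \<open>The \<open>GREATEST\<close> operator is meaningful only once a largest root is
  exhibited. Delta is nonpositive at \<open>r0\<close> and positive from 2 m on, since the mass
  stays below m; so there is a root in between, and the roots there form a compact set.\<close>

lemma event_horizon_exists:
  assumes m: "m > 0" and r0: "r0 > 0" "horizon_mass l a r0 \<le> m"
  defines "r\<^sub>2 \<equiv> event_horizon_radius l a m"
  shows "r0 \<le> r\<^sub>2" "Delta_fn (dymnikova_mass l m) a r\<^sub>2 = 0"
    "\<And>r. 0 < r \<Longrightarrow> Delta_fn (dymnikova_mass l m) a r = 0 \<Longrightarrow> r \<le> r\<^sub>2"
proof -
  let ?D = "Delta_fn (dymnikova_mass l m) a"
  define Z where "Z = {r \<in> {r0..2 * m}. ?D r = 0}"
  have D0: "?D r0 \<le> 0"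
    using Delta_dymnikova_nonpos_iff[OF r0(1)] r0(2) by simp
  have large: "r < 2 * m" if "r > 0" "?D r \<le> 0" for r
    using Delta_dymnikova_pos[OF that(1) m, of a] that(2) by (cases "r < 2 * m") auto
  have cont: "continuous_on {r0..2 * m} ?D"
    unfolding Delta_dymnikova[abs_def] by (intro continuous_intros continuous_on_mass_profile)
  have "?D (2 * m) > 0"
    using Delta_dymnikova_pos[of "2 * m" m] m by simp
  then obtain z where "z \<in> {r0..2 * m}" "?D z = 0"
    using IVT'[of ?D r0 0 "2 * m"] D0 large[OF r0(1) D0] cont by auto
  then have "Z \<noteq> {}"
    by (auto simp: Z_def)
  moreover have "compact Z"
  proof -
    have "closed Z"
      unfolding Z_def by (rule continuous_closed_preimage_constant[OF cont closed_atLeastAtMost])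
    moreover have "bounded Z"
      by (rule bounded_subset[of "{r0..2 * m}"]) (auto simp: Z_def)
    ultimately show ?thesis
      by (simp add: compact_eq_bounded_closed)
  qed
  ultimately obtain s where s: "s \<in> Z" "\<forall>r\<in>Z. r \<le> s"
    using compact_attains_sup[of Z] by blast
  \<comment> \<open>\<open>Z\<close> leaves out roots below \<open>r0\<close>, such as an inner
    horizon, but these are smaller than \<open>s\<close> because \<open>s\<close> is at least
    \<open>r0\<close>.\<close>
  have greatest: "r \<le> s" if "0 < r" "?D r = 0" for r
  proof (cases "r < r0")
    case True
    then show ?thesis
      using s(1) by (simp add: Z_def)
  next
    case False
    then have "r \<in> Z"
      using large[OF that(1)] that(2) by (simp add: Z_def)
    then show ?thesis
      using s(2) by blast
  qed
  have "r\<^sub>2 = s"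
    unfolding r\<^sub>2_def event_horizon_radius_def
    by (rule Greatest_equality) (use s(1) r0(1) greatest in \<open>auto simp: Z_def\<close>)
  then show "r0 \<le> r\<^sub>2" "?D r\<^sub>2 = 0" "\<And>r. 0 < r \<Longrightarrow> ?D r = 0 \<Longrightarrow> r \<le> r\<^sub>2"
    using s(1) greatest by (simp_all add: Z_def)
qed

end

theorem mainTheorem2:
  fixes l a m :: real
  assumes "l > 0" and "a \<noteq> 0" and "m \<ge> extremal_mass l a"
  defines "M \<equiv> dymnikova_mass l m" and "r\<^sub>2 \<equiv> event_horizon_radius l a m"
  shows "0 < extremal_mass l a
    \<and> (\<exists>r>0. horizon_mass l a r = extremal_mass l a)
    \<and> (\<forall>r>0. extremal_mass l a \<le> horizon_mass l a r)
    \<and> 0 < r\<^sub>2 \<and> Delta_fn M a r\<^sub>2 = 0 \<and> (\<forall>r>0. Delta_fn M a r = 0 \<longrightarrow> r \<le> r\<^sub>2)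
    \<and> DEC_on_radii M a {sqrt \<bar>a * l\<bar>..}
    \<and> sqrt \<bar>a * l\<bar> < r\<^sub>2
    \<and> DEC_on_radii M a {r\<^sub>2..}"
proof -
  obtain r0 where r0: "r0 > 0" and min: "\<And>r. r > 0 \<Longrightarrow> horizon_mass l a r0 \<le> horizon_mass l a r"
    using horizon_mass_has_minimum[OF assms(1,2)] by blast
  \<comment> \<open>The infimum in \<open>extremal_mass\<close> is attained, so m_ex is a genuine
    minimum and inherits positivity from m_h.\<close>
  have ext: "extremal_mass l a = horizon_mass l a r0"
    unfolding extremal_mass_def by (rule cInf_eq_minimum) (use r0 min in auto)
  have ext_pos: "extremal_mass l a > 0"
    using horizon_mass_pos[OF assms(1) r0] ext by simp
  with assms(3) have m: "m > 0"
    by simp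
  have r0_large: "sqrt \<bar>a * l\<bar> < r0"
    using minimum_radius_bound[OF assms(1) r0 min] r0 real_less_lsqrt by simp
  note horizon = event_horizon_exists[OF assms(1) m r0, of a, folded r\<^sub>2_def M_def]
  have hm: "horizon_mass l a r0 \<le> m"
    using assms(3) ext by simp
  have al: "\<bar>a * l\<bar> > 0"
    using assms by simp
  \<comment> \<open>Left general in \<open>R\<close> because it is used for both half-lines; the one
    starting at the event horizon is covered through sqrt |a l| < r0 <=
    \<open>r\<^sub>2\<close>.\<close>
  have DEC: "DEC_on_radii M a R" if "\<And>r. r \<in> R \<Longrightarrow> sqrt \<bar>a * l\<bar> \<le> r" for R
    unfolding M_def
  proof (rule DEC_on_radii_dymnikova[OF assms(1) m])
    fix r assume "r \<in> R"
    then have r: "sqrt \<bar>a * l\<bar> \<le> r"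
      by (rule that)
    moreover have "sqrt \<bar>a * l\<bar> > 0"
      using al by simp
    ultimately show "r > 0 \<and> \<bar>a * l\<bar> \<le> r\<^sup>2"
      using sqrt_le_D[OF r] by linarith
  qed
  show ?thesis
    using ext ext_pos r0 min horizon[OF hm] r0_large DEC[of "{sqrt \<bar>a * l\<bar>..}"] DEC[of "{r\<^sub>2..}"] by auto
qed

end
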